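(* For an integer $d\ge 3$ and a real number $\theta$, consider the inequality $$ \left( \int_{\mathbb{R}^d} |\nabla u|^2\,dx - \frac{(d-2)^2}{4} \sup_{y\in \mathbb{R}^d} \int_{\mathbb{R}^d}\frac{|u(x)|^2}{|x-y|^2} \,dx \right)^{\theta} \left( \sup_{y\in \mathbb{R}^d} \int_{\mathbb{R}^d}\frac{|u(x)|^2}{|x-y|^2}\, dx \right)^{1-\theta} \ge C \| u\|_{L^{2^*}(\mathbb{R}^d)}^2, \qquad (\ast) $$ where $2^*=2d/(d-2)$. If $d=3$ and $\theta=1/3$, then there exists a constant $C=C(d,\theta)>0$ such that $(\ast)$ holds for all $u\in \dot H^1(\mathbb{R}^d)$. Moreover, if $d\ge 4$ or if $\theta\neq 1/3$, then there is no constant $C>0$ such that $(\ast)$ holds for all nonzero $u\in \dot H^1(\mathbb{R}^d)$.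
   Context: $\dot H^1(\mathbb{R}^d)$, $d\ge 3$, is the usual homogeneous Sobolev space (the completion of $C_c^\infty(\mathbb{R}^d)$ with respect to $\|\nabla u\|_{L^2}$, viewed as a subspace of $L^{2^*}(\mathbb{R}^d)$). By Hardy's inequality $\int_{\mathbb{R}^d}|\nabla u|^2\,dx\ge \frac{(d-2)^2}{4}\int_{\mathbb{R}^d}\frac{|u(x)|^2}{|x|^2}\,dx$ and translation invariance, the first bracket in the inequality is nonnegative for every $u\in\dot H^1(\mathbb{R}^d)$. *)

theory Defs
  imports "HOL-Analysis.Analysis"
begin

text \<open>
  Functions live on \<open>real ^ 'n\<close>, so the dimension is \<open>CARD('n)\<close>. The scalars \<open>'k\<close> range over
  \<open>{real_normed_field, euclidean_space}\<close>, a sort that has exactly the real and the complex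
  numbers (up to isomorphism) as models.
\<close>

definition partial_deriv :: "'n::finite \<Rightarrow> (real ^ 'n \<Rightarrow> 'k::real_normed_vector) \<Rightarrow> real ^ 'n \<Rightarrow> 'k"
  where "partial_deriv i f x = frechet_derivative f (at x) (axis i 1)"

definition gradient :: "(real ^ 'n::finite \<Rightarrow> 'k::real_normed_vector) \<Rightarrow> real ^ 'n \<Rightarrow> 'k ^ 'n"
  where "gradient f x = (\<chi> i. partial_deriv i f x)"

text \<open>
  Differentiability of every iterated partial derivative makes all of them continuous, so
  \<open>\<forall>m. times_differentiable m f\<close> is \<open>C\<^sup>\<infinity>\<close> smoothness.
\<close>

primrec times_differentiable :: "nat \<Rightarrow> (real ^ 'n::finite \<Rightarrow> 'k::real_normed_vector) \<Rightarrow> bool"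
  where
    "times_differentiable 0 f \<longleftrightarrow> continuous_on UNIV f"
  | "times_differentiable (Suc m) f \<longleftrightarrow>
       f differentiable_on UNIV \<and> (\<forall>i. times_differentiable m (partial_deriv i f))"

definition smooth_compact_support :: "(real ^ 'n::finite \<Rightarrow> 'k::real_normed_vector) set"
  where "smooth_compact_support =
    {f. (\<forall>m. times_differentiable m f) \<and> compact (closure {x. f x \<noteq> 0})}"

definition Lp_space :: "real \<Rightarrow> (real ^ 'n::finite \<Rightarrow> 'v::euclidean_space) set"
  where "Lp_space p =
    {f. f \<in> borel_measurable lebesgue \<and> integrable lebesgue (\<lambda>x. norm (f x) powr p)}"

definition Lp_norm :: "real \<Rightarrow> (real ^ 'n::finite \<Rightarrow> 'v::euclidean_space) \<Rightarrow> real"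
  where "Lp_norm p f = (LINT x|lebesgue. norm (f x) powr p) powr (1 / p)"

definition sobolev_exponent :: "'n::finite itself \<Rightarrow> real"
  where "sobolev_exponent _ = 2 * real CARD('n) / (real CARD('n) - 2)"

text \<open>
  \<open>dot_H1_gradient u g\<close>: the pair \<open>(u, g)\<close> lies in the closure of
  \<open>{(\<phi>, \<nabla>\<phi>). \<phi> \<in> C\<^sub>c\<^sup>\<infinity>}\<close> in \<open>L\<^sup>p \<times> L\<^sup>2\<close> with \<open>p\<close> the Sobolev exponent, i.e. \<open>u\<close> represents, inside
  \<open>L\<^sup>p\<close>, the element of the completion given by a sequence that is Cauchy for \<open>\<parallel>\<nabla>\<phi>\<parallel>\<close>, and \<open>g\<close> is
  its (weak) gradient. The gradient is unique up to null sets, so that the choice in \<open>dot_H1_grad\<close>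
  does not affect integrals.
\<close>

definition dot_H1_gradient ::
    "(real ^ 'n::finite \<Rightarrow> 'k::{real_normed_field,euclidean_space}) \<Rightarrow> (real ^ 'n \<Rightarrow> 'k ^ 'n) \<Rightarrow> bool"
  where "dot_H1_gradient u g \<longleftrightarrow>
    u \<in> Lp_space (sobolev_exponent TYPE('n)) \<and> g \<in> Lp_space 2 \<and>
    (\<exists>\<phi>. (\<forall>m::nat. \<phi> m \<in> smooth_compact_support) \<and>
         (\<lambda>m. Lp_norm (sobolev_exponent TYPE('n)) (\<lambda>x. \<phi> m x - u x)) \<longlonglongrightarrow> 0 \<and>
         (\<lambda>m. Lp_norm 2 (\<lambda>x. gradient (\<phi> m) x - g x)) \<longlonglongrightarrow> 0)"

definition dot_H1 :: "(real ^ 'n::finite \<Rightarrow> 'k::{real_normed_field,euclidean_space}) set"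
  where "dot_H1 = {u. \<exists>g. dot_H1_gradient u g}"

definition dot_H1_grad ::
    "(real ^ 'n::finite \<Rightarrow> 'k::{real_normed_field,euclidean_space}) \<Rightarrow> real ^ 'n \<Rightarrow> 'k ^ 'n"
  where "dot_H1_grad u = (SOME g. dot_H1_gradient u g)"

definition dirichlet_energy ::
    "(real ^ 'n::finite \<Rightarrow> 'k::{real_normed_field,euclidean_space}) \<Rightarrow> real"
  where "dirichlet_energy u = (LINT x|lebesgue. (norm (dot_H1_grad u x))\<^sup>2)"

text \<open>
  For \<open>u \<in> dot_H1\<close> and \<open>CARD('n) \<ge> 3\<close>, Hardy's inequality says that the integrals below converge
  and are bounded uniformly in \<open>y\<close>, so the real-valued supremum is the true one.
\<close>

definition hardy_sup ::
    "(real ^ 'n::finite \<Rightarrow> 'k::{real_normed_field,euclidean_space}) \<Rightarrow> real"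
  where "hardy_sup u = (SUP y. LINT x|lebesgue. (norm (u x))\<^sup>2 / (norm (x - y))\<^sup>2)"

text \<open>
  Both bases of \<open>powr\<close> are positive for \<open>u\<close> in \<open>dot_H1\<close> that do not vanish almost everywhere
  (the supremum is attained and Hardy's inequality is strict), so every real \<open>\<theta>\<close> is meaningful;
  for \<open>u = 0\<close> both vanish, and \<open>0 powr a = 0\<close>.
\<close>

definition hardy_sobolev_inequality ::
    "real \<Rightarrow> real \<Rightarrow> (real ^ 'n::finite \<Rightarrow> 'k::{real_normed_field,euclidean_space}) \<Rightarrow> bool"
  where "hardy_sobolev_inequality \<theta> C u \<longleftrightarrow>
    (dirichlet_energy u - (real CARD('n) - 2)\<^sup>2 / 4 * hardy_sup u) powr \<theta>
      * hardy_sup u powr (1 - \<theta>)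
    \<ge> C * (Lp_norm (sobolev_exponent TYPE('n)) u)\<^sup>2"

end

theory Submission
  imports Defs
begin

text \<open>
  Write \<open>D\<close> for the Dirichlet energy, \<open>h(y)\<close> for the Hardy integral centred at \<open>y\<close>, \<open>H\<close> for its
  supremum and \<open>X\<close> for the \<open>p\<close>-th power of the \<open>L\<^sup>p\<close> norm, \<open>p\<close> being the Sobolev exponent.

  In dimension three, truncation at a height \<open>\<lambda>\<close> and averaging over balls of radius \<open>\<sim> H / \<lambda>^2\<close> give
  the improved Sobolev inequality \<open>X \<le> C D H^2\<close>, hence \<open>X \<le> C D^3\<close> by Hardy's inequality.
  The substitution \<open>v(x) = |x| powr ((k-1)/2) u(|x| powr (k-1) x)\<close>, i.e. a dilation by \<open>k \<ge> 1\<close> of the logarithmic radial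
  variable, divides \<open>X\<close> by \<open>k\<close> and turns \<open>D\<close> into at most \<open>(D + k^2 (D - h(0)/4)) / k\<close>. Optimising
  \<open>X \<le> C D^3\<close> over \<open>k\<close> gives \<open>X \<le> C D^2 (D - h(y)/4)\<close>. If \<open>D - h(y)/4 \<le> H\<close>, then \<open>D \<le> 2 H\<close> and the
  latter bound is at most \<open>C (D - h(y)/4) H^2\<close>; otherwise \<open>D \<le> 2 (D - h(y)/4)\<close> and the improved Sobolev
  inequality gives the same. Density extends this to the homogeneous Sobolev space.

  For the converse, the same substitution with \<open>k \<rightarrow> 0\<close>, applied to a radial function, forces
  \<open>\<theta> \<le> 1/d\<close>, and sums of \<open>N \<rightarrow> \<infinity>\<close> bumps far apart force \<open>\<theta> \<ge> 1 - 2/d\<close>. Both hold only if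
  \<open>d = 3\<close> and \<open>\<theta> = 1/3\<close>.
\<close>

section \<open>Continuously differentiable functions of compact support\<close>

text \<open>Two quantities resist a common treatment: the supremum \<open>H\<close> and the deficit
  \<open>D - h(y)/4\<close>. Dilating the logarithmic radius about a centre exposes the deficit
  there, because in logarithmic variables only the radial derivative is affected, but it gives no
  control of Hardy integrals about other centres. Hence the dilated function is fed only into the
  plain bound \<open>X \<le> C D^3\<close>, in which no supremum occurs, and \<open>H\<close>
  returns afterwards through its comparison with the deficit. The averaging argument is
  complementary: each point of a level set serves as the centre of a Hardy integral.

  The estimates are proved for C1 functions of compact support, a class that truncation and cutoff
  preserve, as does the dilation if the function vanishes near the centre. Removing a neighbourhood
  of the centre costs nothing in the limit, because Hardy's inequality dominates the gradient of the
  cutoff.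

  The Dirichlet energy is defined through a choice of gradient. The positive part works with any
  admissible gradient; the counterexamples need the value of the energy, hence uniqueness of the
  gradient.\<close>

definition C1 :: "(real ^ 'n::finite \<Rightarrow> 'v::real_normed_vector) \<Rightarrow> bool"
  where "C1 f \<longleftrightarrow> f differentiable_on UNIV \<and> (\<forall>i. continuous_on UNIV (partial_deriv i f))"

definition C1c :: "(real ^ 'n::finite \<Rightarrow> 'v::real_normed_vector) \<Rightarrow> bool"
  where "C1c f \<longleftrightarrow> C1 f \<and> (\<exists>R. \<forall>x. R < norm x \<longrightarrow> f x = 0)"

section \<open>Calculus of partial derivatives\<close>

lemma partial_deriv_eq:
  assumes "(f has_derivative f') (at x)"
  shows "partial_deriv i f x = f' (axis i 1)"
  unfolding partial_deriv_def using frechet_derivative_at[OF assms] by simp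

lemma has_derivative_partial:
  fixes f :: "real ^ 'n::finite \<Rightarrow> 'v::real_normed_vector"
  assumes "f differentiable at x"
  shows "(f has_derivative (\<lambda>h. \<Sum>i\<in>UNIV. (h $ i) *\<^sub>R partial_deriv i f x)) (at x)"
proof -
  define f' where "f' = frechet_derivative f (at x)"
  have f': "(f has_derivative f') (at x)"
    unfolding f'_def using assms by (simp add: frechet_derivative_works)
  then have lin: "linear f'" by (rule has_derivative_linear)
  have "f' h = (\<Sum>i\<in>UNIV. (h $ i) *\<^sub>R partial_deriv i f x)" for h
  proof -
    have "f' h = f' (\<Sum>i\<in>UNIV. (h $ i) *\<^sub>R axis i 1)"
      by (subst basis_expansion[symmetric]) (simp add: scalar_mult_eq_scaleR)
    also have "\<dots> = (\<Sum>i\<in>UNIV. (h $ i) *\<^sub>R f' (axis i 1))"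
      by (simp add: linear_sum[OF lin] linear_scale[OF lin])
    finally show ?thesis by (simp add: partial_deriv_eq[OF f'])
  qed
  then have "f' = (\<lambda>h. \<Sum>i\<in>UNIV. (h $ i) *\<^sub>R partial_deriv i f x)" by (rule ext)
  with f' show ?thesis by simp
qed

lemma C1_differentiable: "C1 f \<Longrightarrow> f differentiable at x"
  by (auto simp: C1_def differentiable_on_def)

lemma C1_continuous: "C1 f \<Longrightarrow> continuous_on UNIV f"
  by (auto simp: C1_def intro: differentiable_imp_continuous_on)

lemma C1_continuous_partial: "C1 f \<Longrightarrow> continuous_on UNIV (partial_deriv i f)"
  by (simp add: C1_def)

lemma partial_scaleR:
  assumes "a differentiable at x" "f differentiable at x"
  shows "partial_deriv i (\<lambda>x. a x *\<^sub>R f x) x = a x *\<^sub>R partial_deriv i f x + partial_deriv i a x *\<^sub>R f x"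
  by (rule partial_deriv_eq[OF has_derivative_scaleR[OF assms(1)[unfolded frechet_derivative_works] assms(2)[unfolded frechet_derivative_works]], of i,
    folded partial_deriv_def])

lemma partial_inner:
  assumes "f differentiable at x" "g differentiable at x"
  shows "partial_deriv i (\<lambda>x. f x \<bullet> g x) x = f x \<bullet> partial_deriv i g x + partial_deriv i f x \<bullet> g x"
  by (rule partial_deriv_eq[OF has_derivative_inner[OF assms(1)[unfolded frechet_derivative_works] assms(2)[unfolded frechet_derivative_works]], of i,
    folded partial_deriv_def])

lemma partial_norm_sq:
  fixes f :: "real ^ 'n::finite \<Rightarrow> 'v::real_inner"
  assumes "f differentiable at x"
  shows "partial_deriv i (\<lambda>x. (norm (f x))^2) x = 2 * (f x \<bullet> partial_deriv i f x)"
  unfolding power2_norm_eq_inner partial_inner[OF assms assms] by (simp add: inner_commute)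

lemma partial_compose:
  assumes "(F has_real_derivative F') (at (g x))" "g differentiable at x"
  shows "partial_deriv i (\<lambda>x. F (g x)) x = F' * partial_deriv i g x"
  by (rule partial_deriv_eq[OF has_derivative_compose[OF assms(2)[unfolded frechet_derivative_works] assms(1)[unfolded has_field_derivative_def]], of i,
    folded partial_deriv_def])

lemma partial_diff:
  assumes "f differentiable at x" "g differentiable at x"
  shows "partial_deriv i (\<lambda>x. f x - g x) x = partial_deriv i f x - partial_deriv i g x"
  by (rule partial_deriv_eq[OF has_derivative_diff[OF assms(1)[unfolded frechet_derivative_works] assms(2)[unfolded frechet_derivative_works]], of i,
    folded partial_deriv_def])

lemma has_derivative_coord: "((\<lambda>x. (x - y) $ j) has_derivative (\<lambda>h. h $ j)) (at (x::real^'n))"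
proof -
  have "((\<lambda>x. x $ j - y $ j) has_derivative (\<lambda>h. h $ j - 0)) (at x)"
    by (intro has_derivative_diff has_derivative_const bounded_linear_imp_has_derivative bounded_linear_vec_nth)
  then show ?thesis by simp
qed

lemma partial_coord: "partial_deriv i (\<lambda>x. (x - y) $ j) x = (if i = j then 1 else 0)"
  using partial_deriv_eq[OF has_derivative_coord, of i y j x] by (simp add: axis_def)

lemma differentiable_coord: "(\<lambda>x. (x - y) $ j) differentiable at (x::real^'n)"
  unfolding differentiable_def using has_derivative_coord by blast

lemma C1_coord: "C1 (\<lambda>x::real^'n. (x - y) $ j)"
  unfolding C1_def differentiable_on_def partial_coord[abs_def] using differentiable_coord by auto

lemma partial_dist_sq: "partial_deriv i (\<lambda>x. (norm (x - y))^2) x = 2 * (x - y) $ i"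
proof -
  have "((\<lambda>x. (norm (x - y))^2) has_derivative (\<lambda>h. 2 * ((x - y) \<bullet> h))) (at x)"
    unfolding power2_norm_eq_inner by (auto intro!: derivative_eq_intros simp: inner_commute)
  from partial_deriv_eq[OF this, of i] show ?thesis by (simp add: inner_axis)
qed

lemma differentiable_dist_sq: "(\<lambda>x. (norm (x - y))^2) differentiable at (x::real^'n)"
  unfolding power2_norm_eq_inner differentiable_def by (auto intro!: derivative_eq_intros exI)

lemma C1_dist_sq: "C1 (\<lambda>x::real^'n. (norm (x - y))^2)"
  unfolding C1_def differentiable_on_def partial_dist_sq[abs_def]
  using differentiable_dist_sq by (auto intro!: continuous_intros)

text \<open>The partial derivatives enter through an explicit formula \<open>p\<close>; the
  algebraic closure properties below then follow by resolving a product or difference rule against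
  the second assumption.\<close>

lemma C1I:
  assumes "\<And>x. f differentiable at x" "\<And>i x. partial_deriv i f x = p i x" "\<And>i. continuous_on UNIV (p i)"
  shows "C1 f"
proof -
  have "partial_deriv i f = p i" for i by (rule ext) (rule assms(2))
  with assms show ?thesis by (simp add: C1_def differentiable_on_def)
qed

lemma C1_scaleR:
  assumes "C1 a" "C1 f"
  shows "C1 (\<lambda>x. a x *\<^sub>R f x)"
  by (rule C1I[OF _ partial_scaleR])
    (intro differentiable_scaleR continuous_on_add continuous_on_scaleR C1_continuous C1_continuous_partial
      C1_differentiable[OF assms(1)] C1_differentiable[OF assms(2)] assms)+

lemma C1_mult: "C1 a \<Longrightarrow> C1 f \<Longrightarrow> C1 (\<lambda>x. a x * f x :: real)"
  using C1_scaleR[of a f] by simp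

lemma C1_inner:
  assumes "C1 f" "C1 g"
  shows "C1 (\<lambda>x. f x \<bullet> g x)"
  by (rule C1I[OF _ partial_inner])
    (intro differentiable_inner continuous_on_add continuous_on_inner C1_continuous C1_continuous_partial
      C1_differentiable[OF assms(1)] C1_differentiable[OF assms(2)] assms)+

lemma C1_norm_sq: "C1 f \<Longrightarrow> C1 (\<lambda>x. (norm (f x :: 'v::real_inner))^2)"
  unfolding power2_norm_eq_inner by (rule C1_inner)

lemma C1_diff:
  assumes "C1 f" "C1 g"
  shows "C1 (\<lambda>x. f x - g x)"
  by (rule C1I[OF _ partial_diff])
    (intro differentiable_diff continuous_on_diff C1_continuous C1_continuous_partial
      C1_differentiable[OF assms(1)] C1_differentiable[OF assms(2)] assms)+

lemma C1_compose:
  assumes F: "\<And>x. (F has_real_derivative F' (g x)) (at (g x))" and "continuous_on UNIV (\<lambda>x. F' (g x))" "C1 g"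
  shows "C1 (\<lambda>x. F (g x))"
proof (rule C1I)
  fix x
  have "F differentiable at (g x)"
    using F[of x] real_differentiable_def by blast
  then show "(\<lambda>x. F (g x)) differentiable at x"
    by (rule differentiable_compose[OF _ C1_differentiable[OF assms(3)]])
  show "partial_deriv i (\<lambda>x. F (g x)) x = F' (g x) * partial_deriv i g x" for i
    by (rule partial_compose[OF F C1_differentiable[OF assms(3)]])
  show "continuous_on UNIV (\<lambda>x. F' (g x) * partial_deriv i g x)" for i
    by (intro continuous_on_mult assms(2) C1_continuous_partial assms(3))
qed

lemma partial_translate:
  assumes "f differentiable at (x + a)"
  shows "partial_deriv i (\<lambda>x. f (x + a)) x = partial_deriv i f (x + a)"
proof -
  have "((\<lambda>x. x + a) has_derivative (\<lambda>h. h)) (at x)" by (auto intro!: derivative_eq_intros)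
  from has_derivative_compose[OF this assms[unfolded frechet_derivative_works]]
  show ?thesis unfolding partial_deriv_def[of _ f] by (rule partial_deriv_eq)
qed

lemma C1_translate:
  assumes "C1 f" shows "C1 (\<lambda>x. f (x + a))"
proof -
  have "continuous_on UNIV (partial_deriv i (\<lambda>x. f (x + a)))" for i
    using continuous_on_compose2[OF C1_continuous_partial[OF assms, of i], of UNIV "\<lambda>x. x + a"]
    by (simp add: partial_translate[OF C1_differentiable[OF assms], abs_def] continuous_on_add)
  moreover have "(\<lambda>x. f (x + a)) differentiable at x" for x
  proof (rule differentiable_compose[of f "\<lambda>x. x + a"])
    show "f differentiable at (x + a)" by (rule C1_differentiable[OF assms])
    show "(\<lambda>x. x + a) differentiable at x" by (intro differentiable_add differentiable_ident differentiable_const)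
  qed
  ultimately show ?thesis by (simp add: C1_def differentiable_on_def)
qed

section \<open>Compact support and integration by parts\<close>

lemma C1cI: "C1 f \<Longrightarrow> (\<And>x. R < norm x \<Longrightarrow> f x = 0) \<Longrightarrow> C1c f"
  unfolding C1c_def by blast

lemma C1c_C1: "C1c f \<Longrightarrow> C1 f" by (simp add: C1c_def)

lemma partial_deriv_eq_0:
  assumes "open S" "x \<in> S" "\<And>y. y \<in> S \<Longrightarrow> f y = 0"
  shows "partial_deriv i f x = 0"
proof -
  have "(f has_derivative (\<lambda>h. 0)) (at x)"
    by (rule has_derivative_transform_within_open[of "\<lambda>_. 0" _ x UNIV S]) (use assms in auto)
  from partial_deriv_eq[OF this] show ?thesis .
qed

lemma C1c_support:
  assumes "C1c f"
  obtains R where "0 < R" "\<And>x. R < norm x \<Longrightarrow> f x = 0" "\<And>x i. R < norm x \<Longrightarrow> partial_deriv i f x = 0"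
proof -
  obtain R where R: "\<And>x. R < norm x \<Longrightarrow> f x = 0" using assms unfolding C1c_def by blast
  have "partial_deriv i f x = 0" if "R < norm x" for x i
  proof (rule partial_deriv_eq_0[of "{x. R < norm x}"])
    show "open {x::real^'n. R < norm x}" by (intro open_Collect_less continuous_intros)
  qed (use that R in auto)
  with R that[of "max R 1"] show ?thesis by auto
qed

lemma continuous_support_integrable:
  fixes f :: "'a::euclidean_space \<Rightarrow> 'b::{banach, second_countable_topology}"
  assumes "continuous_on UNIV f" "\<And>x. R < norm x \<Longrightarrow> f x = 0"
  shows "integrable lborel f"
proof -
  have "integrable lborel (\<lambda>x. indicator (cball 0 R) x *\<^sub>R f x)"
    using assms(1) by (intro borel_integrable_compact compact_cball) (rule continuous_on_subset, auto)
  also have "(\<lambda>x. indicator (cball 0 R) x *\<^sub>R f x) = f"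
    using assms(2) by (auto simp: indicator_def fun_eq_iff)
  finally show ?thesis .
qed

lemma continuous_support_bounded:
  fixes f :: "'a::euclidean_space \<Rightarrow> 'b::real_normed_vector"
  assumes "continuous_on UNIV f" "\<And>x. R < norm x \<Longrightarrow> f x = 0"
  obtains M where "0 < M" "\<And>x. norm (f x) \<le> M"
proof -
  have "compact (f ` cball 0 R)"
    using assms(1) by (intro compact_continuous_image compact_cball) (rule continuous_on_subset, auto)
  then obtain M where M: "M > 0" "\<And>y. y \<in> f ` cball 0 R \<Longrightarrow> norm y \<le> M"
    using compact_imp_bounded[THEN bounded_pos[THEN iffD1]] by metis
  have "norm (f x) \<le> M" for x
    using M assms(2)[of x] by (cases "R < norm x") auto
  with M that show ?thesis by blast
qed

lemma gradient_norm_sq: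
  fixes f :: "real ^ 'n::finite \<Rightarrow> 'v::euclidean_space"
  shows "(norm (gradient f x))^2 = (\<Sum>i\<in>UNIV. (norm (partial_deriv i f x))^2)"
  unfolding norm_vec_def L2_set_def gradient_def by (simp add: sum_nonneg)

lemma norm_directional_le:
  fixes G :: "'v::real_normed_vector ^ 'n::finite" and h :: "real ^ 'n"
  shows "norm (\<Sum>i\<in>UNIV. (h $ i) *\<^sub>R (G $ i)) \<le> norm h * norm G"
proof -
  have "norm (\<Sum>i\<in>UNIV. (h $ i) *\<^sub>R (G $ i)) \<le> (\<Sum>i\<in>UNIV. \<bar>h $ i\<bar> * norm (G $ i))"
    by (rule norm_sum[THEN order_trans]) simp
  also have "\<dots> \<le> norm h * norm G"
    unfolding norm_vec_def using L2_set_mult_ineq[of "\<lambda>i. norm (h $ i)" "\<lambda>i. norm (G $ i)" UNIV] by simp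
  finally show ?thesis .
qed

lemma C1_gradient_continuous: "C1 f \<Longrightarrow> continuous_on UNIV (gradient f)"
  unfolding gradient_def[abs_def] by (intro continuous_on_vec_lambda C1_continuous_partial)

lemma C1_has_derivative:
  assumes "C1 f"
  shows "(f has_derivative (\<lambda>h. \<Sum>i\<in>UNIV. (h $ i) *\<^sub>R partial_deriv i f x)) (at x)"
  by (rule has_derivative_partial[OF C1_differentiable[OF assms]])

text \<open>By translation invariance of Lebesgue measure every difference quotient in direction
  \<open>axis i 1\<close> has integral zero; dominated convergence carries this over to the
  derivative.\<close>

lemma integral_partial_eq_0:
  fixes f :: "real ^ 'n::finite \<Rightarrow> 'v::euclidean_space"
  assumes "C1c f"
  shows "(LINT x|lborel. partial_deriv i f x) = 0"
proof -
  obtain R where R: "0 < R" "\<And>x. R < norm x \<Longrightarrow> f x = 0" "\<And>x i. R < norm x \<Longrightarrow> partial_deriv i f x = 0"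
    using C1c_support[OF assms] by metis
  note C = C1c_C1[OF assms]
  note cf = C1_continuous[OF C] and cp = C1_continuous_partial[OF C, of i]
  obtain M where M: "M > 0" "\<And>x. norm (partial_deriv i f x) \<le> M"
    using continuous_support_bounded[OF cp R(3)] by metis
  define e :: "real^'n" where "e = axis i 1"
  define h where "h n = 1 / real (Suc n)" for n
  have h: "0 < h n" "h n \<le> 1" for n by (auto simp: h_def)
  define g where "g n x = (1 / h n) *\<^sub>R (f (x + h n *\<^sub>R e) - f x)" for n x
  have bm: "f \<in> borel_measurable borel" using cf by (rule borel_measurable_continuous_onI)
  have int: "integrable lborel f" using continuous_support_integrable[OF cf R(2)] .
  have shift: "integrable lborel (\<lambda>x. f (x + a)) \<and> (LINT x|lborel. f (x + a)) = (LINT x|lborel. f x)" for a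
  proof -
    have "integrable (distr lborel borel (\<lambda>x. a + x)) f" using int lborel_distr_plus[of a] by metis
    then have "integrable lborel (\<lambda>x. f (a + x))" by (subst (asm) integrable_distr_eq) (use bm in auto)
    moreover have "(LINT x|lborel. f (a + x)) = (LINT x|distr lborel borel ((+) a). f x)"
      by (subst integral_distr) (use bm in auto)
    ultimately show ?thesis by (simp add: add.commute lborel_distr_plus)
  qed
  have 0: "(LINT x|lborel. g n x) = 0" for n
    unfolding g_def using shift[of "h n *\<^sub>R e"] int by simp
  have der: "((\<lambda>t. f (x + t *\<^sub>R e)) has_vector_derivative partial_deriv i f (x + t *\<^sub>R e)) (at t)" for x t
  proof -
    have 1: "((\<lambda>t. x + t *\<^sub>R e) has_derivative (\<lambda>s. s *\<^sub>R e)) (at t)"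
      by (auto intro!: derivative_eq_intros)
    have "((\<lambda>t. f (x + t *\<^sub>R e)) has_derivative (\<lambda>s. \<Sum>j\<in>UNIV. ((s *\<^sub>R e) $ j) *\<^sub>R partial_deriv j f (x + t *\<^sub>R e))) (at t)"
      by (rule has_derivative_compose[OF 1 C1_has_derivative[OF C]])
    moreover have "(\<Sum>j\<in>UNIV. ((s *\<^sub>R e) $ j) *\<^sub>R partial_deriv j f (x + t *\<^sub>R e)) = s *\<^sub>R partial_deriv i f (x + t *\<^sub>R e)" for s
      by (subst sum.remove[of UNIV i]) (auto simp: e_def axis_def intro!: sum.neutral)
    ultimately show ?thesis by (simp add: has_vector_derivative_def)
  qed
  \<comment> \<open>The quotients are bounded by \<open>M\<close> through the mean value inequality,
    and since \<open>h n \<le> 1\<close> they vanish outside the ball of radius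
    \<open>R + 1\<close>.\<close>
  have "(\<lambda>n. LINT x|lborel. g n x) \<longlonglongrightarrow> (LINT x|lborel. partial_deriv i f x)"
  proof (rule integral_dominated_convergence[where w = "\<lambda>x. M * indicator (cball 0 (R + 1)) x"])
    show "partial_deriv i f \<in> borel_measurable lborel"
      using cp by (simp add: borel_measurable_continuous_onI)
    show "g n \<in> borel_measurable lborel" for n
      unfolding g_def using bm by measurable
    show "integrable lborel (\<lambda>x::real^'n. M * indicator (cball 0 (R + 1)) x)"
      by (intro integrable_mult_right integrable_real_indicator) (use emeasure_bounded_finite[OF bounded_cball[of "0::real^'n" "R + 1"]] in \<open>simp_all add: less_top[symmetric]\<close>)
    show "AE x in lborel. (\<lambda>n. g n x) \<longlonglongrightarrow> partial_deriv i f x"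
    proof (rule AE_I2)
      fix x
      let ?F = "\<lambda>t. f (x + t *\<^sub>R e)"
      have "(\<lambda>t. norm (?F (0 + t) - ?F 0 - t *\<^sub>R partial_deriv i f x) / norm t) \<midarrow>0\<rightarrow> 0"
        using der[of x 0] unfolding has_vector_derivative_def has_derivative_at by simp
      then have "(\<lambda>t. norm ((?F t - f x) /\<^sub>R t - partial_deriv i f x)) \<midarrow>0\<rightarrow> 0"
      proof (rule Lim_transform_eventually)
        have "norm (?F (0 + t) - ?F 0 - t *\<^sub>R partial_deriv i f x) / norm t
            = norm ((?F t - f x) /\<^sub>R t - partial_deriv i f x)" if "t \<noteq> 0" for t
        proof -
          have "(?F t - f x) /\<^sub>R t - partial_deriv i f x = (?F t - f x - t *\<^sub>R partial_deriv i f x) /\<^sub>R t"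
            using that by (simp add: scaleR_diff_right)
          then show ?thesis by (simp add: divide_inverse mult.commute)
        qed
        then show "\<forall>\<^sub>F t in at 0. norm (?F (0 + t) - ?F 0 - t *\<^sub>R partial_deriv i f x) / norm t
            = norm ((?F t - f x) /\<^sub>R t - partial_deriv i f x)"
          by (auto simp: eventually_at_filter)
      qed
      then have "((\<lambda>t. (?F t - f x) /\<^sub>R t) \<longlongrightarrow> partial_deriv i f x) (at 0)"
        by (rule LIM_zero_cancel[OF tendsto_norm_zero_cancel])
      moreover have "filterlim h (at 0) sequentially"
      proof (rule filterlim_atI)
        show "h \<longlonglongrightarrow> 0" unfolding h_def using LIMSEQ_inverse_real_of_nat by (simp add: inverse_eq_divide)
      qed (simp add: h_def)
      ultimately have "(\<lambda>n. (f (x + h n *\<^sub>R e) - f x) /\<^sub>R h n) \<longlonglongrightarrow> partial_deriv i f x"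
        by (rule filterlim_compose)
      then show "(\<lambda>n. g n x) \<longlonglongrightarrow> partial_deriv i f x" by (simp add: g_def inverse_eq_divide)
    qed
    show "AE x in lborel. norm (g n x) \<le> M * indicator (cball 0 (R + 1)) x" for n
    proof (rule AE_I2)
      fix x
      show "norm (g n x) \<le> M * indicator (cball 0 (R + 1)) x"
      proof (cases "norm x \<le> R + 1")
        case True
        have "norm (f (x + h n *\<^sub>R e) - f (x + 0 *\<^sub>R e)) \<le> M * norm (h n - 0)"
          by (rule differentiable_bound[of UNIV "\<lambda>t. f (x + t *\<^sub>R e)" "\<lambda>t s. s *\<^sub>R partial_deriv i f (x + t *\<^sub>R e)"])
            (use der M in \<open>auto simp: has_vector_derivative_def intro!: onorm_le simp: mult.commute[of M] mult_left_mono\<close>)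
        then have "norm (f (x + h n *\<^sub>R e) - f x) / h n \<le> M"
          using h(1)[of n] by (subst pos_divide_le_eq) auto
        moreover have "norm (g n x) = norm (f (x + h n *\<^sub>R e) - f x) / h n"
          unfolding g_def norm_scaleR using h(1)[of n] by simp
        ultimately show ?thesis using True by simp
      next
        case False
        have "norm x \<le> norm (x + h n *\<^sub>R e) + norm (h n *\<^sub>R e)"
            using norm_triangle_ineq4[of "x + h n *\<^sub>R e" "h n *\<^sub>R e"] by simp
        moreover have "norm (h n *\<^sub>R e) \<le> 1" using h[of n] by (simp add: e_def)
        ultimately have "f (x + h n *\<^sub>R e) = 0" "f x = 0" using False by (auto intro!: R(2))
        with False show ?thesis by (simp add: g_def)
      qed
    qed
  qed
  with 0 show ?thesis by (simp add: LIMSEQ_const_iff)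
qed

section \<open>Hardy's inequality\<close>

text \<open>Fatou's lemma for bounds that vary with \<open>n\<close>. Integrability of the limit is
  part of the conclusion; this is how integrability of the singular Hardy integrand is obtained, for
  C1 functions and later for their limits.\<close>

lemma fatou_real:
  fixes f :: "nat \<Rightarrow> 'a \<Rightarrow> real"
  assumes f: "\<And>n. integrable M (f n)" "\<And>n x. 0 \<le> f n x" "\<And>n. integral\<^sup>L M (f n) \<le> B n"
    and B: "B \<longlonglongrightarrow> b" and lim: "AE x in M. (\<lambda>n. f n x) \<longlonglongrightarrow> g x"
    and g: "g \<in> borel_measurable M" "\<And>x. 0 \<le> g x"
  shows "integrable M g \<and> integral\<^sup>L M g \<le> b"
proof -
  have b0: "0 \<le> b"
    by (rule LIMSEQ_le_const[OF B]) (use order_trans[OF Bochner_Integration.integral_nonneg[of M, OF f(2)] f(3)] in blast)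
  have "(\<integral>\<^sup>+x. ennreal (g x) \<partial>M) = (\<integral>\<^sup>+x. liminf (\<lambda>n. ennreal (f n x)) \<partial>M)"
  proof (rule nn_integral_cong_AE)
    show "AE x in M. ennreal (g x) = liminf (\<lambda>n. ennreal (f n x))"
      using lim
    proof eventually_elim
      case (elim x)
      then have "(\<lambda>n. ennreal (f n x)) \<longlonglongrightarrow> ennreal (g x)" by (rule tendsto_ennrealI)
      then show ?case by (simp add: lim_imp_Liminf)
    qed
  qed
  also have "\<dots> \<le> liminf (\<lambda>n. \<integral>\<^sup>+x. ennreal (f n x) \<partial>M)"
    using borel_measurable_integrable[OF f(1)] by (intro nn_integral_liminf) simp
  also have "\<dots> \<le> liminf (\<lambda>n. ennreal (B n))"
    using f by (intro Liminf_mono) (auto simp: nn_integral_eq_integral intro!: ennreal_leI always_eventually)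
  also have "\<dots> = ennreal b" using tendsto_ennrealI[OF B] by (simp add: lim_imp_Liminf)
  finally have *: "(\<integral>\<^sup>+x. ennreal (g x) \<partial>M) \<le> ennreal b" .
  then have "integrable M g"
    using g by (intro integrableI_nonneg) (auto intro: le_less_trans)
  moreover have "ennreal (integral\<^sup>L M g) \<le> ennreal b"
    using * nn_integral_eq_integral[OF \<open>integrable M g\<close>] g(2) by simp
  ultimately show ?thesis using b0 by (simp add: ennreal_le_iff)
qed

lemma integrable_dominated_nonneg:
  assumes "integrable M (g :: 'a \<Rightarrow> real)" "f \<in> borel_measurable M" "\<And>x. 0 \<le> f x" "\<And>x. f x \<le> g x"
  shows "integrable M f"
  by (rule Bochner_Integration.integrable_bound[OF assms(1,2)]) (use assms in \<open>auto intro!: order_trans[OF _ abs_ge_self]\<close>)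

definition dirichlet :: "(real ^ 'n::finite \<Rightarrow> 'v::euclidean_space) \<Rightarrow> real"
  where "dirichlet u = (LINT x|lborel. (norm (gradient u x))^2)"

definition hardy_int :: "(real ^ 'n::finite \<Rightarrow> 'v::euclidean_space) \<Rightarrow> real ^ 'n \<Rightarrow> real"
  where "hardy_int u y = (LINT x|lborel. (norm (u x))^2 / (norm (x - y))^2)"

lemma dirichlet_integrable:
  fixes u :: "real ^ 'n::finite \<Rightarrow> 'v::euclidean_space"
  assumes "C1c u"
  shows "integrable lborel (\<lambda>x. (norm (gradient u x))^2)"
proof -
  obtain R where R: "\<And>x i. R < norm x \<Longrightarrow> partial_deriv i u x = 0"
    using C1c_support[OF assms] by metis
  show ?thesis
  proof (rule continuous_support_integrable)
    show "continuous_on UNIV (\<lambda>x. (norm (gradient u x))^2)"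
      by (intro continuous_intros C1_gradient_continuous C1c_C1[OF assms])
    show "(norm (gradient u x))^2 = 0" if "R < norm x" for x
      unfolding gradient_norm_sq using R[OF that] by simp
  qed
qed

lemma sum_coord_sq: "(\<Sum>i\<in>UNIV. (x $ i)^2) = (norm (x::real^'n::finite))^2"
  unfolding norm_vec_def L2_set_def by (simp add: sum_nonneg)

text \<open>
  \<open>w\<close> is the divergence of \<open>|u|^2 (x - y) / (|x - y|^2 + e)\<close>. The limit \<open>e \<rightarrow> 0\<close> yields Hardy's inequality as
  well as the identity \<open>radial_cross\<close> below.
\<close>

lemma hardy_field:
  fixes u :: "real ^ 'n::finite \<Rightarrow> 'v::euclidean_space" and y :: "real ^ 'n"
  assumes u: "C1c u" and e: "e > 0"
  defines "k \<equiv> \<lambda>x. inverse ((norm (x - y))^2 + e)"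
  defines "w \<equiv> \<lambda>x. 2 * k x * (u x \<bullet> (\<Sum>i\<in>UNIV. (x - y) $ i *\<^sub>R gradient u x $ i)) + real CARD('n) * (k x * (norm (u x))^2)
        - 2 * (k x)^2 * (norm (x - y))^2 * (norm (u x))^2"
  shows "integrable lborel w" "(LINT x|lborel. w x) = 0" "continuous_on UNIV k"
proof -
  note C = C1c_C1[OF u]
  obtain R where R: "\<And>x. R < norm x \<Longrightarrow> u x = 0"
    using C1c_support[OF u] by metis
  have pos: "(norm (x - y))^2 + e > 0" for x using e by (simp add: add_nonneg_pos)
  have kpos: "k x > 0" for x using pos by (simp add: k_def)
  have dk: "((\<lambda>s. inverse (s + e)) has_real_derivative - ((k x)^2)) (at ((norm (x - y))^2))" for x
    unfolding k_def using pos[of x] by (auto intro!: derivative_eq_intros simp: power2_eq_square)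
  have ck: "continuous_on UNIV k" unfolding k_def using pos by (intro continuous_intros) (metis less_irrefl)
  have Ck: "C1 k"
    unfolding k_def
    by (rule C1_compose[where F = "\<lambda>s. inverse (s + e)" and F' = "\<lambda>s. - ((inverse (s + e))^2)" and g = "\<lambda>x. (norm (x - y))^2"])
      (use dk ck in \<open>simp_all add: k_def C1_dist_sq continuous_intros\<close>)
  have pk: "partial_deriv i k x = - ((k x)^2) * (2 * (x - y) $ i)" for i x
    unfolding k_def[abs_def]
    by (subst partial_compose[OF dk[unfolded k_def] differentiable_dist_sq]) (simp add: partial_dist_sq)
  define F where "F i x = k x * ((x - y) $ i * (norm (u x))^2)" for i x
  have CF: "C1c (F i)" for i
  proof (rule C1cI)
    show "C1 (F i)" unfolding F_def by (intro C1_mult Ck C1_coord C1_norm_sq C)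
    show "F i x = 0" if "R < norm x" for x using R[OF that] by (simp add: F_def)
  qed
  have pF: "partial_deriv i (F i) x = k x * ((x - y) $ i * (2 * (u x \<bullet> partial_deriv i u x)) + (norm (u x))^2)
      - (k x)^2 * (2 * (x - y) $ i) * ((x - y) $ i * (norm (u x))^2)" for i x
  proof -
    have 1: "partial_deriv i (\<lambda>x. (x - y) $ i * (norm (u x))^2) x = (x - y) $ i * (2 * (u x \<bullet> partial_deriv i u x)) + (norm (u x))^2"
      using partial_scaleR[OF differentiable_coord[of y i x] C1_differentiable[OF C1_norm_sq[OF C]], of i]
      by (simp del: vector_minus_component add: partial_coord partial_norm_sq[OF C1_differentiable[OF C]])
    show ?thesis
      unfolding F_def[abs_def]
      using partial_scaleR[OF C1_differentiable[OF Ck, of x] C1_differentiable[OF C1_mult[OF C1_coord[of y i] C1_norm_sq[OF C]]], of i]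
      by (simp del: vector_minus_component add: 1 pk)
  qed
  define w' where "w' x = (\<Sum>i\<in>UNIV. partial_deriv i (F i) x)" for x
  have iw: "integrable lborel (partial_deriv i (F i))" for i
    using C1c_support[OF CF[of i]] continuous_support_integrable[OF C1_continuous_partial[OF C1c_C1[OF CF[of i]], of i]] by metis
  have w0: "(LINT x|lborel. w' x) = 0" "integrable lborel w'"
    unfolding w'_def using iw integral_partial_eq_0[OF CF] by auto
  have weq: "w' x = 2 * k x * (u x \<bullet> (\<Sum>i\<in>UNIV. (x - y) $ i *\<^sub>R gradient u x $ i)) + real CARD('n) * (k x * (norm (u x))^2)
      - 2 * (k x)^2 * (norm (x - y))^2 * (norm (u x))^2" for x
  proof -
    have 1: "(\<Sum>i\<in>UNIV. (k x)^2 * (2 * (x - y) $ i) * ((x - y) $ i * (norm (u x))^2)) =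
        2 * (k x)^2 * (norm (x - y))^2 * (norm (u x))^2"
    proof -
      have "(\<Sum>i\<in>UNIV. (k x)^2 * (2 * (x - y) $ i) * ((x - y) $ i * (norm (u x))^2)) =
        (\<Sum>i\<in>UNIV. (2 * (k x)^2 * (norm (u x))^2) * ((x - y) $ i)^2)"
        by (intro sum.cong refl) (simp add: power2_eq_square mult_ac)
      also have "\<dots> = 2 * (k x)^2 * (norm (u x))^2 * (norm (x - y))^2"
        unfolding sum_distrib_left[symmetric] sum_coord_sq ..
      finally show ?thesis by (simp add: mult_ac)
    qed
    have 2: "(\<Sum>i\<in>UNIV. k x * ((x - y) $ i * (2 * (u x \<bullet> partial_deriv i u x)))) =
       2 * k x * (u x \<bullet> (\<Sum>i\<in>UNIV. (x - y) $ i *\<^sub>R gradient u x $ i))"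
      unfolding inner_sum_right sum_distrib_left
      by (intro sum.cong refl) (simp add: gradient_def mult_ac)
    show ?thesis
      unfolding w'_def pF sum_subtractf sum.distrib distrib_left 1 2 by simp
  qed
  have "w = w'" unfolding w_def by (rule ext) (simp only: weq)
  with w0 show "integrable lborel w" "(LINT x|lborel. w x) = 0" by simp_all
  show "continuous_on UNIV k" by (rule ck)
qed

text \<open>Add \<open>m / 2\<close> times the divergence from \<open>hardy_field\<close>, whose
  integral vanishes, to \<open>|grad u|^2\<close>. Completing a square shows that the sum is
  pointwise at least \<open>m^2 / 4\<close> times the Hardy density regularised by \<open>e\<close>.
  Fatou's lemma removes \<open>e\<close>.\<close>

theorem hardy:
  fixes u :: "real ^ 'n::finite \<Rightarrow> 'v::euclidean_space"
  assumes u: "C1c u" and d: "3 \<le> CARD('n)"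
  shows "integrable lborel (\<lambda>x. (norm (u x))^2 / (norm (x - y))^2) \<and>
    (real CARD('n) - 2)^2 / 4 * hardy_int u y \<le> dirichlet u"
proof -
  define m where "m = real CARD('n) - 2"
  have m: "m \<ge> 1" using d by (simp add: m_def)
  note C = C1c_C1[OF u]
  obtain R where R: "\<And>x. R < norm x \<Longrightarrow> u x = 0"
    using C1c_support[OF u] by metis
  have step: "integrable lborel (\<lambda>x. (norm (u x))^2 / ((norm (x - y))^2 + e)) \<and>
      m^2 / 4 * (LINT x|lborel. (norm (u x))^2 / ((norm (x - y))^2 + e)) \<le> dirichlet u" if e: "e > 0" for e
  proof -
    have pos: "(norm (x - y))^2 + e > 0" for x using e by (simp add: add_nonneg_pos)
    define k where "k x = inverse ((norm (x - y))^2 + e)" for x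
    have kpos: "k x > 0" for x using pos by (simp add: k_def)
    define w where "w x = 2 * k x * (u x \<bullet> (\<Sum>i\<in>UNIV. (x - y) $ i *\<^sub>R gradient u x $ i)) + real CARD('n) * (k x * (norm (u x))^2)
        - 2 * (k x)^2 * (norm (x - y))^2 * (norm (u x))^2" for x
    have w0: "(LINT x|lborel. w x) = 0" "integrable lborel w" and ck: "continuous_on UNIV k"
      using hardy_field[OF u e, of y] by (simp_all add: k_def[abs_def] w_def[abs_def])
    have pw: "m^2 / 4 * (k x * (norm (u x))^2) \<le> (norm (gradient u x))^2 + m / 2 * w x" for x
    proof -
      define r a g where "r = norm (x - y)" and "a = norm (u x)" and "g = norm (gradient u x)"
      have "\<bar>u x \<bullet> (\<Sum>i\<in>UNIV. (x - y) $ i *\<^sub>R gradient u x $ i)\<bar> \<le> a * (r * g)"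
        unfolding a_def r_def g_def
        by (rule order_trans[OF Cauchy_Schwarz_ineq2]) (intro mult_left_mono norm_directional_le, simp)
      then have i: "- (a * (r * g)) \<le> u x \<bullet> (\<Sum>i\<in>UNIV. (x - y) $ i *\<^sub>R gradient u x $ i)" by linarith
      \<comment> \<open>Bounding \<open>k x * r^2\<close> by 1 in the negative term of
        \<open>w\<close> lowers the coefficient \<open>CARD('n)\<close> to
        \<open>m = CARD('n) - 2\<close>, the origin of Hardy's constant.\<close>
      have kr: "k x * r^2 \<le> 1" unfolding k_def r_def using e pos[of x] by (simp add: field_simps)
      have "2 * k x * (- (a * (r * g))) + real CARD('n) * (k x * a^2) - 2 * (k x * a^2) \<le> w x"
      proof -
        have "2 * k x * (- (a * (r * g))) \<le> 2 * k x * (u x \<bullet> (\<Sum>i\<in>UNIV. (x - y) $ i *\<^sub>R gradient u x $ i))"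
          using i kpos[of x] by (intro mult_left_mono) auto
        moreover have "(k x * a^2) * (k x * r^2) \<le> (k x * a^2) * 1"
          using kr kpos[of x] by (intro mult_left_mono) auto
        ultimately show ?thesis unfolding w_def a_def[symmetric] r_def[symmetric]
          by (simp add: power2_eq_square mult_ac)
      qed
      then have w1: "m * (k x * a^2) - 2 * k x * a * r * g \<le> w x" by (simp add: m_def algebra_simps)
      then have "m / 2 * (m * (k x * a^2) - 2 * k x * a * r * g) \<le> m / 2 * w x"
        using m by (intro mult_left_mono) auto
      moreover have "(m / 2 * (k x * a * r))^2 \<le> m^2 / 4 * (k x * a^2)"
      proof -
        have "(m / 2 * (k x * a * r))^2 = (m^2 / 4 * (k x * a^2)) * (k x * r^2)"
          by (simp add: power2_eq_square)
        also have "\<dots> \<le> (m^2 / 4 * (k x * a^2)) * 1"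
          using kr kpos[of x] by (intro mult_left_mono) auto
        finally show ?thesis by simp
      qed
      moreover have "0 \<le> (g - m / 2 * (k x * a * r))^2" by simp
      moreover have "m / 2 * (m * (k x * a^2) - 2 * k x * a * r * g) = 2 * (m^2 / 4 * (k x * a^2)) - 2 * g * (m / 2 * (k x * a * r))"
        by (simp add: power2_eq_square algebra_simps)
      moreover have "(g - m / 2 * (k x * a * r))^2 = g^2 + (m / 2 * (k x * a * r))^2 - 2 * g * (m / 2 * (k x * a * r))"
        by (rule power2_diff)
      ultimately have "m^2 / 4 * (k x * a^2) \<le> g^2 + m / 2 * w x"
        by linarith
      then show ?thesis by (simp add: a_def g_def)
    qed
    have ik: "integrable lborel (\<lambda>x. k x * (norm (u x))^2)"
      by (rule continuous_support_integrable[where R = R])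
        (use ck C1_continuous[OF C] R in \<open>auto intro!: continuous_intros\<close>)
    have "(LINT x|lborel. m^2 / 4 * (k x * (norm (u x))^2)) \<le> (LINT x|lborel. (norm (gradient u x))^2 + m / 2 * w x)"
      using ik w0(2) dirichlet_integrable[OF u] pw by (intro integral_mono) auto
    also have "\<dots> = dirichlet u"
      using w0 dirichlet_integrable[OF u] by (simp add: dirichlet_def)
    finally have "m^2 / 4 * (LINT x|lborel. k x * (norm (u x))^2) \<le> dirichlet u" by simp
    moreover have "k x * (norm (u x))^2 = (norm (u x))^2 / ((norm (x - y))^2 + e)" for x
      by (simp add: k_def divide_inverse)
    ultimately show ?thesis using ik by simp
  qed
  have um: "u \<in> borel_measurable borel" using C1_continuous[OF C] by (rule borel_measurable_continuous_onI)
  define e where "e n = 1 / real (Suc n)" for n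
  have e: "e n > 0" for n by (simp add: e_def)
  have elim0: "e \<longlonglongrightarrow> 0" unfolding e_def using LIMSEQ_inverse_real_of_nat by (simp add: inverse_eq_divide)
  have "integrable lborel (\<lambda>x. (norm (u x))^2 / (norm (x - y))^2) \<and>
      (LINT x|lborel. (norm (u x))^2 / (norm (x - y))^2) \<le> dirichlet u / (m^2 / 4)"
  proof (rule fatou_real[where B = "\<lambda>_. dirichlet u / (m^2 / 4)" and f = "\<lambda>n x. (norm (u x))^2 / ((norm (x - y))^2 + e n)"])
    show "(LINT x|lborel. (norm (u x))^2 / ((norm (x - y))^2 + e n)) \<le> dirichlet u / (m^2 / 4)" for n
      using step[OF e[of n]] m by (simp add: field_simps)
    show "AE x in lborel. (\<lambda>n. (norm (u x))^2 / ((norm (x - y))^2 + e n)) \<longlonglongrightarrow> (norm (u x))^2 / (norm (x - y))^2"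
      using AE_lborel_singleton[of y]
    proof eventually_elim
      case (elim x)
      have "(\<lambda>n. (norm (u x))^2 / ((norm (x - y))^2 + e n)) \<longlonglongrightarrow> (norm (u x))^2 / ((norm (x - y))^2 + 0)"
        using elim by (intro tendsto_intros elim0) auto
      then show ?case by simp
    qed
    show "integrable lborel (\<lambda>x. (norm (u x))^2 / ((norm (x - y))^2 + e n))" for n
      using step[OF e[of n]] by simp
    show "0 \<le> (norm (u x))^2 / ((norm (x - y))^2 + e n)" for n x
      using less_imp_le[OF e[of n]] by simp
    show "(\<lambda>x. (norm (u x))^2 / (norm (x - y))^2) \<in> borel_measurable lborel"
      using um by measurable
  qed simp_all
  moreover from this m have "m^2 / 4 * hardy_int u y \<le> dirichlet u"
    unfolding hardy_int_def by (simp add: field_simps)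
  ultimately show ?thesis by (simp add: m_def)
qed

section \<open>The improved Sobolev inequality in dimension three\<close>

lemma nn_integral_translate:
  fixes f :: "'a::euclidean_space \<Rightarrow> ennreal"
  assumes "f \<in> borel_measurable borel"
  shows "(\<integral>\<^sup>+x. f (x + a) \<partial>lborel) = (\<integral>\<^sup>+x. f x \<partial>lborel)"
proof -
  have "(\<integral>\<^sup>+x. f x \<partial>lborel) = (\<integral>\<^sup>+x. f x \<partial>distr lborel borel ((+) a))"
    by (simp add: lborel_distr_plus)
  also have "\<dots> = (\<integral>\<^sup>+x. f (a + x) \<partial>lborel)"
    using assms by (subst nn_integral_distr) auto
  finally show ?thesis by (simp add: add.commute)
qed

lemma C1_borel: "C1 f \<Longrightarrow> f \<in> borel_measurable borel"
  by (intro borel_measurable_continuous_onI C1_continuous)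

lemma C1_gradient_borel:
  fixes f :: "real ^ 'n::finite \<Rightarrow> 'v::euclidean_space"
  shows "C1 f \<Longrightarrow> gradient f \<in> borel_measurable borel"
  by (intro borel_measurable_continuous_onI C1_gradient_continuous)

section \<open>Increments in L2 and the weak-type bound\<close>

lemma nn_integral_dirichlet:
  assumes "C1c u"
  shows "(\<integral>\<^sup>+x. ennreal ((norm (gradient u x))^2) \<partial>lborel) = ennreal (dirichlet u)"
  unfolding dirichlet_def using dirichlet_integrable[OF assms] by (subst nn_integral_eq_integral) auto

lemma dirichlet_nonneg: "0 \<le> dirichlet u"
  unfolding dirichlet_def by simp

lemma hardy_int_nonneg: "0 \<le> hardy_int u y"
  unfolding hardy_int_def by simp

text \<open>The fundamental theorem of calculus on the segment from \<open>x\<close> to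
  \<open>x + h\<close>, followed by Cauchy-Schwarz in the parameter. The right-hand side is an
  extended integral so that Fubini applies to it at once.\<close>

lemma increment_sq_le:
  fixes v :: "real ^ 'n::finite \<Rightarrow> 'v::euclidean_space"
  assumes v: "C1 v"
  shows "ennreal ((norm (v (x + h) - v x))^2) \<le>
    ennreal ((norm h)^2) * (\<integral>\<^sup>+t. ennreal (indicator {0..1} t * (norm (gradient v (x + t *\<^sub>R h)))^2) \<partial>lborel)"
proof -
  define F where "F t = v (x + t *\<^sub>R h)" for t
  define f where "f t = (\<Sum>i\<in>UNIV. (h $ i) *\<^sub>R gradient v (x + t *\<^sub>R h) $ i)" for t
  define G where "G t = norm (gradient v (x + t *\<^sub>R h))" for t
  have cgr: "continuous_on UNIV (\<lambda>t. gradient v (x + t *\<^sub>R h))"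
    using continuous_on_compose2[OF C1_gradient_continuous[OF v], of UNIV "\<lambda>t. x + t *\<^sub>R h"]
    by (simp add: continuous_intros)
  have cf: "continuous_on UNIV f" and cG: "continuous_on UNIV G"
    unfolding f_def G_def using cgr by (auto intro!: continuous_intros)
  have fG: "norm (f t) \<le> norm h * G t" for t
    unfolding f_def G_def by (rule norm_directional_le)
  have der: "(F has_vector_derivative f t) (at t within S)" for t S
  proof -
    have 1: "((\<lambda>t. x + t *\<^sub>R h) has_derivative (\<lambda>s. s *\<^sub>R h)) (at t)"
      by (auto intro!: derivative_eq_intros)
    have "(F has_derivative (\<lambda>s. \<Sum>i\<in>UNIV. ((s *\<^sub>R h) $ i) *\<^sub>R partial_deriv i v (x + t *\<^sub>R h))) (at t)"
      unfolding F_def by (rule has_derivative_compose[OF 1 C1_has_derivative[OF v]])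
    moreover have "(\<Sum>i\<in>UNIV. ((s *\<^sub>R h) $ i) *\<^sub>R partial_deriv i v (x + t *\<^sub>R h)) = s *\<^sub>R f t" for s
      by (simp add: f_def gradient_def scaleR_sum_right)
    ultimately show ?thesis
      unfolding has_vector_derivative_def by (auto intro: has_derivative_at_withinI)
  qed
  have intI: "integrable lborel (\<lambda>t. indicator {0..1} t *\<^sub>R k t)" if "continuous_on UNIV k" for k :: "real \<Rightarrow> 'b::{banach, second_countable_topology}"
    by (rule borel_integrable_compact) (use that in \<open>auto intro: continuous_on_subset\<close>)
  define D where "D = norm (F 1 - F 0)"
  define I where "I = (LINT t|lborel. indicator {0..1} t *\<^sub>R (G t)^2)"
  have FT: "(LINT t|lborel. indicator {0..1} t *\<^sub>R f t) = F 1 - F 0"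
    by (rule integral_FTC_atLeastAtMost) (use der cf in \<open>auto intro: continuous_on_subset\<close>)
  have "D^2 \<le> (norm h)^2 * I"
  proof (cases "D = 0")
    case True
    then show ?thesis unfolding I_def by (auto intro!: mult_nonneg_nonneg Bochner_Integration.integral_nonneg)
  next
    case False
    then have D: "D > 0" by (simp add: D_def)
    have "D \<le> (LINT t|lborel. norm (indicator {0..1} t *\<^sub>R f t))"
      unfolding D_def FT[symmetric] by (rule integral_norm_bound)
    also have "\<dots> \<le> (LINT t|lborel. indicator {0..1} t *\<^sub>R ((norm h)^2 * (G t)^2 / (2 * D) + D / 2))"
    proof (rule integral_mono)
      show "integrable lborel (\<lambda>t. norm (indicator {0..1} t *\<^sub>R f t))"
        by (intro integrable_norm intI cf)
      show "integrable lborel (\<lambda>t. indicator {0..1} t *\<^sub>R ((norm h)^2 * (G t)^2 / (2 * D) + D / 2))"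
        by (intro intI continuous_intros cG) (use D in auto)
      fix t
      \<comment> \<open>Young's inequality weighted by \<open>D\<close> itself stands in for
        Cauchy-Schwarz: the summand \<open>D / 2\<close> is absorbed by the left side
        \<open>D\<close>.\<close>
      have "2 * D * (norm h * G t) \<le> (norm h * G t)^2 + D^2"
        using sum_squares_bound[of D "norm h * G t"] by (simp add: mult_ac)
      then have "norm h * G t \<le> (norm h)^2 * (G t)^2 / (2 * D) + D / 2"
        using D by (simp add: field_simps power2_eq_square)
      with fG[of t] show "norm (indicator {0..1} t *\<^sub>R f t) \<le> indicator {0..1} t *\<^sub>R ((norm h)^2 * (G t)^2 / (2 * D) + D / 2)"
        by (auto simp: indicator_def)
    qed
    also have "\<dots> = (LINT t|lborel. (norm h)^2 / (2 * D) * (indicator {0..1} t *\<^sub>R (G t)^2) + indicator {0..1} t *\<^sub>R (D / 2))"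
      by (rule Bochner_Integration.integral_cong) (auto simp: indicator_def)
    also have "\<dots> = (norm h)^2 / (2 * D) * I + D / 2"
      unfolding I_def
      by (subst Bochner_Integration.integral_add) (use intI[of "\<lambda>_. D / 2"] intI[OF continuous_on_power[OF cG, of 2]] in auto)
    finally have "D / 2 \<le> (norm h)^2 / (2 * D) * I" by linarith
    with D show ?thesis by (simp add: field_simps power2_eq_square)
  qed
  moreover have "ennreal I = (\<integral>\<^sup>+t. ennreal (indicator {0..1} t * (G t)^2) \<partial>lborel)"
    unfolding I_def using intI[OF continuous_on_power[OF cG, of 2]]
    by (subst nn_integral_eq_integral) auto
  ultimately show ?thesis
    unfolding D_def F_def G_def[symmetric]
    by (metis (no_types, lifting) add.right_neutral ennreal_leI ennreal_mult'' ennreal_mult' scaleR_one scaleR_zero_left zero_le_power2)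
qed

text \<open>After Fubini, each \<open>t\<close> sees a translate of the gradient, with the same
  \<open>L^2\<close> norm, and the average over \<open>t\<close> in \<open>[0, 1]\<close> costs
  nothing.\<close>

lemma increment_L2_le:
  fixes v :: "real ^ 'n::finite \<Rightarrow> 'v::euclidean_space"
  assumes v: "C1c v"
  shows "(\<integral>\<^sup>+x. ennreal ((norm (v (x + h) - v x))^2) \<partial>lborel) \<le> ennreal ((norm h)^2 * dirichlet v)"
proof -
  note C = C1c_C1[OF v]
  note [measurable] = C1_gradient_borel[OF C] C1_borel[OF C]
  have "(\<integral>\<^sup>+x. ennreal ((norm (v (x + h) - v x))^2) \<partial>lborel) \<le>
    (\<integral>\<^sup>+x. ennreal ((norm h)^2) * (\<integral>\<^sup>+t. ennreal (indicator {0..1} t * (norm (gradient v (x + t *\<^sub>R h)))^2) \<partial>lborel) \<partial>lborel)"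
    by (intro nn_integral_mono increment_sq_le C)
  also have "\<dots> = ennreal ((norm h)^2) * (\<integral>\<^sup>+x. (\<integral>\<^sup>+t. ennreal (indicator {0..1} t * (norm (gradient v (x + t *\<^sub>R h)))^2) \<partial>lborel) \<partial>lborel)"
    by (rule nn_integral_cmult) measurable
  also have "(\<integral>\<^sup>+x. (\<integral>\<^sup>+t. ennreal (indicator {0..1} t * (norm (gradient v (x + t *\<^sub>R h)))^2) \<partial>lborel) \<partial>lborel)
     = (\<integral>\<^sup>+t. (\<integral>\<^sup>+x. ennreal (indicator {0..1} t * (norm (gradient v (x + t *\<^sub>R h)))^2) \<partial>lborel) \<partial>lborel)"
    by (rule lborel_pair.Fubini') measurable
  also have "\<dots> = (\<integral>\<^sup>+t. indicator {0..1::real} t * ennreal (dirichlet v) \<partial>lborel)"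
  proof (rule nn_integral_cong)
    fix t :: real
    have "(\<integral>\<^sup>+x. ennreal (indicator {0..1} t * (norm (gradient v (x + t *\<^sub>R h)))^2) \<partial>lborel)
      = (\<integral>\<^sup>+x. indicator {0..1} t * ennreal ((norm (gradient v (x + t *\<^sub>R h)))^2) \<partial>lborel)"
      by (intro nn_integral_cong) (auto simp: indicator_def)
    also have "\<dots> = indicator {0..1} t * (\<integral>\<^sup>+x. ennreal ((norm (gradient v (x + t *\<^sub>R h)))^2) \<partial>lborel)"
      by (rule nn_integral_cmult) measurable
    also have "(\<integral>\<^sup>+x. ennreal ((norm (gradient v (x + t *\<^sub>R h)))^2) \<partial>lborel) = ennreal (dirichlet v)"
      unfolding nn_integral_dirichlet[OF v, symmetric]
      by (rule nn_integral_translate) measurable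
    finally show "(\<integral>\<^sup>+x. ennreal (indicator {0..1} t * (norm (gradient v (x + t *\<^sub>R h)))^2) \<partial>lborel) = indicator {0..1} t * ennreal (dirichlet v)" .
  qed
  also have "\<dots> = ennreal (dirichlet v)"
    by (subst nn_integral_multc) auto
  finally show ?thesis by (simp add: ennreal_mult dirichlet_nonneg)
qed

lemma nn_hardy_int:
  fixes v :: "real ^ 'n::finite \<Rightarrow> 'v::euclidean_space"
  assumes "C1c v" "3 \<le> CARD('n)"
  shows "(\<integral>\<^sup>+x. ennreal ((norm (v x))^2 / (norm (x - y))^2) \<partial>lborel) = ennreal (hardy_int v y)"
  unfolding hardy_int_def using hardy[OF assms, of y] by (subst nn_integral_eq_integral) auto

lemma ennreal_twice_add: "0 \<le> a \<Longrightarrow> 0 \<le> b \<Longrightarrow> ennreal (2 * a + 2 * b) = 2 * ennreal a + 2 * ennreal b"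
  by (simp add: ennreal_plus ennreal_mult)

text \<open>
  The mean of \<open>|v|^2\<close> over a ball of radius \<open>r\<close> is at most \<open>H / (\<kappa> r)\<close>, \<open>\<kappa>\<close> being the volume of the unit ball.
  For \<open>r = 4 H / (\<kappa> l^2)\<close> it is too small to account for \<open>|v| = l\<close> at the centre, so that increments of \<open>v\<close> must do so.
\<close>

lemma weak_type_level:
  fixes v :: "real ^ 'n::finite \<Rightarrow> 'v::euclidean_space"
  assumes v: "C1c v" and d: "CARD('n) = 3" and H: "H > 0" "\<And>y. hardy_int v y \<le> H" and l: "l > 0"
  shows "emeasure lborel {x. norm (v x) = l} \<le> ennreal (64 / (unit_ball_vol 3)^2 * H^2 * dirichlet v / l ^ 6)"
proof -
  note C = C1c_C1[OF v]
  note [measurable] = C1_borel[OF C]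
  define k where "k = unit_ball_vol 3"
  have k: "k > 0" by (simp add: k_def)
  define r where "r = 4 * H / (k * l^2)"
  have r: "r > 0" using H k l by (simp add: r_def)
  define B where "B = ball (0::real^'n) r"
  have mB: "emeasure lborel B = ennreal (k * r ^ 3)"
    using r d by (simp add: B_def emeasure_ball k_def)
  have [measurable]: "B \<in> sets borel" by (simp add: B_def)
  have kr: "k * r * l^2 = 4 * H" using k l by (simp add: r_def)
  define E where "E = {x. norm (v x) = l}"
  have [measurable]: "E \<in> sets borel" unfolding E_def by measurable
  define A where "A x = (\<integral>\<^sup>+h. indicator B h * ennreal ((norm (v (x + h) - v x))^2) \<partial>lborel)" for x
  have 1: "ennreal (l^2 * k * r ^ 3 / 4) \<le> A x" if x: "x \<in> E" for x
  proof -
    have "(\<integral>\<^sup>+h. indicator B h * ennreal ((norm (v (x + h)))^2) \<partial>lborel) \<le>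
        (\<integral>\<^sup>+h. ennreal (r^2) * ennreal ((norm (v (h + x)))^2 / (norm (h + x - x))^2) \<partial>lborel)"
    proof (rule nn_integral_mono_AE)
      show "AE h in lborel. indicator B h * ennreal ((norm (v (x + h)))^2) \<le> ennreal (r^2) * ennreal ((norm (v (h + x)))^2 / (norm (h + x - x))^2)"
        using AE_lborel_singleton[of 0]
      proof eventually_elim
        case (elim h)
        show ?case
        proof (cases "h \<in> B")
          case True
          \<comment> \<open>On the ball the Hardy weight centred at \<open>x\<close> is at least
            \<open>1 / r^2\<close>.\<close>
          then have "(norm h)^2 \<le> r^2" by (simp add: B_def power_mono)
          then have "(norm h)^2 * (norm (v (x + h)))^2 \<le> r^2 * (norm (v (x + h)))^2" by (rule mult_right_mono) simp
          then have "(norm (v (x + h)))^2 \<le> r^2 * ((norm (v (h + x)))^2 / (norm h)^2)"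
            using elim by (simp add: field_simps)
          then show ?thesis using True by (simp add: ennreal_mult[symmetric] ennreal_leI)
        qed simp
      qed
    qed
    also have "\<dots> = ennreal (r^2) * (\<integral>\<^sup>+h. ennreal ((norm (v (h + x)))^2 / (norm (h + x - x))^2) \<partial>lborel)"
      by (rule nn_integral_cmult) measurable
    also have "(\<integral>\<^sup>+h. ennreal ((norm (v (h + x)))^2 / (norm (h + x - x))^2) \<partial>lborel) = ennreal (hardy_int v x)"
      unfolding nn_hardy_int[OF v d[THEN eq_imp_le[OF sym]], symmetric]
      by (rule nn_integral_translate[where f = "\<lambda>z. ennreal ((norm (v z))^2 / (norm (z - x))^2)"]) measurable
    also have "ennreal (r^2) * ennreal (hardy_int v x) \<le> ennreal (r^2 * H)"
      using H(2)[of x] by (simp add: ennreal_mult[symmetric] hardy_int_nonneg ennreal_leI mult_left_mono)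
    finally have 2: "(\<integral>\<^sup>+h. indicator B h * ennreal ((norm (v (x + h)))^2) \<partial>lborel) \<le> ennreal (r^2 * H)" .
    have "ennreal (l^2) * emeasure lborel B = (\<integral>\<^sup>+h. ennreal (l^2) * indicator B h \<partial>lborel)"
      by (subst nn_integral_cmult_indicator) auto
    also have "\<dots> \<le> (\<integral>\<^sup>+h. 2 * (indicator B h * ennreal ((norm (v (x + h) - v x))^2)) + 2 * (indicator B h * ennreal ((norm (v (x + h)))^2)) \<partial>lborel)"
    proof (rule nn_integral_mono)
      fix h
      have "l \<le> norm (v (x + h) - v x) + norm (v (x + h))"
        using x norm_triangle_ineq4[of "v (x + h)" "v (x + h) - v x"] by (simp add: E_def)
      then have "l^2 \<le> (norm (v (x + h) - v x) + norm (v (x + h)))^2" using l by (intro power_mono) auto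
      also have "\<dots> \<le> 2 * (norm (v (x + h) - v x))^2 + 2 * (norm (v (x + h)))^2"
        using sum_squares_bound[of "norm (v (x + h) - v x)" "norm (v (x + h))"] by (simp add: power2_sum)
      finally have "ennreal (l^2) \<le> 2 * ennreal ((norm (v (x + h) - v x))^2) + 2 * ennreal ((norm (v (x + h)))^2)"
        using ennreal_leI ennreal_twice_add[of "(norm (v (x + h) - v x))^2" "(norm (v (x + h)))^2"] by fastforce
      then show "ennreal (l^2) * indicator B h \<le> 2 * (indicator B h * ennreal ((norm (v (x + h) - v x))^2)) + 2 * (indicator B h * ennreal ((norm (v (x + h)))^2))"
        by (auto simp: indicator_def)
    qed
    also have "\<dots> = 2 * A x + 2 * (\<integral>\<^sup>+h. indicator B h * ennreal ((norm (v (x + h)))^2) \<partial>lborel)"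
      unfolding A_def by (subst nn_integral_add) (auto simp: nn_integral_cmult)
    also have "\<dots> \<le> 2 * A x + 2 * ennreal (r^2 * H)"
      using 2 by (intro add_left_mono mult_left_mono) auto
    finally have 3: "ennreal (l^2 * (k * r ^ 3)) \<le> 2 * A x + 2 * ennreal (r^2 * H)"
      using k r by (simp add: mB ennreal_mult)
    \<comment> \<open>The choice of \<open>r\<close> makes the Hardy share exactly half of
      \<open>l^2\<close> times the volume of the ball; the increments must carry the other
      half.\<close>
    have rH: "2 * (r^2 * H) = l^2 * k * r ^ 3 / 2"
      using kr by (simp add: power2_eq_square power3_eq_cube mult_ac)
    show ?thesis
    proof (cases "A x")
      case (real a)
      have "ennreal (l^2 * (k * r ^ 3)) \<le> ennreal (2 * a + 2 * (r^2 * H))"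
        using 3 real H by (subst ennreal_twice_add) auto
      then have "l^2 * (k * r ^ 3) \<le> 2 * a + 2 * (r^2 * H)"
        using real H by (subst (asm) ennreal_le_iff) auto
      then have "l^2 * k * r ^ 3 / 4 \<le> a" unfolding rH by (simp add: mult.assoc)
      then show ?thesis using real by (simp add: ennreal_leI)
    qed simp
  qed
  have "ennreal (l^2 * k * r ^ 3 / 4) * emeasure lborel E = (\<integral>\<^sup>+x. ennreal (l^2 * k * r ^ 3 / 4) * indicator E x \<partial>lborel)"
    by (subst nn_integral_cmult_indicator) auto
  also have "\<dots> \<le> (\<integral>\<^sup>+x. A x \<partial>lborel)"
    by (intro nn_integral_mono) (auto simp: indicator_def 1)
  also have "\<dots> = (\<integral>\<^sup>+h. (\<integral>\<^sup>+x. indicator B h * ennreal ((norm (v (x + h) - v x))^2) \<partial>lborel) \<partial>lborel)"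
    unfolding A_def by (rule lborel_pair.Fubini') measurable
  also have "\<dots> \<le> (\<integral>\<^sup>+h. ennreal (r^2 * dirichlet v) * indicator B h \<partial>lborel)"
  proof (rule nn_integral_mono)
    fix h :: "real^'n"
    have "(\<integral>\<^sup>+x. indicator B h * ennreal ((norm (v (x + h) - v x))^2) \<partial>lborel) = indicator B h * (\<integral>\<^sup>+x. ennreal ((norm (v (x + h) - v x))^2) \<partial>lborel)"
      by (rule nn_integral_cmult) measurable
    also have "\<dots> \<le> indicator B h * ennreal ((norm h)^2 * dirichlet v)"
      by (intro mult_left_mono increment_L2_le v) simp
    also have "\<dots> \<le> ennreal (r^2 * dirichlet v) * indicator B h"
      using r by (auto simp: indicator_def B_def dirichlet_nonneg intro!: ennreal_leI mult_right_mono power_mono)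
    finally show "(\<integral>\<^sup>+x. indicator B h * ennreal ((norm (v (x + h) - v x))^2) \<partial>lborel) \<le> ennreal (r^2 * dirichlet v) * indicator B h" .
  qed
  also have "\<dots> = ennreal (r^2 * dirichlet v * (k * r ^ 3))"
    using k r by (subst nn_integral_cmult_indicator) (auto simp: mB ennreal_mult dirichlet_nonneg)
  finally have 4: "ennreal (l^2 * k * r ^ 3 / 4) * emeasure lborel E \<le> ennreal (r^2 * dirichlet v * (k * r ^ 3))" .
  have p: "l^2 * k * r ^ 3 / 4 > 0" using l k r by simp
  show ?thesis
  proof (cases "emeasure lborel E")
    case (real a)
    have "(l^2 * k * r ^ 3 / 4) * a \<le> r^2 * dirichlet v * (k * r ^ 3)"
      using 4 real p k r dirichlet_nonneg[of v] by (simp add: ennreal_mult[symmetric] ennreal_le_iff)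
    then have "a \<le> r^2 * dirichlet v * (k * r ^ 3) / (l^2 * k * r ^ 3 / 4)"
      by (subst pos_le_divide_eq[OF p]) (simp only: mult.commute)
    \<comment> \<open>The volumes cancel and leave \<open>4 * r^2 * dirichlet v / l^2\<close>;
      inserting \<open>r = 4 * H / (k * l^2)\<close> gives \<open>64 = 4 * 4^2\<close>.\<close>
    also have "\<dots> = 64 / k^2 * H^2 * dirichlet v / l ^ 6"
      using k l r H by (simp add: r_def field_simps power2_eq_square eval_nat_numeral)
    finally show ?thesis using real by (simp add: E_def k_def ennreal_leI)
  next
    case top
    with 4 l k r show ?thesis by (simp add: ennreal_mult_top top_unique)
  qed
qed

section \<open>A C1 step function and truncation in height\<close>

definition smoothstep :: "real \<Rightarrow> real"
  where "smoothstep s = 1 - (max 0 (1 - (max 0 s)^2))^2"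

definition smoothstep_deriv :: "real \<Rightarrow> real"
  where "smoothstep_deriv s = 4 * max 0 (1 - (max 0 s)^2) * max 0 s"

text \<open>The square of the positive part is C1 on the whole line, its two pieces meeting at 0
  with derivative 0. Two nested copies of it make up \<open>smoothstep\<close>, so the chain rule
  alone yields the regularity of the step.\<close>

lemma max0_sq_has_derivative: "((\<lambda>s::real. (max 0 s)^2) has_real_derivative 2 * max 0 s) (at s)"
proof -
  consider "s < 0" | "s = 0" | "s > 0" by linarith
  then show ?thesis
  proof cases
    case 1
    have "((\<lambda>s::real. 0) has_real_derivative 0) (at s)" by simp
    then show ?thesis
      by (rule has_field_derivative_transform_within_open[of _ _ _ "{..<0}", THEN DERIV_cong]) (use 1 in auto)
  next
    case 3
    have "((\<lambda>s::real. s^2) has_real_derivative 2 * s) (at s)" by (auto intro!: derivative_eq_intros)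
    then show ?thesis
      by (rule has_field_derivative_transform_within_open[of _ _ _ "{0<..}", THEN DERIV_cong]) (use 3 in auto)
  next
    case 2
    have "((\<lambda>h. (max 0 h)^2 / h) \<longlongrightarrow> 0) (at (0::real))"
    proof (rule Lim_null_comparison)
      show "\<forall>\<^sub>F h in at 0. norm ((max 0 h)^2 / h) \<le> \<bar>h::real\<bar>"
        by (rule always_eventually) (auto simp: max_def power2_eq_square)
      show "((\<lambda>h. \<bar>h::real\<bar>) \<longlongrightarrow> 0) (at 0)" using tendsto_rabs[OF tendsto_ident_at, of "0::real" UNIV] by simp
    qed
    then show ?thesis using 2 by (simp add: DERIV_def)
  qed
qed

lemma smoothstep_has_derivative: "(smoothstep has_real_derivative smoothstep_deriv s) (at s)"
proof -
  have "((\<lambda>s. (max 0 (1 - (max 0 s)^2))^2) has_real_derivative (2 * max 0 (1 - (max 0 s)^2)) * (0 - 2 * max 0 s)) (at s)"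
    by (rule DERIV_chain2[OF max0_sq_has_derivative]) (intro derivative_intros max0_sq_has_derivative)
  from DERIV_diff[OF DERIV_const this, of 1] show ?thesis
    unfolding smoothstep_def[abs_def] smoothstep_deriv_def by (simp add: mult_ac)
qed

lemma continuous_smoothstep_deriv: "continuous_on UNIV smoothstep_deriv"
  unfolding smoothstep_deriv_def by (intro continuous_intros)

lemma smoothstep_bounds: "0 \<le> smoothstep s" "smoothstep s \<le> 1"
  and smoothstep_deriv_bounds: "0 \<le> smoothstep_deriv s" "smoothstep_deriv s \<le> 4"
proof -
  define t where "t = max 0 (1 - (max 0 s)^2)"
  have t: "0 \<le> t" "t \<le> 1" by (auto simp: t_def)
  show "0 \<le> smoothstep s" "smoothstep s \<le> 1"
    using t power_le_one[of t 2] by (auto simp: smoothstep_def t_def[symmetric])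
  show "0 \<le> smoothstep_deriv s" using t by (simp add: smoothstep_deriv_def t_def[symmetric])
  have "t * max 0 s \<le> 1"
  proof (cases "s \<le> 1")
    case True
    then show ?thesis using t by (intro mult_le_one) auto
  next
    case False
    then have "max 0 s = s" "1 - s^2 \<le> 0" using one_le_power[of s 2] by auto
    then have "t = 0" unfolding t_def by simp
    then show ?thesis by simp
  qed
  then show "smoothstep_deriv s \<le> 4" by (simp add: smoothstep_deriv_def t_def[symmetric])
qed

lemma smoothstep_0: "s \<le> 0 \<Longrightarrow> smoothstep s = 0"
  and smoothstep_deriv_0: "s \<le> 0 \<Longrightarrow> smoothstep_deriv s = 0"
  by (auto simp: smoothstep_def smoothstep_deriv_def max_def)

lemma smoothstep_1:
  assumes "1 \<le> s" shows "smoothstep s = 1" "smoothstep_deriv s = 0"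
proof -
  have "max 0 s = s" "max 0 (1 - s^2) = 0" using one_le_power[OF assms, of 2] assms by (simp_all add: max_absorb1)
  then show "smoothstep s = 1" "smoothstep_deriv s = 0"
    by (simp_all add: smoothstep_def smoothstep_deriv_def)
qed

text \<open>Truncation through \<open>|u|^2\<close>, which is C1 also at the zeros of
  \<open>u\<close> and makes the result real-valued for vector-valued \<open>u\<close>. The
  transition takes place for \<open>l^2 \<le> |u|^2 \<le> 2 * l^2\<close>, inside
  \<open>l \<le> |u| \<le> 2 * l\<close>.\<close>

definition trunc :: "real \<Rightarrow> ('a \<Rightarrow> 'v::real_normed_vector) \<Rightarrow> 'a \<Rightarrow> real"
  where "trunc l u x = l * smoothstep ((norm (u x))^2 / l^2 - 1)"

lemma
  fixes u :: "real ^ 'n::finite \<Rightarrow> 'v::euclidean_space"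
  assumes u: "C1c u" and l: "l > 0"
  shows C1c_trunc: "C1c (trunc l u)"
    and gradient_trunc_le: "(norm (gradient (trunc l u) x))^2 \<le> 256 * (norm (gradient u x))^2 * indicator {l..2 * l} (norm (u x))"
proof -
  note C = C1c_C1[OF u]
  obtain R where R: "\<And>x. R < norm x \<Longrightarrow> u x = 0" using C1c_support[OF u] by metis
  define F where "F s = l * smoothstep (s / l^2 - 1)" for s
  define F' where "F' s = l * (smoothstep_deriv (s / l^2 - 1) * (1 / l^2))" for s
  have F: "(F has_real_derivative F' s) (at s)" for s
    unfolding F_def F'_def
    using DERIV_diff[OF DERIV_cdivide[OF DERIV_ident] DERIV_const, of "l^2" 1 s]
    by (intro DERIV_cmult DERIV_chain2[OF smoothstep_has_derivative]) simp
  have eq: "trunc l u = (\<lambda>x. F ((norm (u x))^2))" by (rule ext) (simp add: trunc_def F_def)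
  have cF': "continuous_on UNIV F'"
    unfolding F'_def by (intro continuous_intros continuous_on_compose2[OF continuous_smoothstep_deriv]) (use l in auto)
  have "C1 (trunc l u)"
    unfolding eq
    by (rule C1_compose[OF F continuous_on_compose2[OF cF' C1_continuous[OF C1_norm_sq[OF C]] subset_UNIV] C1_norm_sq[OF C]])
  then show "C1c (trunc l u)"
    by (rule C1cI[of _ R]) (simp add: trunc_def R smoothstep_0)
  have p: "partial_deriv i (trunc l u) x = F' ((norm (u x))^2) * (2 * (u x \<bullet> partial_deriv i u x))" for i
    unfolding eq by (subst partial_compose[OF F C1_differentiable[OF C1_norm_sq[OF C]]])
      (simp add: partial_norm_sq[OF C1_differentiable[OF C]])
  show "(norm (gradient (trunc l u) x))^2 \<le> 256 * (norm (gradient u x))^2 * indicator {l..2 * l} (norm (u x))"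
  proof (cases "norm (u x) \<in> {l..2 * l}")
    case True
    have b: "0 \<le> F' s" "F' s \<le> 4 / l" for s
      using smoothstep_deriv_bounds[of "s / l^2 - 1"] l by (auto simp: F'_def field_simps power2_eq_square)
    have "(norm (partial_deriv i (trunc l u) x))^2 \<le> 256 * (norm (partial_deriv i u x))^2" for i
    proof -
      have "\<bar>partial_deriv i (trunc l u) x\<bar> = F' ((norm (u x))^2) * (2 * \<bar>u x \<bullet> partial_deriv i u x\<bar>)"
        using b by (simp add: p abs_mult)
      \<comment> \<open>The chain rule contributes \<open>F' \<le> 4 / l\<close> and
        \<open>2 * |u| \<le> 4 * l\<close>, together 16; hence \<open>256 = 16^2\<close>.\<close>
      also have "\<dots> \<le> 4 / l * (2 * (2 * l * norm (partial_deriv i u x)))"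
        using b True l Cauchy_Schwarz_ineq2[of "u x" "partial_deriv i u x"]
          mult_right_mono[of "norm (u x)" "2 * l" "norm (partial_deriv i u x)"]
        by (intro mult_mono) auto
      also have "\<dots> = 16 * norm (partial_deriv i u x)" using l by simp
      finally have "\<bar>partial_deriv i (trunc l u) x\<bar>^2 \<le> (16 * norm (partial_deriv i u x))^2" by (intro power_mono) auto
      then show ?thesis by (simp add: power_mult_distrib)
    qed
    then show ?thesis using True unfolding gradient_norm_sq sum_distrib_left by (simp add: sum_mono)
  next
    case False
    have "F' ((norm (u x))^2) = 0"
    proof (cases "norm (u x) < l")
      case True
      then have "(norm (u x))^2 \<le> l^2" by (intro power_mono) auto
      then show ?thesis using l by (simp add: F'_def smoothstep_deriv_0)
    next
      case False
      with \<open>norm (u x) \<notin> {l..2 * l}\<close> have "(2 * l)^2 \<le> (norm (u x))^2" using l by (intro power_mono) auto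
      then have "2 * l^2 \<le> (norm (u x))^2" using zero_le_power2[of l] unfolding power_mult_distrib power2_eq_square[of 2] by linarith
      then have "(norm (u x))^2 / l^2 - 1 \<ge> 1" using l by (simp add: field_simps)
      then show ?thesis by (simp add: F'_def smoothstep_1)
    qed
    then show ?thesis unfolding gradient_norm_sq p by (simp add: sum_nonneg)
  qed
qed

lemma trunc_bounds:
  assumes "l > 0"
  shows "0 \<le> trunc l u x" "trunc l u x \<le> norm (u x)" "2 * l \<le> norm (u x) \<Longrightarrow> trunc l u x = l"
proof -
  show "0 \<le> trunc l u x" using assms smoothstep_bounds by (simp add: trunc_def)
  show "trunc l u x \<le> norm (u x)"
  proof (cases "norm (u x) < l")
    case True
    then have "(norm (u x))^2 \<le> l^2" by (intro power_mono) auto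
    then show ?thesis using assms by (simp add: trunc_def smoothstep_0)
  next
    case False
    have "trunc l u x \<le> l * 1" unfolding trunc_def using assms smoothstep_bounds by (intro mult_left_mono) auto
    with False show ?thesis by simp
  qed
  show "trunc l u x = l" if "2 * l \<le> norm (u x)"
  proof -
    have "(2 * l)^2 \<le> (norm (u x))^2" using assms that by (intro power_mono) auto
    then have "2 * l^2 \<le> (norm (u x))^2" using zero_le_power2[of l] unfolding power_mult_distrib power2_eq_square[of 2] by linarith
    then have "(norm (u x))^2 / l^2 - 1 \<ge> 1" using assms by (simp add: field_simps)
    then show ?thesis by (simp add: trunc_def smoothstep_1)
  qed
qed

text \<open>A one-sided layer-cake formula: only the heights in \<open>(a/4, a/2]\<close> are kept,
  where \<open>l ^ 5 \<ge> (a/4) ^ 5\<close>, and \<open>4 ^ 6 = 4096\<close>.\<close>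

lemma power6_le_level_integral:
  assumes "0 \<le> a"
  shows "ennreal (a ^ 6) \<le> 4096 * (\<integral>\<^sup>+l. ennreal (indicator {l. 0 < l \<and> 2 * l \<le> a} l * l ^ 5) \<partial>lborel)"
proof -
  have "ennreal (a ^ 6) = 4096 * (\<integral>\<^sup>+l. ennreal ((a / 4) ^ 5) * indicator {a / 4<..a / 2} l \<partial>lborel)"
    using assms by (subst nn_integral_cmult_indicator)
      (auto simp: ennreal_mult[symmetric] field_simps eval_nat_numeral simp flip: ennreal_numeral)
  also have "\<dots> \<le> 4096 * (\<integral>\<^sup>+l. ennreal (indicator {l. 0 < l \<and> 2 * l \<le> a} l * l ^ 5) \<partial>lborel)"
    using assms
    by (intro mult_left_mono nn_integral_mono) (auto simp: indicator_def intro!: ennreal_leI power_mono)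
  finally show ?thesis .
qed

text \<open>For positive \<open>a\<close> this is the integral of \<open>1 / l\<close> over
  \<open>[a/2, a]\<close>, of value \<open>ln 2\<close>; the bound 1 is the maximum
  \<open>2 / a\<close> times the length \<open>a / 2\<close>.\<close>

lemma level_integral_inverse_le:
  assumes "0 \<le> a"
  shows "(\<integral>\<^sup>+l. ennreal (indicator {l. 0 < l \<and> l \<le> a \<and> a \<le> 2 * l} l / l) \<partial>lborel) \<le> 1"
proof (cases "a = 0")
  case True
  then have "(\<integral>\<^sup>+l. ennreal (indicator {l. 0 < l \<and> l \<le> a \<and> a \<le> 2 * l} l / l) \<partial>lborel) = (\<integral>\<^sup>+(l::real). 0 \<partial>lborel)"
    by (intro nn_integral_cong) (auto simp: indicator_def)
  then show ?thesis by simp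
next
  case False
  then have a: "a > 0" using assms by simp
  have "(\<integral>\<^sup>+l. ennreal (indicator {l. 0 < l \<and> l \<le> a \<and> a \<le> 2 * l} l / l) \<partial>lborel) \<le> (\<integral>\<^sup>+l. ennreal (2 / a) * indicator {a / 2..a} l \<partial>lborel)"
    using a by (intro nn_integral_mono) (auto simp: indicator_def field_simps intro!: ennreal_leI)
  also have "\<dots> = 1"
    using a by (subst nn_integral_cmult_indicator) (auto simp: ennreal_mult[symmetric])
  finally show ?thesis .
qed

lemma hardy_int_mono:
  fixes u :: "real ^ 'n::finite \<Rightarrow> 'v::euclidean_space" and v :: "real ^ 'n \<Rightarrow> 'w::euclidean_space"
  assumes "C1c u" "C1c v" "3 \<le> CARD('n)" "\<And>x. norm (v x) \<le> norm (u x)"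
  shows "hardy_int v y \<le> hardy_int u y"
  unfolding hardy_int_def using hardy[OF assms(1,3), of y] hardy[OF assms(2,3), of y] assms(4)
  by (intro integral_mono) (auto intro!: divide_right_mono power_mono)

lemma C1c_power_integrable:
  fixes u :: "real ^ 'n::finite \<Rightarrow> 'v::euclidean_space"
  assumes "C1c u" "0 < n"
  shows "integrable lborel (\<lambda>x. (norm (u x)) ^ n)"
proof -
  obtain R where R: "\<And>x. R < norm x \<Longrightarrow> u x = 0" using C1c_support[OF assms(1)] by metis
  show ?thesis
    by (rule continuous_support_integrable[where R = R])
      (use assms(2) R C1_continuous[OF C1c_C1[OF assms(1)]] in \<open>auto intro!: continuous_intros\<close>)
qed

text \<open>The factors are \<open>4 ^ 6\<close> from the layer-cake bound, \<open>16 ^ 2\<close>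
  from the gradient of the truncation, and the constant of \<open>weak_type_level\<close>.\<close>

definition improved_sobolev_const :: real
  where "improved_sobolev_const = 4096 * (256 * (64 / (unit_ball_vol 3)^2))"

text \<open>
  Maz'ya's truncation: the gradient of \<open>trunc l u\<close> lives where \<open>l \<le> |u| \<le> 2 l\<close>, so integrating the weak type
  bound against \<open>l ^ 5 dl\<close> counts every point with the bounded weight \<open>\<integral> dl / l\<close>.
\<close>

theorem improved_sobolev:
  fixes u :: "real ^ 'n::finite \<Rightarrow> 'v::euclidean_space"
  assumes u: "C1c u" and d: "CARD('n) = 3" and H: "H > 0" "\<And>y. hardy_int u y \<le> H"
  shows "(LINT x|lborel. (norm (u x)) ^ 6) \<le> improved_sobolev_const * dirichlet u * H^2"
proof -
  note C = C1c_C1[OF u]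
  note [measurable] = C1_gradient_borel[OF C] C1_borel[OF C]
  define K where "K = 64 / (unit_ball_vol 3)^2 * H^2"
  have K: "K \<ge> 0" by (simp add: K_def)
  define g where "g x = (norm (gradient u x))^2" for x
  have [measurable]: "g \<in> borel_measurable borel" unfolding g_def by measurable
  have g0: "g x \<ge> 0" for x by (simp add: g_def)
  have lev: "emeasure lborel {x. 2 * l \<le> norm (u x)} \<le> ennreal (K / l ^ 6) * (\<integral>\<^sup>+x. ennreal (256 * g x * indicator {l..2 * l} (norm (u x))) \<partial>lborel)"
    if l: "l > 0" for l
  proof -
    note T = C1c_trunc[OF u l]
    \<comment> \<open>The truncation is constant where \<open>|u| \<ge> 2 * l\<close>, so this
      superlevel set of \<open>u\<close> lies in a level set of \<open>trunc l u\<close>, to which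
      the weak-type bound applies.\<close>
    have "emeasure lborel {x. 2 * l \<le> norm (u x)} \<le> emeasure lborel {x. norm (trunc l u x) = l}"
    proof (rule emeasure_mono)
      show "{x. 2 * l \<le> norm (u x)} \<subseteq> {x. norm (trunc l u x) = l}"
        using trunc_bounds(3)[OF l, of u] l by auto
      note [measurable] = C1_borel[OF C1c_C1[OF T]]
      show "{x. norm (trunc l u x) = l} \<in> sets lborel" by simp
    qed
    also have "\<dots> \<le> ennreal (64 / (unit_ball_vol 3)^2 * H^2 * dirichlet (trunc l u) / l ^ 6)"
    proof (rule weak_type_level[OF T d H(1) _ l])
      show "hardy_int (trunc l u) y \<le> H" for y
        by (rule order_trans[OF hardy_int_mono[OF u T] H(2)])
          (use d trunc_bounds(1,2)[OF l, of u] in \<open>simp_all add: abs_of_nonneg\<close>)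
    qed
    also have "\<dots> = ennreal (K / l ^ 6) * ennreal (dirichlet (trunc l u))"
      using K l by (subst ennreal_mult[symmetric]) (auto simp: dirichlet_nonneg K_def)
    also have "\<dots> \<le> ennreal (K / l ^ 6) * (\<integral>\<^sup>+x. ennreal (256 * g x * indicator {l..2 * l} (norm (u x))) \<partial>lborel)"
      unfolding nn_integral_dirichlet[OF T, symmetric] g_def
      by (intro mult_left_mono nn_integral_mono ennreal_leI gradient_trunc_le u l) auto
    finally show ?thesis .
  qed
  have "(\<integral>\<^sup>+x. ennreal ((norm (u x)) ^ 6) \<partial>lborel) \<le>
      (\<integral>\<^sup>+x. 4096 * (\<integral>\<^sup>+l. ennreal (indicator {l. 0 < l \<and> 2 * l \<le> norm (u x)} l * l ^ 5) \<partial>lborel) \<partial>lborel)"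
    by (intro nn_integral_mono power6_le_level_integral) simp
  also have "\<dots> = 4096 * (\<integral>\<^sup>+x. (\<integral>\<^sup>+l. ennreal (indicator {l. 0 < l \<and> 2 * l \<le> norm (u x)} l * l ^ 5) \<partial>lborel) \<partial>lborel)"
    unfolding indicator_def by (rule nn_integral_cmult) measurable
  also have "(\<integral>\<^sup>+x. (\<integral>\<^sup>+l. ennreal (indicator {l. 0 < l \<and> 2 * l \<le> norm (u x)} l * l ^ 5) \<partial>lborel) \<partial>lborel)
     = (\<integral>\<^sup>+l. (\<integral>\<^sup>+x. ennreal (indicator {l. 0 < l \<and> 2 * l \<le> norm (u x)} l * l ^ 5) \<partial>lborel) \<partial>lborel)"
    unfolding indicator_def by (rule lborel_pair.Fubini') measurable
  also have "\<dots> \<le> (\<integral>\<^sup>+l. (\<integral>\<^sup>+x. ennreal (256 * K * (g x * (indicator {l. 0 < l \<and> l \<le> norm (u x) \<and> norm (u x) \<le> 2 * l} l / l))) \<partial>lborel) \<partial>lborel)"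
  proof (rule nn_integral_mono)
    fix l :: real
    show "(\<integral>\<^sup>+x. ennreal (indicator {l. 0 < l \<and> 2 * l \<le> norm (u x)} l * l ^ 5) \<partial>lborel) \<le>
       (\<integral>\<^sup>+x. ennreal (256 * K * (g x * (indicator {l. 0 < l \<and> l \<le> norm (u x) \<and> norm (u x) \<le> 2 * l} l / l))) \<partial>lborel)"
    proof (cases "l > 0")
      case False
      then have "(\<integral>\<^sup>+x. ennreal (indicator {l. 0 < l \<and> 2 * l \<le> norm (u x)} l * l ^ 5) \<partial>lborel) = (\<integral>\<^sup>+(x::real^'n). 0 \<partial>lborel)"
        by (intro nn_integral_cong) (auto simp: indicator_def)
      then show ?thesis by simp
    next
      case True
      have "(\<integral>\<^sup>+x. ennreal (indicator {l. 0 < l \<and> 2 * l \<le> norm (u x)} l * l ^ 5) \<partial>lborel) = (\<integral>\<^sup>+x. ennreal (l ^ 5) * indicator {x. 2 * l \<le> norm (u x)} x \<partial>lborel)"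
        using True by (intro nn_integral_cong) (auto simp: indicator_def)
      also have "\<dots> = ennreal (l ^ 5) * emeasure lborel {x. 2 * l \<le> norm (u x)}"
        by (rule nn_integral_cmult_indicator) simp
      also have "\<dots> \<le> ennreal (l ^ 5) * (ennreal (K / l ^ 6) * (\<integral>\<^sup>+x. ennreal (256 * g x * indicator {l..2 * l} (norm (u x))) \<partial>lborel))"
        by (intro mult_left_mono lev True) simp
      also have "\<dots> = ennreal (K / l) * (\<integral>\<^sup>+x. ennreal (256 * g x * indicator {l..2 * l} (norm (u x))) \<partial>lborel)"
        using True K by (simp add: mult.assoc[symmetric] ennreal_mult[symmetric] eval_nat_numeral)
      also have "\<dots> = (\<integral>\<^sup>+x. ennreal (K / l) * ennreal (256 * g x * indicator {l..2 * l} (norm (u x))) \<partial>lborel)"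
        by (rule nn_integral_cmult[symmetric]) measurable
      also have "\<dots> = (\<integral>\<^sup>+x. ennreal (256 * K * (g x * (indicator {l. 0 < l \<and> l \<le> norm (u x) \<and> norm (u x) \<le> 2 * l} l / l))) \<partial>lborel)"
        using True K by (intro nn_integral_cong) (auto simp: indicator_def ennreal_mult[symmetric] g0 mult_ac)
      finally show ?thesis .
    qed
  qed
  also have "\<dots> = (\<integral>\<^sup>+x. (\<integral>\<^sup>+l. ennreal (256 * K * (g x * (indicator {l. 0 < l \<and> l \<le> norm (u x) \<and> norm (u x) \<le> 2 * l} l / l))) \<partial>lborel) \<partial>lborel)"
    unfolding indicator_def by (rule lborel_pair.Fubini') measurable
  also have "\<dots> \<le> (\<integral>\<^sup>+x. ennreal (256 * K) * ennreal (g x) \<partial>lborel)"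
  proof (rule nn_integral_mono)
    fix x
    have "(\<integral>\<^sup>+l. ennreal (256 * K * (g x * (indicator {l. 0 < l \<and> l \<le> norm (u x) \<and> norm (u x) \<le> 2 * l} l / l))) \<partial>lborel)
      = (\<integral>\<^sup>+l. ennreal (256 * K * g x) * ennreal (indicator {l. 0 < l \<and> l \<le> norm (u x) \<and> norm (u x) \<le> 2 * l} l / l) \<partial>lborel)"
      using K by (intro nn_integral_cong) (auto simp: indicator_def ennreal_mult[symmetric] g0)
    also have "\<dots> = ennreal (256 * K * g x) * (\<integral>\<^sup>+l. ennreal (indicator {l. 0 < l \<and> l \<le> norm (u x) \<and> norm (u x) \<le> 2 * l} l / l) \<partial>lborel)"
      unfolding indicator_def by (rule nn_integral_cmult) measurable
    also have "\<dots> \<le> ennreal (256 * K * g x) * 1"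
      by (intro mult_left_mono level_integral_inverse_le) auto
    finally show "(\<integral>\<^sup>+l. ennreal (256 * K * (g x * (indicator {l. 0 < l \<and> l \<le> norm (u x) \<and> norm (u x) \<le> 2 * l} l / l))) \<partial>lborel) \<le> ennreal (256 * K) * ennreal (g x)"
      using K by (simp add: ennreal_mult g0)
  qed
  also have "\<dots> = ennreal (256 * K) * ennreal (dirichlet u)"
    unfolding nn_integral_dirichlet[OF u, symmetric] g_def by (rule nn_integral_cmult) measurable
  finally have "(\<integral>\<^sup>+x. ennreal ((norm (u x)) ^ 6) \<partial>lborel) \<le> 4096 * (ennreal (256 * K) * ennreal (dirichlet u))"
    by (simp add: mult_left_mono)
  also have "\<dots> = ennreal (4096 * (256 * K * dirichlet u))"
    using K dirichlet_nonneg[of u] by (simp add: ennreal_mult mult.assoc)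
  finally have "ennreal (LINT x|lborel. (norm (u x)) ^ 6) \<le> ennreal (4096 * (256 * K * dirichlet u))"
    by (subst (asm) nn_integral_eq_integral) (auto simp: C1c_power_integrable[OF u])
  then have "(LINT x|lborel. (norm (u x)) ^ 6) \<le> 4096 * (256 * K * dirichlet u)"
    using K dirichlet_nonneg[of u] by (subst (asm) ennreal_le_iff) auto
  then show ?thesis by (simp add: K_def improved_sobolev_const_def mult_ac)
qed

section \<open>Stretching the logarithmic radial variable\<close>

definition radial_weight :: "'a::euclidean_space \<Rightarrow> real"
  where "radial_weight x = inverse (norm x ^ DIM('a))"

definition stretch :: "real \<Rightarrow> 'a::real_normed_vector \<Rightarrow> 'a"
  where "stretch k x = (norm x powr (k - 1)) *\<^sub>R x"

lemma radial_weight_measurable [measurable]: "radial_weight \<in> borel_measurable borel"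
  unfolding radial_weight_def by measurable

lemma radial_weight_nonneg: "0 \<le> radial_weight x"
  by (simp add: radial_weight_def)

lemma radial_weight_0: "radial_weight (0::'a::euclidean_space) = 0"
  by (simp add: radial_weight_def)

lemma stretch_measurable [measurable]: "stretch k \<in> borel_measurable (borel :: 'a::euclidean_space measure)"
  unfolding stretch_def by measurable

lemma norm_stretch: "norm (stretch k x) = norm x powr k"
proof (cases "x = 0")
  case False
  then show ?thesis by (simp add: stretch_def powr_diff)
qed (simp add: stretch_def)

text \<open>The measure \<open>|x| ^ (-d) dx\<close> is dilation-invariant because the Jacobian
  \<open>c ^ d\<close> cancels the homogeneity of the weight. It is the product of Lebesgue measure
  in \<open>ln |x|\<close> and surface measure on the directions.\<close>

lemma nn_integral_dilate:
  fixes F :: "'a::euclidean_space \<Rightarrow> ennreal"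
  assumes [measurable]: "F \<in> borel_measurable borel" and c: "c > 0"
  shows "(\<integral>\<^sup>+x. F (c *\<^sub>R x) * ennreal (radial_weight x) \<partial>lborel) = (\<integral>\<^sup>+x. F x * ennreal (radial_weight x) \<partial>lborel)"
proof -
  have "(\<integral>\<^sup>+x. F x * ennreal (radial_weight x) \<partial>lborel) =
    (\<integral>\<^sup>+x. F x * ennreal (radial_weight x) \<partial>density (distr lborel borel (\<lambda>x. 0 + c *\<^sub>R x)) (\<lambda>_. ennreal (\<bar>c\<bar>^DIM('a))))"
    using c by (subst lborel_affine[of c 0]) (auto simp: ennreal_power)
  also have "\<dots> = (\<integral>\<^sup>+x. ennreal (c ^ DIM('a)) * (F (c *\<^sub>R x) * ennreal (radial_weight (c *\<^sub>R x))) \<partial>lborel)"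
    using c by (simp add: nn_integral_density nn_integral_distr)
  also have "\<dots> = (\<integral>\<^sup>+x. F (c *\<^sub>R x) * ennreal (radial_weight x) \<partial>lborel)"
  proof (intro nn_integral_cong)
    fix x :: 'a
    have "c ^ DIM('a) * radial_weight (c *\<^sub>R x) = radial_weight x"
      using c by (simp add: radial_weight_def power_mult_distrib)
    then have "ennreal (c ^ DIM('a)) * ennreal (radial_weight (c *\<^sub>R x)) = ennreal (radial_weight x)"
      using c by (simp add: radial_weight_nonneg flip: ennreal_mult)
    then show "ennreal (c ^ DIM('a)) * (F (c *\<^sub>R x) * ennreal (radial_weight (c *\<^sub>R x))) = F (c *\<^sub>R x) * ennreal (radial_weight x)"
      by (simp add: mult.left_commute)
  qed
  finally show ?thesis ..
qed

text \<open>
  Polar coordinates without a surface measure: the shell \<open>1 \<le> |x| < e\<close>, weighted by \<open>|x| ^ (-d)\<close>, represents the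
  directions. This makes the behaviour of integrals under \<open>stretch\<close> a one-dimensional affine substitution.
\<close>

lemma nn_integral_polar:
  fixes F :: "'a::euclidean_space \<Rightarrow> ennreal"
  assumes [measurable]: "F \<in> borel_measurable borel"
  shows "(\<integral>\<^sup>+x. F x * ennreal (radial_weight x) \<partial>lborel) =
    (\<integral>\<^sup>+x. indicator {0..<1} (ln (norm x)) * ennreal (radial_weight x) * (\<integral>\<^sup>+t. F (exp t *\<^sub>R x) \<partial>lborel) \<partial>lborel)"
proof -
  have "(\<integral>\<^sup>+x. F x * ennreal (radial_weight x) \<partial>lborel) =
      (\<integral>\<^sup>+x. (\<integral>\<^sup>+t. (F x * indicator {0..<1} (ln (norm x) - t)) * ennreal (radial_weight x) \<partial>lborel) \<partial>lborel)"
  \<comment> \<open>For fixed \<open>x\<close> the admissible \<open>t\<close> form an interval of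
    length 1, so the inserted indicator integrates to 1.\<close>
  proof (intro nn_integral_cong)
    fix x :: 'a
    have "(\<integral>\<^sup>+t. (F x * indicator {0..<1} (ln (norm x) - t)) * ennreal (radial_weight x) \<partial>lborel) =
      (\<integral>\<^sup>+t. (F x * ennreal (radial_weight x)) * indicator {ln (norm x) - 1<..ln (norm x)} t \<partial>lborel)"
      by (intro nn_integral_cong) (auto simp: indicator_def)
    also have "\<dots> = F x * ennreal (radial_weight x)"
      by (subst nn_integral_cmult_indicator) auto
    finally show "F x * ennreal (radial_weight x) = (\<integral>\<^sup>+t. (F x * indicator {0..<1} (ln (norm x) - t)) * ennreal (radial_weight x) \<partial>lborel)" ..
  qed
  also have "\<dots> = (\<integral>\<^sup>+t. (\<integral>\<^sup>+x. (F x * indicator {0..<1} (ln (norm x) - t)) * ennreal (radial_weight x) \<partial>lborel) \<partial>lborel)"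
    by (rule lborel_pair.Fubini') measurable
  also have "\<dots> = (\<integral>\<^sup>+t. (\<integral>\<^sup>+x. (F (exp t *\<^sub>R x) * indicator {0..<1} (ln (norm x))) * ennreal (radial_weight x) \<partial>lborel) \<partial>lborel)"
  \<comment> \<open>Dilating by \<open>exp t\<close> moves the shell
    \<open>t \<le> ln |x| < t + 1\<close> to the fixed shell
    \<open>0 \<le> ln |x| < 1\<close>.\<close>
  proof (rule nn_integral_cong)
    fix t :: real
    have "(\<integral>\<^sup>+x. (F x * indicator {0..<1} (ln (norm x) - t)) * ennreal (radial_weight x) \<partial>lborel) =
      (\<integral>\<^sup>+x. (F (exp t *\<^sub>R x) * indicator {0..<1} (ln (norm (exp t *\<^sub>R x)) - t)) * ennreal (radial_weight x) \<partial>lborel)"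
      by (rule nn_integral_dilate[symmetric]) auto
    also have "\<dots> = (\<integral>\<^sup>+x. (F (exp t *\<^sub>R x) * indicator {0..<1} (ln (norm x))) * ennreal (radial_weight x) \<partial>lborel)"
    proof (intro nn_integral_cong)
      fix x :: 'a
      show "(F (exp t *\<^sub>R x) * indicator {0..<1} (ln (norm (exp t *\<^sub>R x)) - t)) * ennreal (radial_weight x) =
        (F (exp t *\<^sub>R x) * indicator {0..<1} (ln (norm x))) * ennreal (radial_weight x)"
        by (cases "x = 0") (simp_all add: radial_weight_0 ln_mult)
    qed
    finally show "(\<integral>\<^sup>+x. (F x * indicator {0..<1} (ln (norm x) - t)) * ennreal (radial_weight x) \<partial>lborel) =
      (\<integral>\<^sup>+x. (F (exp t *\<^sub>R x) * indicator {0..<1} (ln (norm x))) * ennreal (radial_weight x) \<partial>lborel)" .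
  qed
  also have "\<dots> = (\<integral>\<^sup>+x. (\<integral>\<^sup>+t. (F (exp t *\<^sub>R x) * indicator {0..<1} (ln (norm x))) * ennreal (radial_weight x) \<partial>lborel) \<partial>lborel)"
    by (rule lborel_pair.Fubini'[symmetric]) measurable
  also have "\<dots> = (\<integral>\<^sup>+x. indicator {0..<1} (ln (norm x)) * ennreal (radial_weight x) * (\<integral>\<^sup>+t. F (exp t *\<^sub>R x) \<partial>lborel) \<partial>lborel)"
    by (intro nn_integral_cong) (subst nn_integral_cmult[symmetric], auto intro!: nn_integral_cong simp: mult_ac)
  finally show ?thesis .
qed

text \<open>Along the ray through \<open>x\<close>, in the parameter \<open>t\<close> of
  \<open>exp t *\<^sub>R x\<close>, the map \<open>stretch k\<close> sends \<open>t\<close> to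
  \<open>(k - 1) * ln (norm x) + k * t\<close>. The shift depends on \<open>x\<close> but does not
  affect the integral over the line, and the slope gives the factor \<open>k\<close>.\<close>

lemma nn_integral_stretch:
  fixes F :: "'a::euclidean_space \<Rightarrow> ennreal"
  assumes [measurable]: "F \<in> borel_measurable borel" and k: "k > 0"
  shows "(\<integral>\<^sup>+x. F x * ennreal (radial_weight x) \<partial>lborel) = ennreal k * (\<integral>\<^sup>+x. F (stretch k x) * ennreal (radial_weight x) \<partial>lborel)"
proof -
  have "ennreal k * (\<integral>\<^sup>+x. F (stretch k x) * ennreal (radial_weight x) \<partial>lborel) =
    ennreal k * (\<integral>\<^sup>+x. indicator {0..<1} (ln (norm x)) * ennreal (radial_weight x) * (\<integral>\<^sup>+t. F (stretch k (exp t *\<^sub>R x)) \<partial>lborel) \<partial>lborel)"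
    by (subst nn_integral_polar) auto
  also have "\<dots> = (\<integral>\<^sup>+x. indicator {0..<1} (ln (norm x)) * ennreal (radial_weight x) * (ennreal k * (\<integral>\<^sup>+t. F (stretch k (exp t *\<^sub>R x)) \<partial>lborel)) \<partial>lborel)"
    by (subst nn_integral_cmult[symmetric]) (auto intro!: nn_integral_cong simp: mult_ac)
  also have "\<dots> = (\<integral>\<^sup>+x. indicator {0..<1} (ln (norm x)) * ennreal (radial_weight x) * (\<integral>\<^sup>+t. F (exp t *\<^sub>R x) \<partial>lborel) \<partial>lborel)"
  proof (intro nn_integral_cong)
    fix x :: 'a
    show "indicator {0..<1} (ln (norm x)) * ennreal (radial_weight x) * (ennreal k * (\<integral>\<^sup>+t. F (stretch k (exp t *\<^sub>R x)) \<partial>lborel)) =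
      indicator {0..<1} (ln (norm x)) * ennreal (radial_weight x) * (\<integral>\<^sup>+t. F (exp t *\<^sub>R x) \<partial>lborel)"
    proof (cases "x = 0")
      case False
      have "stretch k (exp t *\<^sub>R x) = exp ((k - 1) * ln (norm x) + k * t) *\<^sub>R x" for t
        using False by (simp add: stretch_def powr_def ln_mult exp_add[symmetric] algebra_simps)
      then have "ennreal k * (\<integral>\<^sup>+t. F (stretch k (exp t *\<^sub>R x)) \<partial>lborel) = (\<integral>\<^sup>+t. F (exp t *\<^sub>R x) \<partial>lborel)"
        using nn_integral_real_affine[of "\<lambda>t. F (exp t *\<^sub>R x)" k "(k - 1) * ln (norm x)"] k by simp
      then show ?thesis by simp
    qed (simp add: radial_weight_0)
  qed
  also have "\<dots> = (\<integral>\<^sup>+x. F x * ennreal (radial_weight x) \<partial>lborel)"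
    by (subst nn_integral_polar[of F]) auto
  finally show ?thesis ..
qed

text \<open>The weighted measure is mapped to \<open>1 / k\<close> times itself. Stating this as an
  equality of measures transfers the substitution to Bochner integrals of functions of either
  sign.\<close>

lemma integral_stretch:
  fixes f :: "'a::euclidean_space \<Rightarrow> real"
  assumes [measurable]: "f \<in> borel_measurable borel" and k: "k > 0"
  shows "(LINT x|lborel. f (stretch k x) * radial_weight x) = (LINT x|lborel. f x * radial_weight x) / k"
proof -
  let ?M = "density lborel (\<lambda>x. ennreal (radial_weight x)) :: 'a measure"
  let ?N = "density lborel (\<lambda>x. ennreal (radial_weight x / k)) :: 'a measure"
  have eq: "distr ?M borel (stretch k) = ?N"
  proof (rule measure_eqI)
    fix A assume "A \<in> sets (distr ?M borel (stretch k))"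
    then have [measurable]: "A \<in> sets borel" by simp
    have "emeasure (distr ?M borel (stretch k)) A = (\<integral>\<^sup>+x. indicator A (stretch k x) * ennreal (radial_weight x) \<partial>lborel)"
    proof -
      have "emeasure (distr ?M borel (stretch k)) A = (\<integral>\<^sup>+x. indicator A x \<partial>distr ?M borel (stretch k))" by simp
      also have "\<dots> = (\<integral>\<^sup>+x. indicator A (stretch k x) \<partial>?M)" by (rule nn_integral_distr) auto
      also have "\<dots> = (\<integral>\<^sup>+x. indicator A (stretch k x) * ennreal (radial_weight x) \<partial>lborel)"
        by (subst nn_integral_density) (auto simp: mult.commute)
      finally show ?thesis .
    qed
    moreover have "emeasure ?N A = (\<integral>\<^sup>+x. ennreal (1 / k) * (indicator A x * ennreal (radial_weight x)) \<partial>lborel)"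
      using k by (subst emeasure_density)
        (auto simp: ennreal_mult[symmetric] radial_weight_nonneg indicator_def intro!: nn_integral_cong)
    moreover have "\<dots> = ennreal (1 / k) * (ennreal k * (\<integral>\<^sup>+x. indicator A (stretch k x) * ennreal (radial_weight x) \<partial>lborel))"
      using k by (subst nn_integral_cmult, measurable) (subst nn_integral_stretch[OF _ k], auto)
    moreover have "\<dots> = (\<integral>\<^sup>+x. indicator A (stretch k x) * ennreal (radial_weight x) \<partial>lborel)"
      using k by (simp add: mult.assoc[symmetric] ennreal_mult[symmetric])
    ultimately show "emeasure (distr ?M borel (stretch k)) A = emeasure ?N A" by simp
  qed simp
  have "(LINT x|lborel. f (stretch k x) * radial_weight x) = (LINT x|?M. f (stretch k x))"
    by (subst integral_density) (auto simp: radial_weight_nonneg mult.commute)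
  also have "\<dots> = (LINT x|?N. f x)"
    unfolding eq[symmetric] by (rule integral_distr[symmetric]) auto
  also have "\<dots> = (LINT x|lborel. (f x * radial_weight x) / k)"
    using k by (subst integral_density) (auto simp: radial_weight_nonneg mult.commute)
  finally show ?thesis by simp
qed

text \<open>The Euler operator \<open>x . grad u\<close>: \<open>|x|\<close> times the radial
  derivative, or the derivative with respect to \<open>ln |x|\<close>.\<close>

definition radial_part :: "(real ^ 'n::finite \<Rightarrow> 'v::euclidean_space) \<Rightarrow> real ^ 'n \<Rightarrow> 'v"
  where "radial_part u x = (\<Sum>i\<in>UNIV. (x $ i) *\<^sub>R partial_deriv i u x)"

lemma radial_part_gradient: "radial_part u x = (\<Sum>i\<in>UNIV. (x $ i) *\<^sub>R gradient u x $ i)"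
  by (simp add: radial_part_def gradient_def)

lemma norm_radial_part_le: "norm (radial_part u x) \<le> norm x * norm (gradient u x)"
  unfolding radial_part_gradient by (rule norm_directional_le)

lemma radial_part_measurable:
  fixes u :: "real ^ 'n::finite \<Rightarrow> 'v::euclidean_space"
  assumes "C1 u" shows "radial_part u \<in> borel_measurable borel"
  unfolding radial_part_def using assms
  by (intro borel_measurable_continuous_onI continuous_intros C1_continuous_partial)

lemma radial_sq_le: "(norm (radial_part u x))^2 / (norm x)^2 \<le> (norm (gradient u x))^2"
proof (cases "x = 0")
  case False
  have "(norm (radial_part u x))^2 \<le> (norm x * norm (gradient u x))^2"
    by (intro power_mono norm_radial_part_le) simp
  then show ?thesis using False by (simp add: power_mult_distrib divide_le_eq mult.commute)
qed simp

lemma radial_cross_le: "\<bar>u x \<bullet> radial_part u x\<bar> / (norm x)^2 \<le> (norm (gradient u x))^2 + (norm (u x))^2 / (norm x)^2"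
proof (cases "x = 0")
  case False
  have "\<bar>u x \<bullet> radial_part u x\<bar> \<le> norm (u x) * (norm x * norm (gradient u x))"
    by (rule order_trans[OF Cauchy_Schwarz_ineq2]) (intro mult_left_mono norm_radial_part_le, simp)
  then have "\<bar>u x \<bullet> radial_part u x\<bar> / (norm x)^2 \<le> (norm (u x) / norm x) * norm (gradient u x)"
    using False by (simp add: field_simps power2_eq_square)
  also have "\<dots> \<le> (norm (gradient u x))^2 + (norm (u x) / norm x)^2"
  proof -
    have "0 \<le> (norm (u x) / norm x) * norm (gradient u x)" by simp
    with sum_squares_bound[of "norm (u x) / norm x" "norm (gradient u x)"] show ?thesis by linarith
  qed
  finally show ?thesis by (simp add: power_divide)
qed simp

definition radial_energy :: "(real ^ 'n::finite \<Rightarrow> 'v::euclidean_space) \<Rightarrow> real"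
  where "radial_energy u = (LINT x|lborel. (norm (radial_part u x))^2 / (norm x)^2)"

lemma radial_energy_integrable:
  fixes u :: "real ^ 'n::finite \<Rightarrow> 'v::euclidean_space"
  assumes "C1c u"
  shows "integrable lborel (\<lambda>x. (norm (radial_part u x))^2 / (norm x)^2)"
proof (rule integrable_dominated_nonneg[OF dirichlet_integrable[OF assms]])
  note [measurable] = radial_part_measurable[OF C1c_C1[OF assms]]
  show "(\<lambda>x. (norm (radial_part u x))^2 / (norm x)^2) \<in> borel_measurable lborel" by measurable
qed (simp_all add: radial_sq_le)

lemma radial_energy_le:
  assumes "C1c u" shows "radial_energy u \<le> dirichlet u"
  unfolding radial_energy_def dirichlet_def
  by (intro integral_mono radial_energy_integrable dirichlet_integrable assms radial_sq_le)

text \<open>The integrand is half the pairing of \<open>grad |u|^2\<close> with the field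
  \<open>x / |x|^2\<close>, whose divergence is \<open>(d - 2) / |x|^2\<close>. An equality is
  wanted, so the regularised identity \<open>hardy_field\<close> passes to the limit by dominated
  convergence rather than by Fatou's lemma.\<close>

lemma radial_cross:
  fixes u :: "real ^ 'n::finite \<Rightarrow> 'v::euclidean_space"
  assumes u: "C1c u" and d: "3 \<le> CARD('n)"
  shows "integrable lborel (\<lambda>x. (u x \<bullet> radial_part u x) / (norm x)^2)"
    "2 * (LINT x|lborel. (u x \<bullet> radial_part u x) / (norm x)^2) = - (real CARD('n) - 2) * hardy_int u 0"
proof -
  note C = C1c_C1[OF u]
  note [measurable] = radial_part_measurable[OF C] C1_borel[OF C]
  note hi = hardy[OF u d, of 0]
  have hi': "integrable lborel (\<lambda>x. (norm (u x))^2 / (norm x)^2)" using hi by simp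
  show int: "integrable lborel (\<lambda>x. (u x \<bullet> radial_part u x) / (norm x)^2)"
    by (rule Bochner_Integration.integrable_bound[OF Bochner_Integration.integrable_add[OF dirichlet_integrable[OF u] hi']])
      (auto intro!: AE_I2 order_trans[OF radial_cross_le])
  define k where "k n x = inverse ((norm x)^2 + 1 / real (Suc n))" for n and x :: "real^'n"
  define w where "w n x = 2 * k n x * (u x \<bullet> radial_part u x) + real CARD('n) * (k n x * (norm (u x))^2)
        - 2 * (k n x)^2 * (norm x)^2 * (norm (u x))^2" for n x
  define W where "W x = 2 * ((u x \<bullet> radial_part u x) / (norm x)^2) + (real CARD('n) - 2) * ((norm (u x))^2 / (norm x)^2)" for x
  \<comment> \<open>Majorant of all \<open>w n\<close> away from the origin: the regularised kernel
    satisfies \<open>0 \<le> k n x \<le> 1 / |x|^2\<close>, and \<open>radial_cross_le\<close>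
    bounds the mixed term.\<close>
  define B where "B x = 2 * ((norm (gradient u x))^2 + (norm (u x))^2 / (norm x)^2) + (real CARD('n) + 2) * ((norm (u x))^2 / (norm x)^2)" for x
  have "(LINT x|lborel. w n x) = 0" for n
    using hardy_field(2)[OF u, of "1 / real (Suc n)" 0]
    by (simp add: w_def k_def radial_part_gradient)
  moreover have "(\<lambda>n. LINT x|lborel. w n x) \<longlonglongrightarrow> (LINT x|lborel. W x)"
  proof (rule integral_dominated_convergence[where w = B])
    show "integrable lborel B" unfolding B_def
      by (intro Bochner_Integration.integrable_add integrable_mult_right dirichlet_integrable u hi')
    show "W \<in> borel_measurable lborel" unfolding W_def by measurable
    show "w n \<in> borel_measurable lborel" for n unfolding w_def k_def by measurable
    show "AE x in lborel. (\<lambda>n. w n x) \<longlonglongrightarrow> W x"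
      using AE_lborel_singleton[of 0]
    proof eventually_elim
      case (elim x)
      then have x: "(norm x)^2 \<noteq> 0" by simp
      have "(\<lambda>n. (norm x)^2 + 1 / real (Suc n)) \<longlonglongrightarrow> (norm x)^2 + 0"
        using LIMSEQ_inverse_real_of_nat by (intro tendsto_intros) (simp add: inverse_eq_divide)
      then have k: "(\<lambda>n. k n x) \<longlonglongrightarrow> inverse ((norm x)^2)"
        unfolding k_def using x by (intro tendsto_inverse) auto
      have "(\<lambda>n. w n x) \<longlonglongrightarrow> 2 * inverse ((norm x)^2) * (u x \<bullet> radial_part u x) + real CARD('n) * (inverse ((norm x)^2) * (norm (u x))^2)
        - 2 * (inverse ((norm x)^2))^2 * (norm x)^2 * (norm (u x))^2"
        unfolding w_def by (intro tendsto_intros k)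
      also have "2 * inverse ((norm x)^2) * (u x \<bullet> radial_part u x) + real CARD('n) * (inverse ((norm x)^2) * (norm (u x))^2)
        - 2 * (inverse ((norm x)^2))^2 * (norm x)^2 * (norm (u x))^2 = W x"
        using x by (simp add: W_def field_simps power2_eq_square)
      finally show ?case .
    qed
    show "AE x in lborel. norm (w n x) \<le> B x" for n
      using AE_lborel_singleton[of 0]
    proof eventually_elim
      case (elim x)
      define q where "q = inverse ((norm x)^2)"
      have k: "0 \<le> k n x" "k n x \<le> q" using elim unfolding k_def q_def by (auto intro!: le_imp_inverse_le)
      have q: "q * (norm x)^2 = 1" using elim by (simp add: q_def)
      have "\<bar>2 * k n x * (u x \<bullet> radial_part u x)\<bar> \<le> 2 * (q * \<bar>u x \<bullet> radial_part u x\<bar>)"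
        using k by (simp add: abs_mult mult_right_mono)
      also have "\<dots> \<le> 2 * ((norm (gradient u x))^2 + (norm (u x))^2 / (norm x)^2)"
        using radial_cross_le[of u x] by (simp add: q_def divide_inverse mult.commute)
      finally have 1: "\<bar>2 * k n x * (u x \<bullet> radial_part u x)\<bar> \<le> 2 * ((norm (gradient u x))^2 + (norm (u x))^2 / (norm x)^2)" .
      have 2: "\<bar>real CARD('n) * (k n x * (norm (u x))^2)\<bar> \<le> real CARD('n) * (q * (norm (u x))^2)"
        using k by (simp add: abs_mult mult_left_mono mult_right_mono)
      have "(k n x)^2 * (norm x)^2 \<le> q^2 * (norm x)^2" using k by (intro mult_right_mono power_mono) auto
      also have "\<dots> = q" using q by (simp add: power2_eq_square)
      finally have "(k n x)^2 * (norm x)^2 * (norm (u x))^2 \<le> q * (norm (u x))^2" by (rule mult_right_mono) simp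
      then have 3: "\<bar>2 * (k n x)^2 * (norm x)^2 * (norm (u x))^2\<bar> \<le> 2 * (q * (norm (u x))^2)"
        by (simp add: abs_mult)
      have "norm (w n x) \<le> 2 * ((norm (gradient u x))^2 + (norm (u x))^2 / (norm x)^2) + real CARD('n) * (q * (norm (u x))^2) + 2 * (q * (norm (u x))^2)"
        using 1 2 3 unfolding w_def real_norm_def by linarith
      also have "\<dots> = B x" by (simp add: B_def q_def divide_inverse algebra_simps)
      finally show ?case .
    qed
  qed
  ultimately have "(LINT x|lborel. W x) = 0" by (simp add: LIMSEQ_const_iff)
  moreover have "(LINT x|lborel. W x) = 2 * (LINT x|lborel. (u x \<bullet> radial_part u x) / (norm x)^2) + (real CARD('n) - 2) * hardy_int u 0"
    unfolding W_def hardy_int_def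
    by (subst Bochner_Integration.integral_add, (intro integrable_mult_right int hi')+)
      (simp only: integral_mult_right_zero diff_zero)
  ultimately show "2 * (LINT x|lborel. (u x \<bullet> radial_part u x) / (norm x)^2) = - (real CARD('n) - 2) * hardy_int u 0"
    by (simp add: algebra_simps)
qed

text \<open>
  In the variables \<open>t = ln |x|\<close> and \<open>x / |x|\<close>, \<open>twist k\<close> sends \<open>w(t) = |x| powr ((d-2)/2) u\<close> to \<open>w(k t)\<close>.
\<close>

definition twist :: "real \<Rightarrow> (real ^ 'n::finite \<Rightarrow> 'v::euclidean_space) \<Rightarrow> real ^ 'n \<Rightarrow> 'v"
  where "twist k u x = (norm x powr ((real CARD('n) - 2) * (k - 1) / 2)) *\<^sub>R u (stretch k x)"

section \<open>Derivative and energies of the twisted function\<close>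

lemma norm_powr_has_derivative:
  fixes x :: "'a::real_inner"
  assumes "x \<noteq> 0"
  shows "((\<lambda>x. norm x powr a) has_derivative (\<lambda>h. a * norm x powr (a - 2) * (x \<bullet> h))) (at x)"
proof -
  have x: "norm x > 0" using assms by simp
  have "((\<lambda>x. norm x powr a) has_derivative (\<lambda>h. (a * norm x powr (a - 1)) * (h \<bullet> sgn x))) (at x)"
    by (rule has_derivative_compose[OF has_derivative_norm[OF assms]])
      (use has_real_derivative_powr[OF x, of a] in \<open>simp add: has_field_derivative_def\<close>)
  also have "(\<lambda>h. (a * norm x powr (a - 1)) * (h \<bullet> sgn x)) = (\<lambda>h. a * norm x powr (a - 2) * (x \<bullet> h))"
    using x by (auto simp: fun_eq_iff sgn_div_norm powr_diff inner_commute power2_eq_square divide_inverse)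
  finally show ?thesis .
qed

text \<open>Serves for the gradient of \<open>twist k u\<close>, with \<open>c = k - 1\<close>.
  Adding \<open>c\<close> times the radial projection multiplies the radial part of \<open>g\<close>
  by \<open>1 + c\<close> and leaves the tangential part alone, whence
  \<open>2 * c + c^2 = (1 + c)^2 - 1\<close>. The summand with \<open>v\<close> comes from
  differentiating the power of the norm.\<close>

lemma sum_radial_expand:
  fixes g :: "'n::finite \<Rightarrow> 'v::euclidean_space" and x :: "real ^ 'n"
  assumes x: "x \<noteq> 0" and s: "s = (\<Sum>i\<in>UNIV. (x $ i) *\<^sub>R g i)"
  shows "(\<Sum>i\<in>UNIV. (norm (a *\<^sub>R (g i + (c * x $ i / (norm x)^2) *\<^sub>R s) + (b * x $ i) *\<^sub>R v))^2) =
    a^2 * ((\<Sum>i\<in>UNIV. (norm (g i))^2) + (2 * c + c^2) * (norm s)^2 / (norm x)^2) + 2 * a * b * (1 + c) * (v \<bullet> s) + b^2 * (norm x)^2 * (norm v)^2"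
proof -
  define P where "P = (norm x)^2"
  have P: "P \<noteq> 0" using x by (simp add: P_def)
  have sx: "(\<Sum>i\<in>UNIV. (x $ i)^2) = P" by (simp add: P_def sum_coord_sq)
  have sg: "(\<Sum>i\<in>UNIV. x $ i * (g i \<bullet> w)) = s \<bullet> w" for w
    unfolding s inner_sum_left by simp
  have "(norm (a *\<^sub>R (g i + (c * x $ i / P) *\<^sub>R s) + (b * x $ i) *\<^sub>R v))^2 =
      a^2 * (norm (g i))^2 + (2 * a^2 * c / P) * (x $ i * (g i \<bullet> s)) + (a^2 * c^2 / P^2 * (s \<bullet> s)) * (x $ i)^2
      + (2 * a * b) * (x $ i * (g i \<bullet> v)) + (2 * a * b * c / P * (s \<bullet> v)) * (x $ i)^2 + (b^2 * (v \<bullet> v)) * (x $ i)^2" for i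
  proof -
    have ex: "(norm (a *\<^sub>R (h + c' *\<^sub>R s) + b' *\<^sub>R v))^2 = a^2 * (norm h)^2 + 2 * a^2 * c' * (h \<bullet> s) + a^2 * c'^2 * (s \<bullet> s)
        + 2 * a * b' * (h \<bullet> v) + 2 * a * b' * c' * (s \<bullet> v) + b'^2 * (v \<bullet> v)" for h c' b'
      unfolding power2_norm_eq_inner
      by (simp add: inner_add_left inner_add_right inner_commute[of s h] inner_commute[of v h] inner_commute[of v s] power2_eq_square algebra_simps)
    have rearr: "a^2 * G + 2 * a^2 * (c * X / P) * S1 + a^2 * (c * X / P)^2 * S2 + 2 * a * (b * X) * V1 + 2 * a * (b * X) * (c * X / P) * S3 + (b * X)^2 * V2
      = a^2 * G + (2 * a^2 * c / P) * (X * S1) + (a^2 * c^2 / P^2 * S2) * X^2 + (2 * a * b) * (X * V1) + (2 * a * b * c / P * S3) * X^2 + (b^2 * V2) * X^2"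
      for G X S1 S2 S3 V1 V2 :: real
      using P by (simp add: field_simps power2_eq_square)
    show ?thesis
      unfolding ex rearr ..
  qed
  then have "(\<Sum>i\<in>UNIV. (norm (a *\<^sub>R (g i + (c * x $ i / P) *\<^sub>R s) + (b * x $ i) *\<^sub>R v))^2) =
    a^2 * (\<Sum>i\<in>UNIV. (norm (g i))^2) + (2 * a^2 * c / P) * (s \<bullet> s) + (a^2 * c^2 / P^2 * (s \<bullet> s)) * P
      + (2 * a * b) * (s \<bullet> v) + (2 * a * b * c / P * (s \<bullet> v)) * P + (b^2 * (v \<bullet> v)) * P"
    by (simp only: sum.distrib sum_distrib_left[symmetric] sx sg)
  also have "\<dots> = a^2 * ((\<Sum>i\<in>UNIV. (norm (g i))^2) + (2 * c + c^2) * (norm s)^2 / P) + 2 * a * b * (1 + c) * (v \<bullet> s) + b^2 * P * (norm v)^2"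
    unfolding power2_norm_eq_inner using P by (simp add: inner_commute field_simps power2_eq_square)
  finally show ?thesis by (simp add: P_def)
qed

context
  fixes u :: "real ^ 'n::finite \<Rightarrow> 'v::euclidean_space" and \<delta> k :: real
  assumes u: "C1c u" and d: "3 \<le> CARD('n)" and \<delta>: "\<delta> > 0" "\<And>x. norm x < \<delta> \<Longrightarrow> u x = 0" and k: "k > 0"
begin

lemma twist_near_0: "norm x < \<delta> powr (1 / k) \<Longrightarrow> twist k u x = 0"
proof -
  assume "norm x < \<delta> powr (1 / k)"
  then have "norm x powr k < (\<delta> powr (1 / k)) powr k" using k by (intro powr_less_mono2) auto
  also have "\<dots> = \<delta>" using k \<delta>(1) by (simp add: powr_powr)
  finally show ?thesis by (simp add: twist_def norm_stretch \<delta>(2))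
qed

lemma twist_has_derivative:
  defines "\<alpha> \<equiv> (real CARD('n) - 2) * (k - 1) / 2"
  assumes x: "x \<noteq> 0"
  shows "(twist k u has_derivative (\<lambda>h. (norm x powr \<alpha>) *\<^sub>R (\<Sum>i\<in>UNIV. ((norm x powr (k - 1)) *\<^sub>R h + ((k - 1) * norm x powr (k - 1 - 2) * (x \<bullet> h)) *\<^sub>R x) $ i *\<^sub>R partial_deriv i u (stretch k x))
      + (\<alpha> * norm x powr (\<alpha> - 2) * (x \<bullet> h)) *\<^sub>R u (stretch k x))) (at x)"
proof -
  have 1: "(stretch k has_derivative (\<lambda>h. (norm x powr (k - 1)) *\<^sub>R h + ((k - 1) * norm x powr (k - 1 - 2) * (x \<bullet> h)) *\<^sub>R x)) (at x)"
    unfolding stretch_def[abs_def]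
    by (rule has_derivative_scaleR[OF norm_powr_has_derivative[OF x] has_derivative_ident])
  show ?thesis
    unfolding twist_def[abs_def] \<alpha>_def[symmetric]
    by (rule has_derivative_scaleR[OF norm_powr_has_derivative[OF x] has_derivative_compose[OF 1 C1_has_derivative[OF C1c_C1[OF u]]]])
qed

lemma partial_twist:
  defines "\<alpha> \<equiv> (real CARD('n) - 2) * (k - 1) / 2"
  assumes x: "x \<noteq> 0"
  shows "partial_deriv i (twist k u) x = (norm x powr (\<alpha> + (k - 1))) *\<^sub>R (partial_deriv i u (stretch k x)
      + ((k - 1) * x $ i / (norm x)^2) *\<^sub>R (\<Sum>j\<in>UNIV. (x $ j) *\<^sub>R partial_deriv j u (stretch k x)))
      + (\<alpha> * norm x powr (\<alpha> - 2) * x $ i) *\<^sub>R u (stretch k x)"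
proof -
  let ?g = "\<lambda>j. partial_deriv j u (stretch k x)"
  define c where "c = (k - 1) * x $ i / (norm x)^2"
  have c: "(k - 1) * norm x powr (k - 1 - 2) * x $ i = (norm x powr (k - 1)) * c"
    using x by (simp add: c_def powr_diff power2_eq_square power3_eq_cube mult_ac)
  have "(\<Sum>j\<in>UNIV. ((norm x powr (k - 1)) *\<^sub>R axis i 1 + ((norm x powr (k - 1)) * c) *\<^sub>R x) $ j *\<^sub>R ?g j)
    = (\<Sum>j\<in>UNIV. ((norm x powr (k - 1)) * axis i 1 $ j) *\<^sub>R ?g j) + ((norm x powr (k - 1)) * c) *\<^sub>R (\<Sum>j\<in>UNIV. (x $ j) *\<^sub>R ?g j)"
    by (simp add: scaleR_add_left sum.distrib scaleR_sum_right mult.assoc)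
  also have "(\<Sum>j\<in>UNIV. ((norm x powr (k - 1)) * axis i 1 $ j) *\<^sub>R ?g j) = (norm x powr (k - 1)) *\<^sub>R ?g i"
    by (subst sum.remove[of UNIV i]) (auto simp: axis_def intro!: sum.neutral)
  finally have "(\<Sum>j\<in>UNIV. ((norm x powr (k - 1)) *\<^sub>R axis i 1 + ((norm x powr (k - 1)) * c) *\<^sub>R x) $ j *\<^sub>R ?g j)
     = (norm x powr (k - 1)) *\<^sub>R (?g i + c *\<^sub>R (\<Sum>j\<in>UNIV. (x $ j) *\<^sub>R ?g j))"
    by (simp add: scaleR_add_right)
  moreover have "x \<bullet> axis i 1 = x $ i" by (simp add: inner_axis)
  ultimately show ?thesis
    unfolding partial_deriv_eq[OF twist_has_derivative[OF x]] \<alpha>_def[symmetric] c_def[symmetric]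
    by (simp only: c powr_add scaleR_scaleR)
qed

text \<open>The powers of the norm may be singular at the origin. Since \<open>u\<close> vanishes on
  a ball around it, so does \<open>twist k u\<close>, and the explicit derivatives serve only on the
  complement of the origin; the two open sets cover the space.\<close>

lemma C1c_twist: "C1c (twist k u)"
proof -
  obtain R where R: "0 < R" "\<And>x. R < norm x \<Longrightarrow> u x = 0" using C1c_support[OF u] by metis
  define \<rho> where "\<rho> = \<delta> powr (1 / k)"
  have \<rho>: "\<rho> > 0" using \<delta> by (simp add: \<rho>_def)
  have z: "twist k u x = 0" if "x \<in> ball 0 \<rho>" for x
    using twist_near_0[of x] that by (simp add: \<rho>_def)
  note C = C1c_C1[OF u]
  have c1: "continuous_on (- {0}) (stretch k :: real^'n \<Rightarrow> _)"
    unfolding stretch_def by (intro continuous_intros) auto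
  have diff: "twist k u differentiable at x" for x
  proof (cases "x = 0")
    case True
    have "(twist k u has_derivative (\<lambda>h. 0)) (at x)"
      by (rule has_derivative_transform_within_open[of "\<lambda>_. 0" _ x UNIV "ball 0 \<rho>"]) (use z \<rho> True in auto)
    then show ?thesis unfolding differentiable_def by blast
  next
    case False
    from twist_has_derivative[OF False] show ?thesis unfolding differentiable_def by blast
  qed
  have "continuous_on UNIV (partial_deriv i (twist k u))" for i
  proof -
    have "continuous_on (- {0}) (partial_deriv i (twist k u))"
    proof (subst continuous_on_cong[OF refl])
      show "partial_deriv i (twist k u) x = (norm x powr ((real CARD('n) - 2) * (k - 1) / 2 + (k - 1))) *\<^sub>R (partial_deriv i u (stretch k x)
      + ((k - 1) * x $ i / (norm x)^2) *\<^sub>R (\<Sum>j\<in>UNIV. (x $ j) *\<^sub>R partial_deriv j u (stretch k x)))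
      + ((real CARD('n) - 2) * (k - 1) / 2 * norm x powr ((real CARD('n) - 2) * (k - 1) / 2 - 2) * x $ i) *\<^sub>R u (stretch k x)" if "x \<in> - {0}" for x
        using that by (intro partial_twist) auto
      show "continuous_on (- {0}) (\<lambda>x. (norm x powr ((real CARD('n) - 2) * (k - 1) / 2 + (k - 1))) *\<^sub>R (partial_deriv i u (stretch k x)
      + ((k - 1) * x $ i / (norm x)^2) *\<^sub>R (\<Sum>j\<in>UNIV. (x $ j) *\<^sub>R partial_deriv j u (stretch k x)))
      + ((real CARD('n) - 2) * (k - 1) / 2 * norm x powr ((real CARD('n) - 2) * (k - 1) / 2 - 2) * x $ i) *\<^sub>R u (stretch k x))"
        by (intro continuous_intros continuous_on_compose2[OF C1_continuous_partial[OF C] c1] continuous_on_compose2[OF C1_continuous[OF C] c1]) auto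
    qed
    moreover have "continuous_on (ball 0 \<rho>) (partial_deriv i (twist k u))"
      by (subst continuous_on_cong[OF refl partial_deriv_eq_0[of "ball 0 \<rho>"]]) (use z in auto)
    ultimately have "continuous_on (- {0} \<union> ball 0 \<rho>) (partial_deriv i (twist k u))"
      by (intro continuous_on_open_Un) auto
    also have "- {0} \<union> ball 0 \<rho> = (UNIV :: (real^'n) set)" using \<rho> by auto
    finally show ?thesis .
  qed
  then have "C1 (twist k u)" using diff by (simp add: C1_def differentiable_on_def)
  then show ?thesis
  proof (rule C1cI)
    fix x :: "real^'n" assume "R powr (1 / k) < norm x"
    then have "(R powr (1 / k)) powr k < norm x powr k" using k by (intro powr_less_mono2) auto
    then have "R < norm (stretch k x)" using k R(1) by (simp add: powr_powr norm_stretch)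
    then show "twist k u x = 0" by (simp add: twist_def R(2))
  qed
qed

lemma powr_twist_weight:
  assumes "x \<noteq> (0::real^'n)"
  shows "norm x powr (real CARD('n) * (k - 1)) = norm (stretch k x) ^ CARD('n) * radial_weight x"
proof -
  have "norm (stretch k x) ^ CARD('n) * radial_weight x = norm x powr (k * real CARD('n)) / norm x powr (real CARD('n))"
    using assms by (simp add: norm_stretch powr_realpow[symmetric] powr_powr radial_weight_def divide_inverse)
  also have "\<dots> = norm x powr (real CARD('n) * (k - 1))"
    unfolding powr_diff[symmetric] by (simp add: algebra_simps)
  finally show ?thesis ..
qed

text \<open>The factor in the third assumption is \<open>norm (stretch k x) ^ CARD('n)\<close>
  divided by \<open>norm x ^ CARD('n)\<close>, so passing to the dilation-invariant measure reduces
  the claim to \<open>integral_stretch\<close>. The exponent in \<open>twist\<close> is the one for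
  which the Hardy, \<open>L^p\<close> and Dirichlet densities all acquire this factor.\<close>

lemma integral_twist:
  fixes f g :: "real ^ 'n \<Rightarrow> real"
  assumes [measurable]: "f \<in> borel_measurable borel" "g \<in> borel_measurable borel"
    and g: "\<And>x. x \<noteq> 0 \<Longrightarrow> g x = norm x powr (real CARD('n) * (k - 1)) * f (stretch k x)"
  shows "(LINT x|lborel. g x) = (LINT x|lborel. f x) / k"
proof -
  have "(LINT x|lborel. g x) = (LINT x|lborel. (norm (stretch k x) ^ CARD('n) * f (stretch k x)) * radial_weight x)"
  proof (rule integral_cong_AE)
    show "AE x in lborel. g x = (norm (stretch k x) ^ CARD('n) * f (stretch k x)) * radial_weight x"
      using AE_lborel_singleton[of 0] by eventually_elim (simp add: g powr_twist_weight)
  qed measurable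
  also have "\<dots> = (LINT x|lborel. (norm x ^ CARD('n) * f x) * radial_weight x) / k"
    by (rule integral_stretch[OF _ k]) measurable
  also have "(LINT x|lborel. (norm x ^ CARD('n) * f x) * radial_weight x) = (LINT x|lborel. f x)"
  proof (rule integral_cong_AE)
    show "AE x in lborel. (norm x ^ CARD('n) * f x) * radial_weight x = f x"
      using AE_lborel_singleton[of 0] by eventually_elim (simp add: radial_weight_def)
  qed measurable
  finally show ?thesis .
qed

lemma hardy_int_twist: "hardy_int (twist k u) 0 = hardy_int u 0 / k"
  unfolding hardy_int_def
proof (rule integral_twist)
  note [measurable] = C1_borel[OF C1c_C1[OF u]] C1_borel[OF C1c_C1[OF C1c_twist]]
  show "(\<lambda>x. (norm (u x))^2 / (norm (x - 0))^2) \<in> borel_measurable borel"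
    "(\<lambda>x. (norm (twist k u x))^2 / (norm (x - 0))^2) \<in> borel_measurable borel" by measurable
  fix x :: "real^'n" assume x: "x \<noteq> 0"
  have "(norm x powr ((real CARD('n) - 2) * (k - 1) / 2))^2 / (norm x)^2 =
      norm x powr (2 * ((real CARD('n) - 2) * (k - 1) / 2) - 2)"
    using x by (simp add: powr_diff powr_power)
  also have "2 * ((real CARD('n) - 2) * (k - 1) / 2) - 2 = real CARD('n) * (k - 1) - 2 * k" by (simp add: field_simps)
  also have "norm x powr (real CARD('n) * (k - 1) - 2 * k) = norm x powr (real CARD('n) * (k - 1)) / (norm x powr k)^2"
    using x by (simp add: powr_diff powr_power)
  finally show "(norm (twist k u x))^2 / (norm (x - 0))^2 =
      norm x powr (real CARD('n) * (k - 1)) * ((norm (u (stretch k x)))^2 / (norm (stretch k x - 0))^2)"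
    by (simp add: twist_def norm_stretch power_mult_distrib)
       (metis (no_types, lifting) mult.commute times_divide_eq_right)
qed

lemma powr_int_twist:
  defines "p \<equiv> 2 * real CARD('n) / (real CARD('n) - 2)"
  shows "(LINT x|lborel. norm (twist k u x) powr p) = (LINT x|lborel. norm (u x) powr p) / k"
proof (rule integral_twist)
  note [measurable] = C1_borel[OF C1c_C1[OF u]] C1_borel[OF C1c_C1[OF C1c_twist]]
  show "(\<lambda>x. norm (u x) powr p) \<in> borel_measurable borel"
    "(\<lambda>x. norm (twist k u x) powr p) \<in> borel_measurable borel" by measurable
  fix x :: "real^'n"
  have "(real CARD('n) - 2) * (k - 1) / 2 * p = real CARD('n) * (k - 1)"
    using d by (simp add: p_def)
  moreover have "norm (twist k u x) = norm x powr ((real CARD('n) - 2) * (k - 1) / 2) * norm (u (stretch k x))"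
    by (simp add: twist_def)
  ultimately show "norm (twist k u x) powr p = norm x powr (real CARD('n) * (k - 1)) * norm (u (stretch k x)) powr p"
    by (simp only: powr_mult powr_powr)
qed

text \<open>With \<open>m = d - 2\<close>, \<open>u = |x| powr (- m / 2) w\<close> and
  \<open>t = ln |x|\<close>, the energy is the integral of \<open>|w_t|^2\<close>, the squared
  angular gradient and \<open>m^2 / 4 * |w|^2\<close>. Only \<open>|w_t|^2\<close>, whose integral
  is \<open>radial_energy u - m^2 / 4 * hardy_int u 0\<close>, is multiplied by \<open>k^2\<close>;
  the change of variables divides the whole by \<open>k\<close>.\<close>

lemma dirichlet_twist:
  "dirichlet (twist k u) = (dirichlet u + (k^2 - 1) * (radial_energy u - (real CARD('n) - 2)^2 / 4 * hardy_int u 0)) / k"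
proof -
  note C = C1c_C1[OF u]
  note [measurable] = C1_borel[OF C] C1_gradient_borel[OF C] radial_part_measurable[OF C]
    C1_gradient_borel[OF C1c_C1[OF C1c_twist]]
  define m where "m = real CARD('n) - 2"
  define \<alpha> where "\<alpha> = m * (k - 1) / 2"
  define \<Psi> where "\<Psi> z = (norm (gradient u z))^2 + (k^2 - 1) * ((norm (radial_part u z))^2 / (norm z)^2)
     + 2 * \<alpha> * k * ((u z \<bullet> radial_part u z) / (norm z)^2) + \<alpha>^2 * ((norm (u z))^2 / (norm z)^2)" for z
  have "dirichlet (twist k u) = (LINT x|lborel. \<Psi> x) / k"
    unfolding dirichlet_def
  proof (rule integral_twist)
    show "\<Psi> \<in> borel_measurable borel" unfolding \<Psi>_def by measurable
    show "(\<lambda>x. (norm (gradient (twist k u) x))^2) \<in> borel_measurable borel" by measurable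
    fix x :: "real^'n" assume x: "x \<noteq> 0"
    define P where "P = norm x"
    have P: "P > 0" using x by (simp add: P_def)
    define z where "z = stretch k x"
    have nz: "norm z = P powr k" by (simp add: z_def norm_stretch P_def)
    define s where "s = (\<Sum>j\<in>UNIV. (x $ j) *\<^sub>R partial_deriv j u z)"
    have rz: "radial_part u z = (P powr (k - 1)) *\<^sub>R s"
      unfolding radial_part_def s_def scaleR_sum_right by (simp add: z_def stretch_def P_def)
    define a where "a = P powr (\<alpha> + (k - 1))"
    define b where "b = \<alpha> * P powr (\<alpha> - 2)"
    have "(norm (gradient (twist k u) x))^2 = (\<Sum>i\<in>UNIV. (norm (a *\<^sub>R (partial_deriv i u z + ((k - 1) * x $ i / (norm x)^2) *\<^sub>R s) + (b * x $ i) *\<^sub>R u z))^2)"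
      unfolding gradient_norm_sq partial_twist[OF x] a_def b_def \<alpha>_def m_def s_def z_def P_def ..
    also have "\<dots> = a^2 * ((norm (gradient u z))^2 + (2 * (k - 1) + (k - 1)^2) * (norm s)^2 / P^2) + 2 * a * b * (1 + (k - 1)) * (u z \<bullet> s) + b^2 * P^2 * (norm (u z))^2"
      by (subst sum_radial_expand[OF x s_def]) (simp add: P_def gradient_norm_sq)
    also have "\<dots> = a^2 * \<Psi> z"
    proof -
      have 1: "(norm (radial_part u z))^2 / (norm z)^2 = (norm s)^2 / P^2"
        using P by (simp add: rz nz power_mult_distrib powr_diff power_divide)
      have 2: "a * (2 * \<alpha> * k * ((u z \<bullet> radial_part u z) / (norm z)^2)) = 2 * b * k * (u z \<bullet> s)"
      proof -
        have "P powr (\<alpha> + (k - 1)) * (P powr (k - 1) / (P powr k)^2) = P powr ((\<alpha> + (k - 1)) + ((k - 1) - k * 2))"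
          using P by (simp only: powr_add powr_diff) (simp add: powr_power mult.commute)
        also have "\<dots> = P powr (\<alpha> - 2)" by (simp add: algebra_simps)
        finally have "a * (P powr (k - 1) / (P powr k)^2) = P powr (\<alpha> - 2)" by (simp add: a_def)
        then have "a * (P powr (k - 1) / (P powr k)^2) * (2 * \<alpha> * k * (u z \<bullet> s)) = 2 * b * k * (u z \<bullet> s)"
          by (simp add: b_def)
        then show ?thesis by (simp add: rz nz mult_ac)
      qed
      have 3: "a^2 * (\<alpha>^2 * ((norm (u z))^2 / (norm z)^2)) = b^2 * P^2 * (norm (u z))^2"
      proof -
        have "a / P powr k = P powr (\<alpha> - 2) * P"
          using P unfolding a_def powr_diff[symmetric] by (simp add: powr_diff powr_add power2_eq_square)
        then have "(a / P powr k)^2 = (P powr (\<alpha> - 2) * P)^2" by simp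
        then have "(a / P powr k)^2 * (\<alpha>^2 * (norm (u z))^2) = b^2 * P^2 * (norm (u z))^2"
          by (simp add: b_def power_mult_distrib mult_ac)
        then show ?thesis by (simp add: nz power_divide mult_ac)
      qed
      have "a^2 * \<Psi> z = a^2 * ((norm (gradient u z))^2 + (k^2 - 1) * ((norm s)^2 / P^2)) + a * (a * (2 * \<alpha> * k * ((u z \<bullet> radial_part u z) / (norm z)^2)))
         + a^2 * (\<alpha>^2 * ((norm (u z))^2 / (norm z)^2))"
        unfolding \<Psi>_def 1 by (simp add: algebra_simps power2_eq_square)
      also have "\<dots> = a^2 * ((norm (gradient u z))^2 + (2 * (k - 1) + (k - 1)^2) * (norm s)^2 / P^2) + 2 * a * b * (1 + (k - 1)) * (u z \<bullet> s) + b^2 * P^2 * (norm (u z))^2"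
      proof -
        have "k^2 - 1 = 2 * (k - 1) + (k - 1)^2" by (simp add: power2_eq_square algebra_simps)
        then show ?thesis unfolding 2 3 by simp
      qed
      finally show ?thesis ..
    qed
    also have "a^2 = norm x powr (real CARD('n) * (k - 1))"
    proof -
      have "a^2 = P powr (2 * (\<alpha> + (k - 1)))" using P by (simp add: a_def powr_power mult.commute)
      also have "2 * (\<alpha> + (k - 1)) = real CARD('n) * (k - 1)" by (simp add: \<alpha>_def m_def field_simps)
      finally show ?thesis by (simp add: P_def)
    qed
    finally show "(norm (gradient (twist k u) x))^2 = norm x powr (real CARD('n) * (k - 1)) * \<Psi> (stretch k x)"
      by (simp add: z_def)
  qed
  also have "(LINT x|lborel. \<Psi> x) = dirichlet u + (k^2 - 1) * radial_energy u
      + 2 * \<alpha> * k * (LINT x|lborel. (u x \<bullet> radial_part u x) / (norm x)^2) + \<alpha>^2 * hardy_int u 0"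
  proof -
    have h: "integrable lborel (\<lambda>x. (norm (u x))^2 / (norm x)^2)" using hardy[OF u d, of 0] by simp
    note i1 = integrable_mult_right[OF radial_energy_integrable[OF u], of "k^2 - 1"]
    note i2 = integrable_mult_right[OF radial_cross(1)[OF u d], of "2 * \<alpha> * k"]
    note i3 = integrable_mult_right[OF h, of "\<alpha>^2"]
    note i4 = dirichlet_integrable[OF u]
    show ?thesis
      unfolding \<Psi>_def dirichlet_def radial_energy_def hardy_int_def
      using i1 i2 i3 i4 by (simp only: Bochner_Integration.integral_add Bochner_Integration.integrable_add integral_mult_right_zero) simp
  qed
  \<comment> \<open>The cross term is integrated by parts. With
    \<open>\<alpha> = m * (k - 1) / 2\<close> one has
    \<open>\<alpha>^2 - \<alpha> * k * m = - (k^2 - 1) * m^2 / 4\<close>, which joins the radial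
    energy.\<close>
  also have "2 * \<alpha> * k * (LINT x|lborel. (u x \<bullet> radial_part u x) / (norm x)^2) = \<alpha> * k * (- m * hardy_int u 0)"
    using radial_cross(2)[OF u d] by (simp add: m_def mult_ac)
  also have "dirichlet u + (k^2 - 1) * radial_energy u + \<alpha> * k * (- m * hardy_int u 0) + \<alpha>^2 * hardy_int u 0
    = dirichlet u + (k^2 - 1) * (radial_energy u - m^2 / 4 * hardy_int u 0)"
    by (simp add: \<alpha>_def power2_eq_square field_simps)
  finally show ?thesis by (simp add: m_def)
qed

end

lemma improved_sobolev_const_nonneg: "0 \<le> improved_sobolev_const"
  by (simp add: improved_sobolev_const_def)

section \<open>The inequality for continuously differentiable functions\<close>

text \<open>In dimension three Hardy's inequality allows \<open>H = 4 * D\<close>, hence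
  \<open>16 = 4^2\<close>. For \<open>D = 0\<close> this value is not positive, and
  \<open>H = 1\<close> takes its place.\<close>

lemma sobolev3:
  fixes u :: "real ^ 'n::finite \<Rightarrow> 'v::euclidean_space"
  assumes u: "C1c u" and d: "CARD('n) = 3"
  shows "(LINT x|lborel. (norm (u x)) ^ 6) \<le> 16 * improved_sobolev_const * dirichlet u ^ 3"
proof -
  have h: "hardy_int u y \<le> 4 * dirichlet u" for y using hardy[OF u, of y] d by simp
  show ?thesis
  proof (cases "dirichlet u = 0")
    case True
    then have "hardy_int u y \<le> 1" for y using h[of y] by simp
    from improved_sobolev[OF u d zero_less_one this] True show ?thesis by simp
  next
    case False
    then have "4 * dirichlet u > 0" using dirichlet_nonneg[of u] by simp
    from improved_sobolev[OF u d this h] show ?thesis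
      by (simp add: power2_eq_square power3_eq_cube mult_ac)
  qed
qed

lemma sobolev_hardy_deficit_away:
  fixes u :: "real ^ 'n::finite \<Rightarrow> 'v::euclidean_space"
  assumes u: "C1c u" and d: "CARD('n) = 3" and \<delta>: "\<delta> > 0" "\<And>x. norm x < \<delta> \<Longrightarrow> u x = 0"
  shows "(LINT x|lborel. (norm (u x)) ^ 6) \<le> 128 * improved_sobolev_const * (dirichlet u)^2 * (dirichlet u - hardy_int u 0 / 4)"
proof -
  have d3: "3 \<le> CARD('n)" using d by simp
  define D where "D = dirichlet u"
  define a where "a = D - hardy_int u 0 / 4"
  define X where "X = (LINT x|lborel. (norm (u x)) ^ 6)"
  define K where "K = 16 * improved_sobolev_const"
  have K: "K \<ge> 0" using improved_sobolev_const_nonneg by (simp add: K_def)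
  have a0: "a \<ge> 0" using hardy[OF u d3, of 0] d by (simp add: a_def D_def)
  have aD: "a \<le> D" using hardy_int_nonneg[of u 0] by (simp add: a_def)
  have D0: "D \<ge> 0" using dirichlet_nonneg[of u] by (simp add: D_def)
  have six: "norm (w x) powr (2 * real CARD('n) / (real CARD('n) - 2)) = norm (w x) ^ 6" for w :: "real^'n \<Rightarrow> 'v" and x
    using d by simp
  \<comment> \<open>Sobolev's inequality for \<open>twist k u\<close>. Replacing the radial energy
    by the larger \<open>D\<close>, which is legitimate as \<open>k^2 - 1 \<ge> 0\<close>, leaves a
    bound in terms of \<open>D\<close> and the deficit \<open>a\<close> alone.\<close>
  have main: "X \<le> K * k * ((D + k^2 * a) / k) ^ 3" if k: "k \<ge> 1" for k
  proof -
    have k0: "k > 0" using k by simp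
    have "X / k = (LINT x|lborel. (norm (twist k u x)) ^ 6)"
      using powr_int_twist[OF u d3 \<delta> k0] unfolding six X_def by simp
    also have "\<dots> \<le> K * dirichlet (twist k u) ^ 3"
      unfolding K_def by (rule sobolev3[OF C1c_twist[OF u d3 \<delta> k0] d])
    also have "\<dots> \<le> K * ((D + k^2 * a) / k) ^ 3"
    proof (intro mult_left_mono power_mono K dirichlet_nonneg)
      have "(k^2 - 1) * (radial_energy u - hardy_int u 0 / 4) \<le> (k^2 - 1) * a"
        using radial_energy_le[OF u] k by (intro mult_left_mono) (auto simp: a_def D_def)
      also have "\<dots> \<le> k^2 * a" using a0 by (simp add: left_diff_distrib)
      finally have "D + (k^2 - 1) * (radial_energy u - hardy_int u 0 / 4) \<le> D + k^2 * a" by simp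
      then show "dirichlet (twist k u) \<le> (D + k^2 * a) / k"
        using dirichlet_twist[OF u d3 \<delta> k0] k0 d by (simp add: D_def divide_right_mono)
    qed
    finally show ?thesis using k0 by (simp add: pos_divide_le_eq mult_ac)
  qed
  show ?thesis
  proof (cases "a = 0")
    case False
    then have a: "a > 0" and Dpos: "D > 0" using a0 aD by auto
    \<comment> \<open>This \<open>k\<close> balances \<open>D\<close> and \<open>k^2 * a\<close>; it
      is at least 1 because \<open>a \<le> D\<close>. Then \<open>(2 * D / k) ^ 3\<close> supplies
      the factor 8 in \<open>128 = 8 * 16\<close>.\<close>
    define k where "k = sqrt (D / a)"
    have k2: "k^2 = D / a" using a D0 by (simp add: k_def)
    have k: "k \<ge> 1" using a aD by (simp add: k_def)
    have "D + k^2 * a = 2 * D" using a by (simp add: k2)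
    then have "X \<le> K * k * (2 * D / k) ^ 3" using main[OF k] by simp
    also have "\<dots> = 8 * K * D ^ 3 / k^2" using k by (simp add: power2_eq_square power3_eq_cube)
    also have "\<dots> = 8 * K * D^2 * a" unfolding k2 using a Dpos by (simp add: power2_eq_square power3_eq_cube)
    finally show ?thesis by (simp add: X_def K_def D_def a_def)
  next
    case True
    \<comment> \<open>Without deficit the bound is \<open>K * D ^ 3 / k^2\<close>, and letting
      \<open>k\<close> tend to infinity forces \<open>X \<le> 0\<close>.\<close>
    have "(\<lambda>n. K * D ^ 3 / (real (Suc n))^2) \<longlonglongrightarrow> 0"
      using tendsto_mult[OF tendsto_const[of "K * D ^ 3"] tendsto_power[OF LIMSEQ_inverse_real_of_nat, of 2]]
      by (simp add: divide_inverse power_inverse)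
    moreover have "X \<le> K * D ^ 3 / (real (Suc n))^2" for n
      using main[of "real (Suc n)"] True by (simp add: power2_eq_square power3_eq_cube)
    ultimately have "X \<le> 0" by (intro LIMSEQ_le_const) auto
    moreover have "dirichlet u - hardy_int u 0 / 4 = 0" using True by (simp only: a_def D_def)
    ultimately show ?thesis by (simp only: X_def mult_zero_right)
  qed
qed

definition cutoff :: "real \<Rightarrow> 'a::real_normed_vector \<Rightarrow> real"
  where "cutoff l x = smoothstep ((norm x)^2 / l^2 - 1)"

lemma cutoff_bounds: "0 \<le> cutoff l x" "cutoff l x \<le> 1"
  using smoothstep_bounds by (auto simp: cutoff_def)

lemma cutoff_inside: "0 < l \<Longrightarrow> norm x \<le> l \<Longrightarrow> cutoff l x = 0"
  using power_mono[of "norm x" l 2] by (simp add: cutoff_def smoothstep_0)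

lemma cutoff_arg_ge_1:
  assumes "0 < l" "2 * l \<le> norm x" shows "(norm x)^2 / l^2 - 1 \<ge> 1"
proof -
  have "4 * l^2 \<le> (norm x)^2" using power_mono[OF assms(2), of 2] assms(1) by (simp add: power_mult_distrib)
  moreover have "l^2 > 0" using assms by simp
  ultimately have "2 * l^2 \<le> (norm x)^2" by linarith
  with \<open>l^2 > 0\<close> show ?thesis by (simp add: pos_le_divide_eq)
qed

text \<open>The gradient bound is independent of \<open>l\<close>: where the derivative is nonzero,
  \<open>norm x < 2 * l\<close>, so \<open>64 * (norm x)^2 / l ^ 4\<close> is at most
  \<open>64 * 16 / (norm x)^2\<close>. This uniformity makes the Hardy integrand a majorant in the
  next lemma.\<close>

lemma
  fixes x :: "real ^ 'n::finite"
  assumes l: "0 < l"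
  shows C1_cutoff: "C1 (cutoff l :: real ^ 'n \<Rightarrow> real)"
    and gradient_cutoff_le: "(\<Sum>i\<in>UNIV. (partial_deriv i (cutoff l) x)^2) \<le> 1024 / (norm x)^2"
    and partial_cutoff_outside: "2 * l \<le> norm x \<Longrightarrow> partial_deriv i (cutoff l) x = 0"
proof -
  define F where "F s = smoothstep (s / l^2 - 1)" for s
  define F' where "F' s = smoothstep_deriv (s / l^2 - 1) * (1 / l^2)" for s
  have F: "(F has_real_derivative F' s) (at s)" for s
    unfolding F_def F'_def
    using DERIV_diff[OF DERIV_cdivide[OF DERIV_ident] DERIV_const, of "l^2" 1 s]
    by (intro DERIV_chain2[OF smoothstep_has_derivative]) simp
  have eq: "cutoff l = (\<lambda>x::real^'n. F ((norm (x - 0))^2))" by (rule ext) (simp add: cutoff_def F_def)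
  have cF': "continuous_on UNIV F'"
    unfolding F'_def by (intro continuous_intros continuous_on_compose2[OF continuous_smoothstep_deriv]) (use l in auto)
  show "C1 (cutoff l :: real ^ 'n \<Rightarrow> real)"
    unfolding eq by (rule C1_compose[OF F continuous_on_compose2[OF cF' C1_continuous[OF C1_dist_sq] subset_UNIV] C1_dist_sq])
  have p: "partial_deriv i (cutoff l) x = F' ((norm x)^2) * (2 * x $ i)" for i and x :: "real^'n"
    unfolding eq partial_compose[OF F differentiable_dist_sq] partial_dist_sq by simp
  show out: "partial_deriv i (cutoff l) x = 0" if "2 * l \<le> norm x" for i
    using smoothstep_1(2)[OF cutoff_arg_ge_1[OF l that]] by (simp add: p F'_def)
  show "(\<Sum>i\<in>UNIV. (partial_deriv i (cutoff l) x)^2) \<le> 1024 / (norm x)^2"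
  proof (cases "2 * l \<le> norm x")
    case True
    then show ?thesis using out by simp
  next
    case False
    show ?thesis
    proof (cases "x = 0")
      case True
      then show ?thesis by (simp add: p)
    next
      case x: False
      have "(\<Sum>i\<in>UNIV. (partial_deriv i (cutoff l) x)^2) = 4 * (F' ((norm x)^2))^2 * (norm x)^2"
        unfolding p sum_coord_sq[symmetric] sum_distrib_left
        by (intro sum.cong refl) (simp add: power_mult_distrib mult_ac)
      also have "\<dots> \<le> 4 * (4 / l^2)^2 * (norm x)^2"
        using smoothstep_deriv_bounds[of "(norm x)^2 / l^2 - 1"] l
        by (intro mult_right_mono mult_left_mono power_mono) (auto simp: F'_def divide_right_mono)
      also have "\<dots> \<le> 1024 / (norm x)^2"
      proof -
        have "(norm x) ^ 4 \<le> (2 * l) ^ 4" using False by (intro power_mono) auto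
        then have "64 * (norm x) ^ 4 \<le> 1024 * l ^ 4" by (simp add: power_mult_distrib)
        then show ?thesis using x l by (simp add: field_simps power2_eq_square eval_nat_numeral)
      qed
      finally show ?thesis .
    qed
  qed
qed

text \<open>A point has zero capacity in dimension at least three. Concretely, \<open>|u|^2\<close>
  times the squared gradient of the cutoff is dominated by 1024 times the Hardy integrand, while at
  each point other than the origin the cutoff is eventually 1 with vanishing gradient.\<close>

lemma cutoff_approximation:
  fixes u :: "real ^ 'n::finite \<Rightarrow> 'v::euclidean_space"
  assumes u: "C1c u" and d: "3 \<le> CARD('n)"
  defines "v \<equiv> \<lambda>n x. cutoff (1 / real (Suc n)) x *\<^sub>R u x"
  shows "\<And>n. C1c (v n)" "\<And>n x. norm x < 1 / real (Suc n) \<Longrightarrow> v n x = 0"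
    and "(\<lambda>n. dirichlet (v n)) \<longlonglongrightarrow> dirichlet u" "(\<lambda>n. hardy_int (v n) 0) \<longlonglongrightarrow> hardy_int u 0"
    and "(\<lambda>n. LINT x|lborel. (norm (v n x)) ^ 6) \<longlonglongrightarrow> (LINT x|lborel. (norm (u x)) ^ 6)"
proof -
  define l where "l n = 1 / real (Suc n)" for n
  have l: "l n > 0" for n by (simp add: l_def)
  have v: "v n = (\<lambda>x. cutoff (l n) x *\<^sub>R u x)" for n by (simp add: v_def l_def)
  note C = C1c_C1[OF u]
  obtain R where R: "\<And>x. R < norm x \<Longrightarrow> u x = 0" using C1c_support[OF u] by metis
  show Cv: "C1c (v n)" for n
    unfolding v by (rule C1cI[OF C1_scaleR[OF C1_cutoff[OF l] C], of R]) (simp add: R)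
  show "v n x = 0" if "norm x < 1 / real (Suc n)" for n x
    using that cutoff_inside[OF l, of x n] by (simp add: v l_def)
  note [measurable] = C1_borel[OF C] C1_gradient_borel[OF C] C1_borel[OF C1c_C1[OF Cv]] C1_gradient_borel[OF C1c_C1[OF Cv]]
  have hi: "integrable lborel (\<lambda>x. (norm (u x))^2 / (norm x)^2)" using hardy[OF u d, of 0] by simp
  have ev: "\<forall>\<^sub>F n in sequentially. 2 * l n \<le> norm x" if "x \<noteq> 0" for x :: "real^'n"
  proof -
    have "(\<lambda>n. 2 * l n) \<longlonglongrightarrow> 2 * 0"
      unfolding l_def using LIMSEQ_inverse_real_of_nat by (intro tendsto_intros) (simp add: inverse_eq_divide)
    then have "\<forall>\<^sub>F n in sequentially. 2 * l n < norm x"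
      by (rule order_tendstoD) (use that in simp)
    then show ?thesis by eventually_elim simp
  qed
  have ev1: "v n x = u x" if "2 * l n \<le> norm x" for n x
    using smoothstep_1(1)[OF cutoff_arg_ge_1[OF l that]] by (simp add: v cutoff_def)
  have pv: "partial_deriv i (v n) x = cutoff (l n) x *\<^sub>R partial_deriv i u x + partial_deriv i (cutoff (l n)) x *\<^sub>R u x" for i n x
    unfolding v by (rule partial_scaleR) (intro C1_differentiable C1_cutoff l C)+
  have ev2: "gradient (v n) x = gradient u x" if "2 * l n \<le> norm x" for n x
    using partial_cutoff_outside[OF l that] smoothstep_1(1)[OF cutoff_arg_ge_1[OF l that]]
    by (simp add: gradient_def pv cutoff_def)
  have nv: "norm (v n x) \<le> norm (u x)" for n x
    using cutoff_bounds[of "l n" x] by (simp add: v mult_left_le_one_le)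
  have lim: "(\<lambda>n. f n x) \<longlonglongrightarrow> g x" if "x \<noteq> 0" "\<And>n. 2 * l n \<le> norm x \<Longrightarrow> f n x = g x" for f :: "nat \<Rightarrow> real^'n \<Rightarrow> real" and g x
    by (rule tendsto_eventually) (use ev[OF that(1)] in \<open>eventually_elim, use that(2) in auto\<close>)
  show "(\<lambda>n. dirichlet (v n)) \<longlonglongrightarrow> dirichlet u"
    unfolding dirichlet_def
  proof (rule integral_dominated_convergence[where w = "\<lambda>x. 2 * (norm (gradient u x))^2 + 2048 * ((norm (u x))^2 / (norm x)^2)"])
    show "integrable lborel (\<lambda>x. 2 * (norm (gradient u x))^2 + 2048 * ((norm (u x))^2 / (norm x)^2))"
      by (intro Bochner_Integration.integrable_add integrable_mult_right dirichlet_integrable u hi)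
    show "AE x in lborel. (\<lambda>n. (norm (gradient (v n) x))^2) \<longlonglongrightarrow> (norm (gradient u x))^2"
      using AE_lborel_singleton[of 0] by eventually_elim (rule lim, simp_all add: ev2)
    show "AE x in lborel. norm ((norm (gradient (v n) x))^2) \<le> 2 * (norm (gradient u x))^2 + 2048 * ((norm (u x))^2 / (norm x)^2)" for n
    proof (rule AE_I2)
      fix x :: "real^'n"
      have "(norm (partial_deriv i (v n) x))^2 \<le> 2 * (norm (partial_deriv i u x))^2 + 2 * (norm (u x))^2 * (partial_deriv i (cutoff (l n)) x)^2" for i
      proof -
        have "norm (partial_deriv i (v n) x) \<le> norm (partial_deriv i u x) + \<bar>partial_deriv i (cutoff (l n)) x\<bar> * norm (u x)"
          unfolding pv using cutoff_bounds[of "l n" x]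
          by (intro order_trans[OF norm_triangle_ineq] add_mono) (auto simp: mult_left_le_one_le)
        then have "(norm (partial_deriv i (v n) x))^2 \<le> (norm (partial_deriv i u x) + \<bar>partial_deriv i (cutoff (l n)) x\<bar> * norm (u x))^2"
          by (intro power_mono) auto
        also have "\<dots> \<le> 2 * (norm (partial_deriv i u x))^2 + 2 * (\<bar>partial_deriv i (cutoff (l n)) x\<bar> * norm (u x))^2"
          using sum_squares_bound[of "norm (partial_deriv i u x)" "\<bar>partial_deriv i (cutoff (l n)) x\<bar> * norm (u x)"]
          unfolding power2_sum by linarith
        finally show ?thesis by (simp add: power_mult_distrib mult_ac)
      qed
      then have "(norm (gradient (v n) x))^2 \<le> (\<Sum>i\<in>UNIV. 2 * (norm (partial_deriv i u x))^2 + 2 * (norm (u x))^2 * (partial_deriv i (cutoff (l n)) x)^2)"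
        unfolding gradient_norm_sq by (intro sum_mono)
      also have "\<dots> = 2 * (norm (gradient u x))^2 + 2 * (norm (u x))^2 * (\<Sum>i\<in>UNIV. (partial_deriv i (cutoff (l n)) x)^2)"
        unfolding gradient_norm_sq by (simp add: sum.distrib sum_distrib_left)
      also have "\<dots> \<le> 2 * (norm (gradient u x))^2 + 2 * (norm (u x))^2 * (1024 / (norm x)^2)"
        by (intro add_left_mono mult_left_mono gradient_cutoff_le l) auto
      finally show "norm ((norm (gradient (v n) x))^2) \<le> 2 * (norm (gradient u x))^2 + 2048 * ((norm (u x))^2 / (norm x)^2)"
        by simp
    qed
  qed measurable
  show "(\<lambda>n. hardy_int (v n) 0) \<longlonglongrightarrow> hardy_int u 0"
    unfolding hardy_int_def diff_zero
  proof (rule integral_dominated_convergence[OF _ _ hi])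
    show "AE x in lborel. (\<lambda>n. (norm (v n x))^2 / (norm x)^2) \<longlonglongrightarrow> (norm (u x))^2 / (norm x)^2"
      using AE_lborel_singleton[of 0] by eventually_elim (rule lim, simp_all add: ev1)
    show "AE x in lborel. norm ((norm (v n x))^2 / (norm x)^2) \<le> (norm (u x))^2 / (norm x)^2" for n
      using nv by (intro AE_I2) (auto intro!: divide_right_mono power_mono)
  qed measurable
  show "(\<lambda>n. LINT x|lborel. (norm (v n x)) ^ 6) \<longlonglongrightarrow> (LINT x|lborel. (norm (u x)) ^ 6)"
  proof (rule integral_dominated_convergence[OF _ _ C1c_power_integrable[OF u, of 6]])
    show "AE x in lborel. (\<lambda>n. (norm (v n x)) ^ 6) \<longlonglongrightarrow> (norm (u x)) ^ 6"
      using AE_lborel_singleton[of 0] by eventually_elim (rule lim, simp_all add: ev1)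
    show "AE x in lborel. norm ((norm (v n x)) ^ 6) \<le> (norm (u x)) ^ 6" for n
      using nv by (intro AE_I2) (auto intro!: power_mono)
  qed (simp, measurable)
qed

lemma sobolev_hardy_deficit_0:
  fixes u :: "real ^ 'n::finite \<Rightarrow> 'v::euclidean_space"
  assumes u: "C1c u" and d: "CARD('n) = 3"
  shows "(LINT x|lborel. (norm (u x)) ^ 6) \<le> 128 * improved_sobolev_const * (dirichlet u)^2 * (dirichlet u - hardy_int u 0 / 4)"
proof -
  have d3: "3 \<le> CARD('n)" using d by simp
  note a = cutoff_approximation[OF u d3]
  show ?thesis
  proof (rule LIMSEQ_le[OF a(5)])
    show "(\<lambda>n. 128 * improved_sobolev_const * (dirichlet (\<lambda>x. cutoff (1 / real (Suc n)) x *\<^sub>R u x))^2 *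
         (dirichlet (\<lambda>x. cutoff (1 / real (Suc n)) x *\<^sub>R u x) - hardy_int (\<lambda>x. cutoff (1 / real (Suc n)) x *\<^sub>R u x) 0 / 4))
      \<longlonglongrightarrow> 128 * improved_sobolev_const * (dirichlet u)^2 * (dirichlet u - hardy_int u 0 / 4)"
      by (intro tendsto_intros a(3,4)) simp
    show "\<exists>N. \<forall>n\<ge>N. (LINT x|lborel. (norm (cutoff (1 / real (Suc n)) x *\<^sub>R u x)) ^ 6) \<le>
      128 * improved_sobolev_const * (dirichlet (\<lambda>x. cutoff (1 / real (Suc n)) x *\<^sub>R u x))^2 *
         (dirichlet (\<lambda>x. cutoff (1 / real (Suc n)) x *\<^sub>R u x) - hardy_int (\<lambda>x. cutoff (1 / real (Suc n)) x *\<^sub>R u x) 0 / 4)"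
      by (intro exI allI impI sobolev_hardy_deficit_away[OF a(1) d] a(2)) auto
  qed
qed

lemma integral_translate:
  fixes f :: "'a::euclidean_space \<Rightarrow> 'b::{banach, second_countable_topology}"
  assumes "f \<in> borel_measurable borel"
  shows "(LINT x|lborel. f (x + a)) = (LINT x|lborel. f x)"
proof -
  have "(LINT x|lborel. f x) = (LINT x|distr lborel borel ((+) a). f x)"
    by (simp add: lborel_distr_plus)
  also have "\<dots> = (LINT x|lborel. f (a + x))"
    using assms by (subst integral_distr) auto
  finally show ?thesis by (simp add: add.commute)
qed

lemma
  fixes u :: "real ^ 'n::finite \<Rightarrow> 'v::euclidean_space"
  assumes u: "C1c u"
  shows C1c_translate: "C1c (\<lambda>x. u (x + y))"
    and dirichlet_translate: "dirichlet (\<lambda>x. u (x + y)) = dirichlet u"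
    and hardy_int_translate: "hardy_int (\<lambda>x. u (x + y)) z = hardy_int u (z + y)"
proof -
  note C = C1c_C1[OF u]
  note [measurable] = C1_borel[OF C] C1_gradient_borel[OF C]
  obtain R where R: "\<And>x. R < norm x \<Longrightarrow> u x = 0" using C1c_support[OF u] by metis
  show "C1c (\<lambda>x. u (x + y))"
  proof (rule C1cI[OF C1_translate[OF C]])
    fix x :: "real^'n" assume "R + norm y < norm x"
    then have "R < norm (x + y)" using norm_triangle_ineq4[of "x + y" y] by simp
    then show "u (x + y) = 0" by (rule R)
  qed
  have "gradient (\<lambda>x. u (x + y)) x = gradient u (x + y)" for x :: "real^'n"
    by (simp add: gradient_def partial_translate[OF C1_differentiable[OF C]])
  then show "dirichlet (\<lambda>x. u (x + y)) = dirichlet u"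
    unfolding dirichlet_def using integral_translate[of "\<lambda>x. (norm (gradient u x))^2" y] by simp
  show "hardy_int (\<lambda>x. u (x + y)) z = hardy_int u (z + y)"
    unfolding hardy_int_def using integral_translate[of "\<lambda>x. (norm (u x))^2 / (norm (x - (z + y)))^2" y]
    by (simp add: algebra_simps)
qed

text \<open>\<open>H\<close> is any positive bound on the Hardy integrals rather than their
  supremum, so that \<open>u = 0\<close> is covered. In the first case
  \<open>D = a + h / 4 \<le> 2 * H\<close> and \<open>512 = 128 * 2^2\<close>; in the second the
  factor is 2; the constant 514 covers both.\<close>

theorem sobolev_hardy_deficit:
  fixes u :: "real ^ 'n::finite \<Rightarrow> 'v::euclidean_space"
  assumes u: "C1c u" and d: "CARD('n) = 3" and H: "H > 0" "\<And>y. hardy_int u y \<le> H"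
  shows "(LINT x|lborel. (norm (u x)) ^ 6) \<le> 514 * improved_sobolev_const * (dirichlet u - hardy_int u y / 4) * H^2"
proof -
  note [measurable] = C1_borel[OF C1c_C1[OF u]]
  define K where "K = improved_sobolev_const"
  have K: "K \<ge> 0" using improved_sobolev_const_nonneg by (simp add: K_def)
  define D where "D = dirichlet u"
  define h where "h = hardy_int u y"
  define a where "a = D - h / 4"
  have a0: "a \<ge> 0" using hardy[OF u, of y] d by (simp add: a_def D_def h_def)
  have D0: "D \<ge> 0" using dirichlet_nonneg[of u] by (simp add: D_def)
  have hH: "h \<le> H" using H by (simp add: h_def)
  have Da: "D = a + h / 4" by (simp add: a_def)
  have p: "0 \<le> K * a * H^2" using K a0 by simp
  have "(LINT x|lborel. (norm (u x)) ^ 6) \<le> 514 * (K * a * H^2)"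
  proof (cases "a \<le> H")
    case True
    have "(LINT x|lborel. (norm (u x)) ^ 6) = (LINT x|lborel. (norm (u (x + y))) ^ 6)"
      by (rule integral_translate[symmetric]) measurable
    also have "\<dots> \<le> 128 * K * D^2 * a"
      using sobolev_hardy_deficit_0[OF C1c_translate[OF u, of y] d]
      unfolding dirichlet_translate[OF u] hardy_int_translate[OF u] by (simp add: D_def h_def a_def K_def)
    also have "\<dots> \<le> 128 * K * (2 * H)^2 * a"
      using K a0 D0 Da True hH H by (intro mult_right_mono mult_left_mono power_mono) auto
    also have "\<dots> = 512 * (K * a * H^2)" by (simp add: power_mult_distrib)
    finally show ?thesis using p by linarith
  next
    case False
    have "(LINT x|lborel. (norm (u x)) ^ 6) \<le> K * D * H^2"
      unfolding K_def D_def by (rule improved_sobolev[OF u d H])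
    also have "\<dots> \<le> K * (2 * a) * H^2"
      using False hH Da K a0 by (intro mult_right_mono mult_left_mono) auto
    finally show ?thesis using p by linarith
  qed
  then show ?thesis by (simp add: K_def a_def D_def h_def)
qed

section \<open>Passage to the homogeneous Sobolev space\<close>

lemma improved_sobolev_const_pos: "0 < improved_sobolev_const"
proof -
  have "0 < unit_ball_vol 3" by (rule unit_ball_vol_pos) simp
  then have "unit_ball_vol 3 \<noteq> 0" by linarith
  then show ?thesis by (simp add: improved_sobolev_const_def)
qed

section \<open>Minkowski's inequality in L2\<close>

lemma weighted_sum_sq:
  assumes "e > (0::real)"
  shows "(a + b)^2 \<le> (1 + e) * a^2 + (1 + 1 / e) * b^2"
proof -
  have "0 \<le> (e * a - b)^2 / e" using assms by simp
  also have "(e * a - b)^2 / e = e * a^2 + b^2 / e - 2 * a * b"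
    using assms by (simp add: field_simps power2_eq_square)
  finally show ?thesis by (simp add: power2_sum algebra_simps)
qed

text \<open>The bound is smallest at \<open>e = sqrt c / sqrt b\<close>, where it equals
  \<open>(sqrt b + sqrt c)^2\<close>. Adding \<open>t > 0\<close> to both \<open>b\<close> and
  \<open>c\<close> keeps this quotient defined and positive; then \<open>t\<close> tends to
  0.\<close>

lemma sqrt_le_sqrt_add_sqrt:
  assumes b: "0 \<le> b" and c: "0 \<le> c" and le: "\<And>e. e > 0 \<Longrightarrow> a \<le> (1 + e) * b + (1 + 1 / e) * (c::real)"
  shows "sqrt a \<le> sqrt b + sqrt c"
proof -
  have step: "sqrt a \<le> sqrt (b + t) + sqrt (c + t)" if t: "t > 0" for t
  proof -
    define p q where "p = sqrt (b + t)" and "q = sqrt (c + t)"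
    have p: "p > 0" "p^2 = b + t" and q: "q > 0" "q^2 = c + t" using b c t by (auto simp: p_def q_def)
    have "a \<le> (1 + q / p) * b + (1 + 1 / (q / p)) * c" using p q by (intro le) simp
    also have "\<dots> \<le> (1 + q / p) * p^2 + (1 + 1 / (q / p)) * q^2"
      using p q t by (intro add_mono mult_left_mono) auto
    also have "\<dots> = (p + q)^2" using p(1) q(1) by (simp add: field_simps power2_eq_square)
    finally have "sqrt a \<le> sqrt ((p + q)^2)" by (rule real_sqrt_le_mono)
    then show ?thesis using p q by (simp add: p_def q_def)
  qed
  have "(\<lambda>n. sqrt (b + inverse (real (Suc n))) + sqrt (c + inverse (real (Suc n)))) \<longlonglongrightarrow> sqrt (b + 0) + sqrt (c + 0)"
    by (intro tendsto_intros LIMSEQ_inverse_real_of_nat)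
  then have "sqrt a \<le> sqrt (b + 0) + sqrt (c + 0)"
    by (rule LIMSEQ_le_const) (use step in auto)
  then show ?thesis by simp
qed

lemma integrable_sq_diff:
  fixes f g :: "'a \<Rightarrow> 'b::euclidean_space"
  assumes [measurable]: "f \<in> borel_measurable M" "g \<in> borel_measurable M"
    and "integrable M (\<lambda>x. (norm (f x))^2)" "integrable M (\<lambda>x. (norm (g x))^2)"
  shows "integrable M (\<lambda>x. (norm (f x - g x))^2)"
proof (rule integrable_dominated_nonneg)
  show "integrable M (\<lambda>x. 2 * (norm (f x))^2 + 2 * (norm (g x))^2)" using assms(3,4) by simp
  fix x
  have "(norm (f x - g x))^2 \<le> (norm (f x) + norm (g x))^2" by (intro power_mono norm_triangle_ineq4) simp
  also have "\<dots> \<le> 2 * (norm (f x))^2 + 2 * (norm (g x))^2" using weighted_sum_sq[of 1 "norm (f x)" "norm (g x)"] by simp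
  finally show "(norm (f x - g x))^2 \<le> 2 * (norm (f x))^2 + 2 * (norm (g x))^2" .
qed auto

lemma L2_triangle:
  fixes f g :: "'a \<Rightarrow> 'b::euclidean_space"
  assumes [measurable]: "f \<in> borel_measurable M" "g \<in> borel_measurable M"
    and f: "integrable M (\<lambda>x. (norm (f x))^2)" and g: "integrable M (\<lambda>x. (norm (g x))^2)"
  shows "sqrt (LINT x|M. (norm (f x))^2) \<le> sqrt (LINT x|M. (norm (g x))^2) + sqrt (LINT x|M. (norm (f x - g x))^2)"
proof (rule sqrt_le_sqrt_add_sqrt)
  fix e :: real assume e: "e > 0"
  note d = integrable_sq_diff[OF assms]
  have "(LINT x|M. (norm (f x))^2) \<le> (LINT x|M. (1 + e) * (norm (g x))^2 + (1 + 1 / e) * (norm (f x - g x))^2)"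
  proof (rule integral_mono[OF f])
    show "integrable M (\<lambda>x. (1 + e) * (norm (g x))^2 + (1 + 1 / e) * (norm (f x - g x))^2)" using d g by simp
    fix x
    have "(norm (f x))^2 \<le> (norm (g x) + norm (f x - g x))^2"
      using norm_triangle_ineq[of "g x" "f x - g x"] by (intro power_mono) auto
    also note weighted_sum_sq[OF e]
    finally show "(norm (f x))^2 \<le> (1 + e) * (norm (g x))^2 + (1 + 1 / e) * (norm (f x - g x))^2" .
  qed
  also have "\<dots> = (1 + e) * (LINT x|M. (norm (g x))^2) + (1 + 1 / e) * (LINT x|M. (norm (f x - g x))^2)"
    using d g by simp
  finally show "(LINT x|M. (norm (f x))^2) \<le> (1 + e) * (LINT x|M. (norm (g x))^2) + (1 + 1 / e) * (LINT x|M. (norm (f x - g x))^2)" .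
qed auto

lemma L2_triangle_abs:
  fixes f g :: "'a \<Rightarrow> 'b::euclidean_space"
  assumes "f \<in> borel_measurable M" "g \<in> borel_measurable M"
    and "integrable M (\<lambda>x. (norm (f x))^2)" "integrable M (\<lambda>x. (norm (g x))^2)"
  shows "\<bar>sqrt (LINT x|M. (norm (f x))^2) - sqrt (LINT x|M. (norm (g x))^2)\<bar> \<le> sqrt (LINT x|M. (norm (f x - g x))^2)"
  using L2_triangle[OF assms] L2_triangle[OF assms(2,1,4,3)] by (simp add: norm_minus_commute abs_le_iff)

lemma tendsto_sqrt_cancel:
  assumes "(\<lambda>n. sqrt (a n)) \<longlonglongrightarrow> sqrt b" "\<And>n. 0 \<le> a n" "0 \<le> b"
  shows "a \<longlonglongrightarrow> b"
  using tendsto_power[OF assms(1), of 2] assms(2,3) by simp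

lemma tendsto_abs_diff_le:
  fixes a :: "nat \<Rightarrow> real"
  assumes "\<And>n. \<bar>a n - b\<bar> \<le> e n" "e \<longlonglongrightarrow> 0"
  shows "a \<longlonglongrightarrow> b"
  by (rule LIM_zero_cancel, rule Lim_null_comparison[OF always_eventually assms(2)]) (simp add: assms(1))

lemma L2_norm_tendsto:
  fixes f :: "nat \<Rightarrow> 'a \<Rightarrow> 'b::euclidean_space"
  assumes "\<And>n. f n \<in> borel_measurable M" "g \<in> borel_measurable M"
    and "\<And>n. integrable M (\<lambda>x. (norm (f n x))^2)" "integrable M (\<lambda>x. (norm (g x))^2)"
    and lim: "(\<lambda>n. LINT x|M. (norm (f n x - g x))^2) \<longlonglongrightarrow> 0"
  shows "(\<lambda>n. LINT x|M. (norm (f n x))^2) \<longlonglongrightarrow> (LINT x|M. (norm (g x))^2)"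
proof (rule tendsto_sqrt_cancel)
  have "(\<lambda>n. sqrt (LINT x|M. (norm (f n x - g x))^2)) \<longlonglongrightarrow> 0" using tendsto_real_sqrt[OF lim] by simp
  then show "(\<lambda>n. sqrt (LINT x|M. (norm (f n x))^2)) \<longlonglongrightarrow> sqrt (LINT x|M. (norm (g x))^2)"
    by (rule tendsto_abs_diff_le[rotated]) (rule L2_triangle_abs[OF assms(1,2,3,4)])
qed auto

section \<open>Transfer to smooth functions and to the completed Lebesgue measure\<close>

lemma smooth_C1c:
  fixes f :: "real ^ 'n::finite \<Rightarrow> 'k::euclidean_space"
  assumes "f \<in> smooth_compact_support" shows "C1c f"
proof -
  have t: "\<forall>m. times_differentiable m f" and c: "compact (closure {x. f x \<noteq> 0})"
    using assms by (auto simp: smooth_compact_support_def)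
  have "times_differentiable (Suc 0) f" using t by blast
  then have "C1 f" by (simp add: C1_def)
  moreover have "bounded {x. f x \<noteq> 0}" using c by simp
  then obtain R where "\<And>x. f x \<noteq> 0 \<Longrightarrow> norm x \<le> R" unfolding bounded_iff by blast
  then have "f x = 0" if "R < norm x" for x using that by force
  ultimately show ?thesis by (rule C1cI)
qed

lemma lebesgue_measurable: "f \<in> borel_measurable borel \<Longrightarrow> f \<in> borel_measurable lebesgue"
  by (rule measurable_completion) simp

lemma lebesgue_integral: "f \<in> borel_measurable borel \<Longrightarrow> (LINT x|lebesgue. f x) = (LINT x|lborel. f x)"
  for f :: "'a::euclidean_space \<Rightarrow> 'b::{banach, second_countable_topology}"
  by (rule integral_completion) simp

lemma lebesgue_integrable: "f \<in> borel_measurable borel \<Longrightarrow> integrable lebesgue f \<longleftrightarrow> integrable lborel f"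
  for f :: "'a::euclidean_space \<Rightarrow> 'b::{banach, second_countable_topology}"
  by (rule integrable_completion) simp

lemma AE_lebesgue_not_eq: "AE x in lebesgue. x \<noteq> (y::'a::euclidean_space)"
  by (rule AE_completion[OF AE_lborel_singleton])

lemma C1c_diff: "C1c f \<Longrightarrow> C1c g \<Longrightarrow> C1c (\<lambda>x. f x - g x)"
proof -
  assume f: "C1c f" and g: "C1c g"
  obtain R S where "\<And>x. R < norm x \<Longrightarrow> f x = 0" "\<And>x. S < norm x \<Longrightarrow> g x = 0" using f g unfolding C1c_def by metis
  then show ?thesis by (intro C1cI[OF C1_diff[OF f[THEN C1c_C1] g[THEN C1c_C1]], of "max R S"]) auto
qed

lemma gradient_diff: "C1 f \<Longrightarrow> C1 g \<Longrightarrow> gradient (\<lambda>x. f x - g x) x = gradient f x - gradient g x"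
  by (simp add: gradient_def vec_eq_iff partial_diff C1_differentiable)

lemma
  fixes u :: "real ^ 'n::finite \<Rightarrow> 'v::euclidean_space"
  assumes u: "C1c u"
  shows dirichlet_lebesgue: "dirichlet u = (LINT x|lebesgue. (norm (gradient u x))^2)"
    and dirichlet_lebesgue_integrable: "integrable lebesgue (\<lambda>x. (norm (gradient u x))^2)"
    and hardy_int_lebesgue: "hardy_int u y = (LINT x|lebesgue. (norm (u x))^2 / (norm (x - y))^2)"
    and hardy_int_lebesgue_integrable: "3 \<le> CARD('n) \<Longrightarrow> integrable lebesgue (\<lambda>x. (norm (u x))^2 / (norm (x - y))^2)"
proof -
  note [measurable] = C1_borel[OF C1c_C1[OF u]] C1_gradient_borel[OF C1c_C1[OF u]]
  have 1: "(\<lambda>x. (norm (gradient u x))^2) \<in> borel_measurable borel"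
    and 2: "(\<lambda>x. (norm (u x))^2 / (norm (x - y))^2) \<in> borel_measurable borel" by measurable
  show "dirichlet u = (LINT x|lebesgue. (norm (gradient u x))^2)"
    "hardy_int u y = (LINT x|lebesgue. (norm (u x))^2 / (norm (x - y))^2)"
    unfolding dirichlet_def hardy_int_def by (rule lebesgue_integral[symmetric, OF 1], rule lebesgue_integral[symmetric, OF 2])
  show "integrable lebesgue (\<lambda>x. (norm (gradient u x))^2)"
    unfolding lebesgue_integrable[OF 1] by (rule dirichlet_integrable[OF u])
  show "integrable lebesgue (\<lambda>x. (norm (u x))^2 / (norm (x - y))^2)" if "3 \<le> CARD('n)"
    unfolding lebesgue_integrable[OF 2] using hardy[OF u that] by blast
qed

lemma hardy_const_pos: "3 \<le> CARD('n) \<Longrightarrow> 0 < (real CARD('n::finite) - 2)^2 / 4"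
  by simp

lemma hardy_int_le: "C1c u \<Longrightarrow> 3 \<le> CARD('n) \<Longrightarrow> hardy_int u y \<le> dirichlet u / ((real CARD('n) - 2)^2 / 4)"
  for u :: "real ^ 'n::finite \<Rightarrow> 'v::euclidean_space"
  using hardy[of u y] hardy_const_pos[where 'n = 'n] by (subst pos_le_divide_eq) (auto simp: mult.commute)

lemma hardy_sup_eq: "C1c u \<Longrightarrow> hardy_sup u = (SUP y. hardy_int u y)"
  for u :: "real ^ 'n::finite \<Rightarrow> 'v::{real_normed_field,euclidean_space}"
  unfolding hardy_sup_def hardy_int_lebesgue ..

lemma hardy_int_le_sup: "C1c u \<Longrightarrow> 3 \<le> CARD('n) \<Longrightarrow> hardy_int u y \<le> hardy_sup u"
  for u :: "real ^ 'n::finite \<Rightarrow> 'v::{real_normed_field,euclidean_space}"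
  unfolding hardy_sup_eq using hardy_int_le by (intro cSUP_upper bdd_aboveI2) auto

lemma hardy_sup_le: "C1c u \<Longrightarrow> 3 \<le> CARD('n) \<Longrightarrow> (\<And>y. hardy_int u y \<le> b) \<Longrightarrow> hardy_sup u \<le> b"
  for u :: "real ^ 'n::finite \<Rightarrow> 'v::{real_normed_field,euclidean_space}"
  unfolding hardy_sup_eq by (intro cSUP_least) auto

lemma powr_diff_integrable:
  fixes f g :: "'a \<Rightarrow> 'b::euclidean_space"
  assumes [measurable]: "f \<in> borel_measurable M" "g \<in> borel_measurable M" and p: "p > 0"
    and "integrable M (\<lambda>x. norm (f x) powr p)" "integrable M (\<lambda>x. norm (g x) powr p)"
  shows "integrable M (\<lambda>x. norm (f x - g x) powr p)"
proof (rule integrable_dominated_nonneg)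
  show "integrable M (\<lambda>x. 2 powr p * (norm (f x) powr p + norm (g x) powr p))" using assms(4,5) by simp
  fix x
  have "norm (f x - g x) powr p \<le> (2 * max (norm (f x)) (norm (g x))) powr p"
    using p norm_triangle_ineq4[of "f x" "g x"] by (intro powr_mono2) auto
  also have "\<dots> \<le> 2 powr p * (norm (f x) powr p + norm (g x) powr p)"
    by (subst powr_mult) (auto simp: max_def)
  finally show "norm (f x - g x) powr p \<le> 2 powr p * (norm (f x) powr p + norm (g x) powr p)" .
qed auto

lemma C1c_powr_integrable:
  fixes u :: "real ^ 'n::finite \<Rightarrow> 'v::euclidean_space"
  assumes "C1c u" "0 < p"
  shows "integrable lborel (\<lambda>x. norm (u x) powr p)"
proof -
  obtain R where R: "\<And>x. R < norm x \<Longrightarrow> u x = 0" using C1c_support[OF assms(1)] by metis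
  show ?thesis
  proof (rule continuous_support_integrable[where R = R])
    show "continuous_on UNIV (\<lambda>x. norm (u x) powr p)"
      using assms(2) by (intro continuous_on_powr' continuous_intros C1_continuous[OF C1c_C1[OF assms(1)]]) auto
  qed (use R in simp)
qed

lemma Lp_norm_tendsto_0:
  assumes p: "p > 0" and "(\<lambda>n. Lp_norm p (f n)) \<longlonglongrightarrow> 0"
  shows "(\<lambda>n. LINT x|lebesgue. norm (f n x) powr p) \<longlonglongrightarrow> 0"
proof -
  have "(\<lambda>n. Lp_norm p (f n) powr p) \<longlonglongrightarrow> 0"
    using assms by (intro tendsto_zero_powrI[OF assms(2) tendsto_const]) (auto simp: Lp_norm_def)
  also have "(\<lambda>n. Lp_norm p (f n) powr p) = (\<lambda>n. LINT x|lebesgue. norm (f n x) powr p)"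
    using p by (simp add: Lp_norm_def powr_powr)
  finally show ?thesis .
qed

lemma Lp_space_2: "f \<in> Lp_space 2 \<longleftrightarrow> f \<in> borel_measurable lebesgue \<and> integrable lebesgue (\<lambda>x. (norm (f x))^2)"
  by (simp add: Lp_space_def)

section \<open>Limits along an approximating sequence\<close>

context
  fixes u :: "real ^ 'n::finite \<Rightarrow> 'k::{real_normed_field,euclidean_space}" and g :: "real ^ 'n \<Rightarrow> 'k ^ 'n"
    and \<phi> :: "nat \<Rightarrow> real ^ 'n \<Rightarrow> 'k"
  assumes d: "3 \<le> CARD('n)"
    and u: "u \<in> Lp_space (sobolev_exponent TYPE('n))" and g: "g \<in> Lp_space 2"
    and \<phi>: "\<And>m. \<phi> m \<in> smooth_compact_support"
    and lim_u: "(\<lambda>m. Lp_norm (sobolev_exponent TYPE('n)) (\<lambda>x. \<phi> m x - u x)) \<longlonglongrightarrow> 0"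
    and lim_g: "(\<lambda>m. Lp_norm 2 (\<lambda>x. gradient (\<phi> m) x - g x)) \<longlonglongrightarrow> 0"
begin

lemma exponent_gt_1: "1 < sobolev_exponent TYPE('n)"
  using d by (simp add: sobolev_exponent_def field_simps)

lemma approx_C1c: "C1c (\<phi> m)" using \<phi> by (rule smooth_C1c)

lemma approx_measurable:
  shows "\<phi> m \<in> borel_measurable lebesgue" "gradient (\<phi> m) \<in> borel_measurable lebesgue"
    "u \<in> borel_measurable lebesgue" "g \<in> borel_measurable lebesgue"
  using u g C1_borel[OF C1c_C1[OF approx_C1c]] C1_gradient_borel[OF C1c_C1[OF approx_C1c]]
  by (auto simp: Lp_space_def intro: lebesgue_measurable)

lemma gradient_error_tendsto_0: "(\<lambda>m. LINT x|lebesgue. (norm (gradient (\<phi> m) x - g x))^2) \<longlonglongrightarrow> 0"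
  using Lp_norm_tendsto_0[OF _ lim_g] by simp

lemma limit_gradient_integrable: "integrable lebesgue (\<lambda>x. (norm (g x))^2)"
  using g by (simp add: Lp_space_2)

lemma gradient_error_integrable: "integrable lebesgue (\<lambda>x. (norm (gradient (\<phi> m) x - g x))^2)"
  by (intro integrable_sq_diff approx_measurable dirichlet_lebesgue_integrable approx_C1c limit_gradient_integrable)

lemma approx_powr_integrable: "integrable lebesgue (\<lambda>x. norm (\<phi> m x - u x) powr sobolev_exponent TYPE('n))"
proof (rule powr_diff_integrable)
  show "integrable lebesgue (\<lambda>x. norm (\<phi> m x) powr sobolev_exponent TYPE('n))"
    using C1c_powr_integrable[OF approx_C1c, of "sobolev_exponent TYPE('n)" m] exponent_gt_1 C1_borel[OF C1c_C1[OF approx_C1c]]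
    by (subst lebesgue_integrable) auto
qed (use u exponent_gt_1 in \<open>auto simp: Lp_space_def intro: approx_measurable\<close>)

lemma AE_subsequence:
  obtains r where "strict_mono r" "AE x in lebesgue. (\<lambda>n. \<phi> (r n) x) \<longlonglongrightarrow> u x"
proof -
  let ?p = "sobolev_exponent TYPE('n)"
  have "(\<lambda>n. LINT x|lebesgue. norm (norm (\<phi> n x - u x) powr ?p)) \<longlonglongrightarrow> 0"
    using Lp_norm_tendsto_0[OF _ lim_u] exponent_gt_1 by simp
  from tendsto_L1_AE_subseq[OF approx_powr_integrable this]
  obtain r where r: "strict_mono r" "AE x in lebesgue. (\<lambda>n. norm (\<phi> (r n) x - u x) powr ?p) \<longlonglongrightarrow> 0" by blast
  from r(2) have "AE x in lebesgue. (\<lambda>n. \<phi> (r n) x) \<longlonglongrightarrow> u x"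
  proof eventually_elim
    case (elim x)
    have "(\<lambda>n. (norm (\<phi> (r n) x - u x) powr ?p) powr (1 / ?p)) \<longlonglongrightarrow> 0"
      using exponent_gt_1 by (intro tendsto_zero_powrI[OF elim tendsto_const]) auto
    then have "(\<lambda>n. norm (\<phi> (r n) x - u x)) \<longlonglongrightarrow> 0"
      using exponent_gt_1 by (simp add: powr_powr)
    then show ?case by (rule LIM_zero_cancel[OF tendsto_norm_zero_cancel])
  qed
  with r(1) that show ?thesis by blast
qed

lemma dirichlet_tendsto: "(\<lambda>m. dirichlet (\<phi> m)) \<longlonglongrightarrow> (LINT x|lebesgue. (norm (g x))^2)"
  unfolding dirichlet_lebesgue[OF approx_C1c]
  by (intro L2_norm_tendsto approx_measurable dirichlet_lebesgue_integrable approx_C1c limit_gradient_integrable gradient_error_tendsto_0)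

text \<open>The limit \<open>u\<close> need not be differentiable, so Hardy's inequality is applied
  to \<open>\<phi> m - \<phi> n\<close>, and \<open>n\<close> tends to infinity along an almost
  everywhere convergent subsequence. Fatou's lemma yields integrability as well, and the bound does
  not depend on \<open>y\<close>.\<close>

lemma hardy_difference:
  "integrable lebesgue (\<lambda>x. (norm (\<phi> m x - u x))^2 / (norm (x - y))^2) \<and>
   (LINT x|lebesgue. (norm (\<phi> m x - u x))^2 / (norm (x - y))^2) \<le> (LINT x|lebesgue. (norm (gradient (\<phi> m) x - g x))^2) / ((real CARD('n) - 2)^2 / 4)"
proof -
  obtain r where r: "strict_mono r" "AE x in lebesgue. (\<lambda>n. \<phi> (r n) x) \<longlonglongrightarrow> u x" by (rule AE_subsequence)
  note [measurable] = approx_measurable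
  let ?c = "(real CARD('n) - 2)^2 / 4"
  have c: "?c > 0" by (rule hardy_const_pos[OF d])
  note Cd = C1c_diff[OF approx_C1c approx_C1c]
  have "(\<lambda>n. LINT x|lebesgue. (norm ((gradient (\<phi> m) x - gradient (\<phi> n) x) - (gradient (\<phi> m) x - g x)))^2) \<longlonglongrightarrow> 0"
    using gradient_error_tendsto_0 by (simp add: norm_minus_commute)
  then have "(\<lambda>n. LINT x|lebesgue. (norm (gradient (\<phi> m) x - gradient (\<phi> n) x))^2) \<longlonglongrightarrow> (LINT x|lebesgue. (norm (gradient (\<phi> m) x - g x))^2)"
    by (intro L2_norm_tendsto gradient_error_integrable integrable_sq_diff approx_measurable dirichlet_lebesgue_integrable approx_C1c
        borel_measurable_diff) auto
  then have "(\<lambda>n. dirichlet (\<lambda>x. \<phi> m x - \<phi> n x)) \<longlonglongrightarrow> (LINT x|lebesgue. (norm (gradient (\<phi> m) x - g x))^2)"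
    by (simp add: dirichlet_lebesgue[OF Cd] gradient_diff[OF C1c_C1[OF approx_C1c] C1c_C1[OF approx_C1c]])
  from LIMSEQ_subseq_LIMSEQ[OF this r(1)]
  have B: "(\<lambda>n. dirichlet (\<lambda>x. \<phi> m x - \<phi> (r n) x) / ?c) \<longlonglongrightarrow> (LINT x|lebesgue. (norm (gradient (\<phi> m) x - g x))^2) / ?c"
    using c by (intro tendsto_divide tendsto_const) (auto simp: o_def)
  show ?thesis
  proof (rule fatou_real[OF _ _ _ B])
    show "integrable lebesgue (\<lambda>x. (norm (\<phi> m x - \<phi> (r n) x))^2 / (norm (x - y))^2)" for n
      by (rule hardy_int_lebesgue_integrable[OF Cd d])
    show "(LINT x|lebesgue. (norm (\<phi> m x - \<phi> (r n) x))^2 / (norm (x - y))^2) \<le> dirichlet (\<lambda>x. \<phi> m x - \<phi> (r n) x) / ?c" for n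
      using hardy_int_le[OF Cd d] by (simp add: hardy_int_lebesgue[OF Cd])
    show "AE x in lebesgue. (\<lambda>n. (norm (\<phi> m x - \<phi> (r n) x))^2 / (norm (x - y))^2) \<longlonglongrightarrow> (norm (\<phi> m x - u x))^2 / (norm (x - y))^2"
      using r(2) AE_lebesgue_not_eq[of y] by eventually_elim (intro tendsto_intros, auto)
    show "(\<lambda>x. (norm (\<phi> m x - u x))^2 / (norm (x - y))^2) \<in> borel_measurable lebesgue"
    proof (intro borel_measurable_divide)
      show "(\<lambda>x. (norm (\<phi> m x - u x))^2) \<in> borel_measurable lebesgue" by measurable
      show "(\<lambda>x::real^'n. (norm (x - y))^2) \<in> borel_measurable lebesgue" by (rule lebesgue_measurable) measurable
    qed
  qed auto
qed

lemma hardy_weight_measurable: "(\<lambda>x::real^'n. 1 / norm (x - y)) \<in> borel_measurable lebesgue"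
  by (rule lebesgue_measurable) measurable

text \<open>The triangle inequality in \<open>L^2\<close> with weight \<open>|x - y|^(-2)\<close>,
  the weight being absorbed into the functions \<open>a\<close> and \<open>b\<close>. The error is
  uniform in \<open>y\<close>, as the passage to the supremum requires.\<close>

lemma hardy_int_close:
  "\<bar>sqrt (hardy_int (\<phi> m) y) - sqrt (LINT x|lebesgue. (norm (u x))^2 / (norm (x - y))^2)\<bar>
   \<le> sqrt ((LINT x|lebesgue. (norm (gradient (\<phi> m) x - g x))^2) / ((real CARD('n) - 2)^2 / 4))"
proof -
  define a where "a x = (1 / norm (x - y)) *\<^sub>R \<phi> m x" for x
  define b where "b x = (1 / norm (x - y)) *\<^sub>R u x" for x
  have [measurable]: "a \<in> borel_measurable lebesgue" "b \<in> borel_measurable lebesgue"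
    unfolding a_def b_def by (intro borel_measurable_scaleR hardy_weight_measurable approx_measurable)+
  have na: "(norm (a x))^2 = (norm (\<phi> m x))^2 / (norm (x - y))^2" and nb: "(norm (b x))^2 = (norm (u x))^2 / (norm (x - y))^2"
    and nab: "(norm (a x - b x))^2 = (norm (\<phi> m x - u x))^2 / (norm (x - y))^2" for x
    by (simp_all add: a_def b_def power_divide flip: scaleR_diff_right)
  have ia: "integrable lebesgue (\<lambda>x. (norm (a x))^2)"
    unfolding na by (rule hardy_int_lebesgue_integrable[OF approx_C1c d])
  have iab: "integrable lebesgue (\<lambda>x. (norm (a x - b x))^2)"
    unfolding nab using hardy_difference by blast
  have "integrable lebesgue (\<lambda>x. (norm (a x - (a x - b x)))^2)"
    by (rule integrable_sq_diff[OF _ _ ia iab]) auto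
  then have ib: "integrable lebesgue (\<lambda>x. (norm (b x))^2)" by simp
  have "\<bar>sqrt (LINT x|lebesgue. (norm (a x))^2) - sqrt (LINT x|lebesgue. (norm (b x))^2)\<bar> \<le> sqrt (LINT x|lebesgue. (norm (a x - b x))^2)"
    by (rule L2_triangle_abs[OF _ _ ia ib]) auto
  also have "\<dots> \<le> sqrt ((LINT x|lebesgue. (norm (gradient (\<phi> m) x - g x))^2) / ((real CARD('n) - 2)^2 / 4))"
    unfolding nab using hardy_difference by (intro real_sqrt_le_mono) blast
  finally show ?thesis unfolding na nb hardy_int_lebesgue[OF approx_C1c] .
qed

lemma hardy_sup_tendsto: "(\<lambda>m. hardy_sup (\<phi> m)) \<longlonglongrightarrow> hardy_sup u"
  and hardy_sup_limit_nonneg: "0 \<le> hardy_sup u"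
proof -
  define e where "e m = sqrt ((LINT x|lebesgue. (norm (gradient (\<phi> m) x - g x))^2) / ((real CARD('n) - 2)^2 / 4))" for m
  have e0: "e m \<ge> 0" for m by (simp add: e_def)
  have e: "e \<longlonglongrightarrow> 0"
    using tendsto_real_sqrt[OF tendsto_divide[OF gradient_error_tendsto_0 tendsto_const[of "(real CARD('n) - 2)^2 / 4"]]] hardy_const_pos[OF d]
    by (simp add: e_def[abs_def])
  define h where "h y = (LINT x|lebesgue. (norm (u x))^2 / (norm (x - y))^2)" for y
  have h0: "h y \<ge> 0" for y by (simp add: h_def)
  have close: "sqrt (hardy_int (\<phi> m) y) \<le> sqrt (h y) + e m" "sqrt (h y) \<le> sqrt (hardy_int (\<phi> m) y) + e m" for m y
    using hardy_int_close[of m y] by (auto simp: h_def e_def abs_le_iff)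
  have up0: "0 \<le> hardy_sup (\<phi> m)" for m
    using hardy_int_le_sup[OF approx_C1c d, of m 0] hardy_int_nonneg[of "\<phi> m" 0] by linarith
  \<comment> \<open>A finite bound uniform in \<open>y\<close>: it shows that the range of
    \<open>h\<close> is bounded, so that the real-valued supremum is the true one.\<close>
  have hb: "h y \<le> (sqrt (hardy_sup (\<phi> m)) + e m)^2" for m y
  proof -
    have "sqrt (h y) \<le> sqrt (hardy_sup (\<phi> m)) + e m"
      using close(2)[of y m] real_sqrt_le_mono[OF hardy_int_le_sup[OF approx_C1c d, of m y]] by linarith
    then have "(sqrt (h y))^2 \<le> (sqrt (hardy_sup (\<phi> m)) + e m)^2" by (rule power_mono) (simp add: h0)
    then show ?thesis by (simp add: h0)
  qed
  have hs: "hardy_sup u = (SUP y. h y)" by (simp add: hardy_sup_def h_def)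
  have bdd: "bdd_above (range h)" using hb[of _ 0] by (intro bdd_aboveI2)
  have hu: "h y \<le> hardy_sup u" for y unfolding hs by (intro cSUP_upper bdd) auto
  show s0: "0 \<le> hardy_sup u" using hu[of 0] h0[of 0] by linarith
  have 1: "sqrt (hardy_sup u) \<le> sqrt (hardy_sup (\<phi> m)) + e m" for m
  proof -
    have "hardy_sup u \<le> (sqrt (hardy_sup (\<phi> m)) + e m)^2" unfolding hs by (intro cSUP_least hb) auto
    then have "sqrt (hardy_sup u) \<le> sqrt ((sqrt (hardy_sup (\<phi> m)) + e m)^2)" by (rule real_sqrt_le_mono)
    then show ?thesis using up0[of m] e0[of m] by simp
  qed
  have 2: "sqrt (hardy_sup (\<phi> m)) \<le> sqrt (hardy_sup u) + e m" for m
  proof -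
    have "hardy_int (\<phi> m) y \<le> (sqrt (hardy_sup u) + e m)^2" for y
    proof -
      have "sqrt (hardy_int (\<phi> m) y) \<le> sqrt (hardy_sup u) + e m"
        using close(1)[of m y] real_sqrt_le_mono[OF hu[of y]] by linarith
      then have "(sqrt (hardy_int (\<phi> m) y))^2 \<le> (sqrt (hardy_sup u) + e m)^2" by (rule power_mono) (simp add: hardy_int_nonneg)
      then show ?thesis by (simp add: hardy_int_nonneg)
    qed
    then have "hardy_sup (\<phi> m) \<le> (sqrt (hardy_sup u) + e m)^2" by (intro hardy_sup_le approx_C1c d)
    then have "sqrt (hardy_sup (\<phi> m)) \<le> sqrt ((sqrt (hardy_sup u) + e m)^2)" by (rule real_sqrt_le_mono)
    then show ?thesis using s0 e0[of m] by simp
  qed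
  have "\<bar>sqrt (hardy_sup (\<phi> m)) - sqrt (hardy_sup u)\<bar> \<le> e m" for m using 1[of m] 2[of m] by (simp add: abs_le_iff)
  then have "(\<lambda>m. sqrt (hardy_sup (\<phi> m))) \<longlonglongrightarrow> sqrt (hardy_sup u)"
    by (rule tendsto_abs_diff_le[OF _ e])
  then show "(\<lambda>m. hardy_sup (\<phi> m)) \<longlonglongrightarrow> hardy_sup u"
    by (rule tendsto_sqrt_cancel[OF _ up0 s0])
qed

lemma sobolev_hardy_deficit_limit:
  assumes d3: "CARD('n) = 3"
  defines "D \<equiv> LINT x|lebesgue. (norm (g x))^2"
  shows "(LINT x|lebesgue. norm (u x) ^ 6) \<le> 514 * improved_sobolev_const * (D - hardy_sup u / 4) * (hardy_sup u)^2"
    and "0 \<le> D - hardy_sup u / 4"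
proof -
  define K where "K = 514 * improved_sobolev_const"
  have K: "K > 0" using improved_sobolev_const_pos by (simp add: K_def)
  have up0: "0 \<le> hardy_sup (\<phi> m)" for m
    using hardy_int_le_sup[OF approx_C1c d, of m 0] hardy_int_nonneg[of "\<phi> m" 0] by linarith
  have "0 \<le> dirichlet (\<phi> m) - hardy_sup (\<phi> m) / 4" for m
  proof -
    have "hardy_sup (\<phi> m) \<le> 4 * dirichlet (\<phi> m)"
      using hardy_int_le[OF approx_C1c d, of m] d3 by (intro hardy_sup_le approx_C1c d) (simp add: mult.commute)
    then show ?thesis by simp
  qed
  moreover have DH: "(\<lambda>m. dirichlet (\<phi> m) - hardy_sup (\<phi> m) / 4) \<longlonglongrightarrow> D - hardy_sup u / 4"
    unfolding D_def by (intro tendsto_intros dirichlet_tendsto hardy_sup_tendsto) simp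
  ultimately show "0 \<le> D - hardy_sup u / 4" by (intro LIMSEQ_le_const[OF DH]) auto
  \<comment> \<open>The summand \<open>t\<close> keeps the bound on the Hardy integrals positive
    even if \<open>\<phi> m = 0\<close>; it is sent to 0 at the end.\<close>
  have core: "(LINT x|lebesgue. norm (\<phi> m x) ^ 6) \<le> K * (dirichlet (\<phi> m) - hardy_sup (\<phi> m) / 4) * (hardy_sup (\<phi> m) + t)^2"
    if t: "t > 0" for m t
  proof -
    define H where "H = hardy_sup (\<phi> m) + t"
    have H: "H > 0" using up0[of m] t by (simp add: H_def)
    have Hy: "hardy_int (\<phi> m) y \<le> H" for y using hardy_int_le_sup[OF approx_C1c d, of m y] t by (simp add: H_def)
    have KH: "K * H^2 > 0" using K H by simp
    define X where "X = (LINT x|lborel. norm (\<phi> m x) ^ 6)"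
    \<comment> \<open>The deficit bound holds for each centre \<open>y\<close>. Solved for the Hardy
      integral it passes to the supremum, and is then solved back.\<close>
    have "hardy_int (\<phi> m) y \<le> 4 * (dirichlet (\<phi> m) - X / (K * H^2))" for y
    proof -
      have "X \<le> (dirichlet (\<phi> m) - hardy_int (\<phi> m) y / 4) * (K * H^2)"
        using sobolev_hardy_deficit[OF approx_C1c d3 H Hy, of y] by (simp add: X_def K_def mult_ac)
      then have "X / (K * H^2) \<le> dirichlet (\<phi> m) - hardy_int (\<phi> m) y / 4" by (subst pos_divide_le_eq[OF KH])
      then show ?thesis by simp
    qed
    then have "hardy_sup (\<phi> m) \<le> 4 * (dirichlet (\<phi> m) - X / (K * H^2))" by (intro hardy_sup_le approx_C1c d)
    then have "X / (K * H^2) \<le> dirichlet (\<phi> m) - hardy_sup (\<phi> m) / 4" by simp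
    then have "X \<le> (dirichlet (\<phi> m) - hardy_sup (\<phi> m) / 4) * (K * H^2)" by (subst (asm) pos_divide_le_eq[OF KH])
    moreover have "X = (LINT x|lebesgue. norm (\<phi> m x) ^ 6)"
      unfolding X_def using C1_borel[OF C1c_C1[OF approx_C1c]] by (intro lebesgue_integral[symmetric]) measurable
    ultimately show ?thesis by (simp add: H_def mult_ac)
  qed
  obtain r where r: "strict_mono r" "AE x in lebesgue. (\<lambda>n. \<phi> (r n) x) \<longlonglongrightarrow> u x" by (rule AE_subsequence)
  note DHr = LIMSEQ_subseq_LIMSEQ[OF DH r(1), unfolded o_def] and Hr = LIMSEQ_subseq_LIMSEQ[OF hardy_sup_tendsto r(1), unfolded o_def]
  have step: "(LINT x|lebesgue. norm (u x) ^ 6) \<le> K * (D - hardy_sup u / 4) * (hardy_sup u + t)^2" if t: "t > 0" for t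
  proof -
    have B: "(\<lambda>n. K * (dirichlet (\<phi> (r n)) - hardy_sup (\<phi> (r n)) / 4) * (hardy_sup (\<phi> (r n)) + t)^2)
        \<longlonglongrightarrow> K * (D - hardy_sup u / 4) * (hardy_sup u + t)^2"
      by (intro tendsto_intros DHr Hr)
    have "integrable lebesgue (\<lambda>x. norm (u x) ^ 6) \<and> (LINT x|lebesgue. norm (u x) ^ 6) \<le> K * (D - hardy_sup u / 4) * (hardy_sup u + t)^2"
    proof (rule fatou_real[OF _ _ _ B])
      show "integrable lebesgue (\<lambda>x. norm (\<phi> (r n) x) ^ 6)" for n
        using C1c_power_integrable[OF approx_C1c, of 6] C1_borel[OF C1c_C1[OF approx_C1c]]
        by (subst lebesgue_integrable) auto
      show "(LINT x|lebesgue. norm (\<phi> (r n) x) ^ 6) \<le> K * (dirichlet (\<phi> (r n)) - hardy_sup (\<phi> (r n)) / 4) * (hardy_sup (\<phi> (r n)) + t)^2" for n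
        by (rule core[OF t])
      show "AE x in lebesgue. (\<lambda>n. norm (\<phi> (r n) x) ^ 6) \<longlonglongrightarrow> norm (u x) ^ 6"
        using r(2) by eventually_elim (intro tendsto_intros)
      show "(\<lambda>x. norm (u x) ^ 6) \<in> borel_measurable lebesgue" using approx_measurable by measurable
    qed auto
    then show ?thesis by blast
  qed
  have "(\<lambda>n. K * (D - hardy_sup u / 4) * (hardy_sup u + inverse (real (Suc n)))^2) \<longlonglongrightarrow> K * (D - hardy_sup u / 4) * (hardy_sup u + 0)^2"
    by (intro tendsto_intros LIMSEQ_inverse_real_of_nat)
  then have "(LINT x|lebesgue. norm (u x) ^ 6) \<le> K * (D - hardy_sup u / 4) * (hardy_sup u + 0)^2"
    by (rule LIMSEQ_le_const) (use step in auto)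
  then show "(LINT x|lebesgue. norm (u x) ^ 6) \<le> 514 * improved_sobolev_const * (D - hardy_sup u / 4) * (hardy_sup u)^2"
    by (simp add: K_def)
qed

end

theorem hardy_sobolev_inequality_dim_3:
  assumes d3: "CARD('n::finite) = 3"
  shows "\<exists>C>0. \<forall>u \<in> (dot_H1 :: (real ^ 'n \<Rightarrow> 'k::{real_normed_field,euclidean_space}) set). hardy_sobolev_inequality (1 / 3) C u"
proof (intro exI conjI ballI)
  define K where "K = 514 * improved_sobolev_const"
  have K: "K > 0" using improved_sobolev_const_pos by (simp add: K_def)
  show "0 < 1 / K powr (1 / 3)" using K by simp
  fix u :: "real ^ 'n \<Rightarrow> 'k" assume "u \<in> dot_H1"
  then have "\<exists>g. dot_H1_gradient u g" by (simp add: dot_H1_def)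
  \<comment> \<open>The limit estimates hold for every admissible gradient, in particular for the
    chosen one.\<close>
  then have "dot_H1_gradient u (dot_H1_grad u)" unfolding dot_H1_grad_def by (rule someI_ex)
  then obtain \<phi> where a: "u \<in> Lp_space (sobolev_exponent TYPE('n))" "dot_H1_grad u \<in> Lp_space 2" "\<And>m. \<phi> m \<in> smooth_compact_support"
      "(\<lambda>m. Lp_norm (sobolev_exponent TYPE('n)) (\<lambda>x. \<phi> m x - u x)) \<longlonglongrightarrow> 0"
      "(\<lambda>m. Lp_norm 2 (\<lambda>x. gradient (\<phi> m) x - dot_H1_grad u x)) \<longlonglongrightarrow> 0"
    unfolding dot_H1_gradient_def by blast
  have d: "3 \<le> CARD('n)" using d3 by simp
  note lim = sobolev_hardy_deficit_limit[OF d a d3]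
  define A where "A = dirichlet_energy u - hardy_sup u / 4"
  define H where "H = hardy_sup u"
  define X where "X = (LINT x|lebesgue. norm (u x) ^ 6)"
  have A: "A \<ge> 0" using lim(2) by (simp add: A_def dirichlet_energy_def)
  have H: "H \<ge> 0" unfolding H_def by (rule hardy_sup_limit_nonneg[OF d a])
  have X: "X \<ge> 0" by (simp add: X_def)
  have "X \<le> K * A * H^2" using lim(1) by (simp add: X_def K_def A_def H_def dirichlet_energy_def)
  then have "X powr (1 / 3) \<le> (K * A * H^2) powr (1 / 3)" using X by (intro powr_mono2) auto
  also have "\<dots> = K powr (1 / 3) * (A powr (1 / 3) * H powr (2 / 3))"
    using K A H by (simp add: powr_mult powr_powr flip: powr_numeral)
  finally have "1 / K powr (1 / 3) * X powr (1 / 3) \<le> A powr (1 / 3) * H powr (2 / 3)"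
    using K by (simp add: field_simps)
  \<comment> \<open>In dimension three the Sobolev exponent is 6, so the squared norm is
    \<open>X powr (2 / 6)\<close>.\<close>
  moreover have "(Lp_norm (sobolev_exponent TYPE('n)) u)^2 = X powr (1 / 3)"
    using d3 X by (simp add: Lp_norm_def sobolev_exponent_def X_def powr_powr flip: powr_numeral)
  ultimately show "hardy_sobolev_inequality (1 / 3) (1 / K powr (1 / 3)) u"
    using d3 by (simp add: hardy_sobolev_inequality_def A_def H_def)
qed

section \<open>Uniqueness of the weak gradient\<close>

lemma pairing_tendsto_0:
  fixes w :: "real ^ 'n::finite \<Rightarrow> 'v::euclidean_space" and f :: "nat \<Rightarrow> real ^ 'n \<Rightarrow> 'v"
  assumes w: "continuous_on UNIV w" "\<And>x. R < norm x \<Longrightarrow> w x = 0" and p: "1 < p"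
    and f: "\<And>n. f n \<in> borel_measurable borel" "\<And>n. integrable lborel (\<lambda>x. norm (f n x) powr p)"
    and lim: "(\<lambda>n. LINT x|lborel. norm (f n x) powr p) \<longlonglongrightarrow> 0"
  shows "(\<lambda>n. LINT x|lborel. w x \<bullet> f n x) \<longlonglongrightarrow> 0"
proof (rule LIMSEQ_I)
  fix r :: real assume r: "r > 0"
  obtain M where M: "M > 0" "\<And>x. norm (w x) \<le> M" using continuous_support_bounded[OF w] by metis
  define V where "V = measure lborel (cball (0::real^'n) R)"
  have V: "V \<ge> 0" by (simp add: V_def)
  define e where "e = r / (2 * M * (V + 1))"
  have e: "e > 0" using r M V by (simp add: e_def)
  have eV: "M * (e * V) < r / 2 + r / 4"
  proof -
    have "M * (e * (V + 1)) = r / 2" using M V by (simp add: e_def)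
    moreover have "M * (e * V) \<le> M * (e * (V + 1))" using M e by (intro mult_left_mono) auto
    ultimately show ?thesis using r by linarith
  qed
  \<comment> \<open>A substitute for Hoelder's inequality: on the bounded support of
    \<open>w\<close> the constant \<open>e\<close> costs only \<open>M * e * V\<close>, and the
    other term is controlled by the \<open>L^p\<close> integral.\<close>
  have young: "t \<le> e + e powr (1 - p) * t powr p" if "t \<ge> 0" for t
  proof (cases "t \<le> e")
    case True
    then show ?thesis by (simp add: add_increasing2)
  next
    case False
    then have t: "t > 0" using e by simp
    have "1 \<le> (t / e) powr (p - 1)" using False e p by (intro ge_one_powr_ge_zero) auto
    then have "t \<le> t * (t / e) powr (p - 1)" using t by simp
    also have "\<dots> = e powr (1 - p) * t powr p"
      using t e by (simp add: powr_divide powr_diff)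
    finally show ?thesis using e by simp
  qed
  have int_ind: "integrable lborel (indicator (cball (0::real^'n) R) :: _ \<Rightarrow> real)"
    using emeasure_bounded_finite[OF bounded_cball[of "0::real^'n" R]] by simp
  have bound: "\<bar>LINT x|lborel. w x \<bullet> f n x\<bar> \<le> M * (e * V) + M * e powr (1 - p) * (LINT x|lborel. norm (f n x) powr p)" for n
  proof -
    let ?b = "\<lambda>x. M * (e * indicator (cball 0 R) x) + M * e powr (1 - p) * (norm (f n x) powr p)"
    have i: "integrable lborel ?b"
      by (intro Bochner_Integration.integrable_add integrable_mult_right int_ind f(2))
    have pt: "\<bar>w x \<bullet> f n x\<bar> \<le> ?b x" for x
    proof (cases "R < norm x")
      case True
      then show ?thesis using M(1) w(2) by simp
    next
      case False
      have "\<bar>w x \<bullet> f n x\<bar> \<le> norm (w x) * norm (f n x)" by (rule Cauchy_Schwarz_ineq2)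
      also have "\<dots> \<le> M * (e + e powr (1 - p) * norm (f n x) powr p)"
        using M young[of "norm (f n x)"] by (intro mult_mono) auto
      finally show ?thesis using False by (simp add: distrib_left mult.assoc)
    qed
    have [measurable]: "w \<in> borel_measurable borel" using w(1) by (rule borel_measurable_continuous_onI)
    note [measurable] = f(1)
    have iw: "integrable lborel (\<lambda>x. w x \<bullet> f n x)"
    proof (rule Bochner_Integration.integrable_bound[OF i])
      show "AE x in lborel. norm (w x \<bullet> f n x) \<le> norm (?b x)"
        by (rule AE_I2) (use pt in \<open>simp add: order_trans[OF _ abs_ge_self]\<close>)
    qed measurable
    have "\<bar>LINT x|lborel. w x \<bullet> f n x\<bar> \<le> (LINT x|lborel. ?b x)"
      by (rule order_trans[OF integral_abs_bound integral_mono[OF integrable_abs[OF iw] i pt]])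
    also have "\<dots> = M * (e * V) + M * e powr (1 - p) * (LINT x|lborel. norm (f n x) powr p)"
      using int_ind f(2) by (simp add: V_def)
    finally show ?thesis .
  qed
  have "(\<lambda>n. M * e powr (1 - p) * (LINT x|lborel. norm (f n x) powr p)) \<longlonglongrightarrow> M * e powr (1 - p) * 0"
    by (intro tendsto_intros lim)
  then have "\<forall>\<^sub>F n in sequentially. M * e powr (1 - p) * (LINT x|lborel. norm (f n x) powr p) < r / 4"
    by (rule order_tendstoD) (use r in simp)
  then obtain N where N: "\<And>n. n \<ge> N \<Longrightarrow> M * e powr (1 - p) * (LINT x|lborel. norm (f n x) powr p) < r / 4"
    unfolding eventually_sequentially by blast
  show "\<exists>N. \<forall>n\<ge>N. norm ((LINT x|lborel. w x \<bullet> f n x) - 0) < r"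
  proof (intro exI allI impI)
    fix n assume "n \<ge> N"
    from bound[of n] N[OF this] eV show "norm ((LINT x|lborel. w x \<bullet> f n x) - 0) < r" by simp
  qed
qed

lemma smooth_C1_partial:
  fixes f :: "real ^ 'n::finite \<Rightarrow> 'k::euclidean_space"
  assumes "f \<in> smooth_compact_support" shows "C1 (partial_deriv i f)"
proof -
  have "times_differentiable (Suc (Suc 0)) f" using assms by (simp add: smooth_compact_support_def del: times_differentiable.simps)
  then show ?thesis by (simp add: C1_def)
qed

lemma gradient_inner: "gradient f x \<bullet> gradient g x = (\<Sum>i\<in>UNIV. partial_deriv i f x \<bullet> partial_deriv i g x)"
  for f g :: "real ^ 'n::finite \<Rightarrow> 'v::euclidean_space"
  by (simp add: inner_vec_def gradient_def)

lemma green_first_identity: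
  fixes a b :: "real ^ 'n::finite \<Rightarrow> 'v::euclidean_space"
  assumes a: "C1c a" "\<And>i. C1 (partial_deriv i a)" and b: "C1c b"
  shows "(LINT x|lborel. gradient a x \<bullet> gradient b x) = - (LINT x|lborel. (\<Sum>i\<in>UNIV. partial_deriv i (partial_deriv i a) x) \<bullet> b x)"
proof -
  obtain R where R: "\<And>x. R < norm x \<Longrightarrow> b x = 0" "\<And>x i. R < norm x \<Longrightarrow> partial_deriv i b x = 0" using C1c_support[OF b] by metis
  note Cb = C1c_C1[OF b]
  have C: "C1c (\<lambda>x. partial_deriv i a x \<bullet> b x)" for i
    by (rule C1cI[OF C1_inner[OF a(2) Cb], of R]) (simp add: R)
  have p: "partial_deriv i (\<lambda>x. partial_deriv i a x \<bullet> b x) x = partial_deriv i a x \<bullet> partial_deriv i b x + partial_deriv i (partial_deriv i a) x \<bullet> b x" for i x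
    by (intro partial_inner C1_differentiable a(2) Cb)
  have i1: "integrable lborel (\<lambda>x. partial_deriv i a x \<bullet> partial_deriv i b x)" for i
    by (rule continuous_support_integrable[of _ R])
      (intro continuous_on_inner C1_continuous_partial C1c_C1[OF a(1)] Cb, simp add: R)
  have i2: "integrable lborel (\<lambda>x. partial_deriv i (partial_deriv i a) x \<bullet> b x)" for i
    by (rule continuous_support_integrable[of _ R])
      (intro continuous_on_inner C1_continuous_partial a(2) C1_continuous Cb, simp add: R)
  have "(LINT x|lborel. partial_deriv i a x \<bullet> partial_deriv i b x) = - (LINT x|lborel. partial_deriv i (partial_deriv i a) x \<bullet> b x)" for i
    using integral_partial_eq_0[OF C, of i i] unfolding p by (simp add: Bochner_Integration.integral_add[OF i1 i2])
  then show ?thesis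
    unfolding gradient_inner inner_sum_left
    by (simp add: Bochner_Integration.integral_sum[OF i1] Bochner_Integration.integral_sum[OF i2] sum_negf)
qed

lemma smooth_in_dot_H1:
  fixes u :: "real ^ 'n::finite \<Rightarrow> 'k::{real_normed_field,euclidean_space}"
  assumes u: "u \<in> smooth_compact_support" and d: "3 \<le> CARD('n)"
  shows "dot_H1_gradient u (gradient u)" "u \<in> dot_H1"
proof -
  note C = smooth_C1c[OF u]
  have p: "0 < sobolev_exponent TYPE('n)" using d by (simp add: sobolev_exponent_def)
  note [measurable] = C1_borel[OF C1c_C1[OF C]]
  have m: "(\<lambda>x. norm (u x) powr sobolev_exponent TYPE('n)) \<in> borel_measurable borel" by measurable
  show "dot_H1_gradient u (gradient u)"
    unfolding dot_H1_gradient_def Lp_space_2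
  proof (intro conjI exI[of _ "\<lambda>_. u"] allI u)
    show "u \<in> Lp_space (sobolev_exponent TYPE('n))"
      unfolding Lp_space_def
      using C1_borel[OF C1c_C1[OF C]] C1c_powr_integrable[OF C p] by (simp add: lebesgue_measurable lebesgue_integrable[OF m])
    show "gradient u \<in> borel_measurable lebesgue" by (intro lebesgue_measurable C1_gradient_borel C1c_C1 C)
    show "integrable lebesgue (\<lambda>x. (norm (gradient u x))^2)" by (rule dirichlet_lebesgue_integrable[OF C])
  qed (simp_all add: Lp_norm_def)
  then show "u \<in> dot_H1" unfolding dot_H1_def by blast
qed

text \<open>
  Uniqueness of the gradient. With \<open>\<psi> m \<rightarrow> 0\<close> in \<open>L\<^sup>p\<close> and \<open>\<nabla>\<psi> m \<rightarrow> k\<close> in \<open>L\<^sup>2\<close>, the products \<open>\<integral> \<nabla>\<psi> m \<bullet> \<nabla>\<psi> n = - \<integral> \<Delta>\<psi> m \<bullet> \<psi> n\<close>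
  tend to zero as \<open>n \<rightarrow> \<infinity>\<close>, because \<open>\<Delta>\<psi> m\<close> is continuous with compact support; then \<open>m \<rightarrow> \<infinity>\<close>.
\<close>

theorem dirichlet_energy_smooth:
  fixes u :: "real ^ 'n::finite \<Rightarrow> 'k::{real_normed_field,euclidean_space}"
  assumes u: "u \<in> smooth_compact_support" and d: "3 \<le> CARD('n)"
  shows "dirichlet_energy u = dirichlet u"
proof -
  define g where "g = dot_H1_grad u"
  have "\<exists>g. dot_H1_gradient u g" using smooth_in_dot_H1(1)[OF u d] by blast
  then have "dot_H1_gradient u g" unfolding g_def dot_H1_grad_def by (rule someI_ex)
  then obtain \<phi> where a: "u \<in> Lp_space (sobolev_exponent TYPE('n))" "g \<in> Lp_space 2" "\<And>m. \<phi> m \<in> smooth_compact_support"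
      "(\<lambda>m. Lp_norm (sobolev_exponent TYPE('n)) (\<lambda>x. \<phi> m x - u x)) \<longlonglongrightarrow> 0"
      "(\<lambda>m. Lp_norm 2 (\<lambda>x. gradient (\<phi> m) x - g x)) \<longlonglongrightarrow> 0"
    unfolding dot_H1_gradient_def by blast
  define p where "p = sobolev_exponent TYPE('n)"
  have p: "1 < p" unfolding p_def by (rule exponent_gt_1[OF d a])
  note Cu = smooth_C1c[OF u] and C\<phi> = smooth_C1c[OF a(3)]
  define \<psi> where "\<psi> m x = \<phi> m x - u x" for m x
  have C\<psi>: "C1c (\<psi> m)" for m unfolding \<psi>_def by (rule C1c_diff[OF C\<phi> Cu])
  have pd: "partial_deriv i (\<psi> m) = (\<lambda>x. partial_deriv i (\<phi> m) x - partial_deriv i u x)" for i m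
    unfolding \<psi>_def by (rule ext) (intro partial_diff C1_differentiable C1c_C1 C\<phi> Cu)
  have C2: "C1 (partial_deriv i (\<psi> m))" for i m
    unfolding pd by (intro C1_diff smooth_C1_partial a(3) u)
  have grad\<psi>: "gradient (\<psi> m) x = gradient (\<phi> m) x - gradient u x" for m x
    unfolding \<psi>_def by (rule gradient_diff[OF C1c_C1[OF C\<phi>] C1c_C1[OF Cu]])
  define k where "k x = g x - gradient u x" for x
  have gm: "gradient u \<in> borel_measurable lebesgue" by (intro lebesgue_measurable C1_gradient_borel C1c_C1 Cu)
  have gm': "gradient (\<psi> m) \<in> borel_measurable lebesgue" for m by (intro lebesgue_measurable C1_gradient_borel C1c_C1 C\<psi>)
  have km: "k \<in> borel_measurable lebesgue"
    unfolding k_def by (intro borel_measurable_diff approx_measurable(4)[OF d a] gm)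
  have ik: "integrable lebesgue (\<lambda>x. (norm (k x))^2)"
    unfolding k_def by (intro integrable_sq_diff gm approx_measurable(4)[OF d a] limit_gradient_integrable[OF d a] dirichlet_lebesgue_integrable Cu)
  note i\<psi> = dirichlet_lebesgue_integrable[OF C\<psi>]
  have err: "(\<lambda>n. LINT x|lebesgue. (norm (gradient (\<psi> n) x - k x))^2) \<longlonglongrightarrow> 0"
    using gradient_error_tendsto_0[OF d a] by (simp add: grad\<psi> k_def)
  have n1: "(\<lambda>n. LINT x|lebesgue. (norm (gradient (\<psi> n) x))^2) \<longlonglongrightarrow> (LINT x|lebesgue. (norm (k x))^2)"
    by (rule L2_norm_tendsto[OF gm' km i\<psi> ik err])
  have n2: "(\<lambda>n. LINT x|lebesgue. (norm (gradient (\<psi> m) x - gradient (\<psi> n) x))^2) \<longlonglongrightarrow> (LINT x|lebesgue. (norm (gradient (\<psi> m) x - k x))^2)" for m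
  proof (rule L2_norm_tendsto)
    show "(\<lambda>n. LINT x|lebesgue. (norm (gradient (\<psi> m) x - gradient (\<psi> n) x - (gradient (\<psi> m) x - k x)))^2) \<longlonglongrightarrow> 0"
      using err by (simp add: norm_minus_commute)
  qed (intro borel_measurable_diff gm' km integrable_sq_diff i\<psi> ik)+
  have \<psi>lim: "(\<lambda>n. LINT x|lborel. norm (\<psi> n x) powr p) \<longlonglongrightarrow> 0"
  proof -
    have "(LINT x|lebesgue. norm (\<psi> n x) powr p) = (LINT x|lborel. norm (\<psi> n x) powr p)" for n
    proof (rule lebesgue_integral)
      note [measurable] = C1_borel[OF C1c_C1[OF C\<psi>]]
      show "(\<lambda>x. norm (\<psi> n x) powr p) \<in> borel_measurable borel" by measurable
    qed
    then show ?thesis using Lp_norm_tendsto_0[OF _ a(4)] p by (simp add: p_def \<psi>_def)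
  qed
  let ?I = "\<lambda>f. LINT x|lebesgue. (norm (f x))^2"
  \<comment> \<open>Twice the inner product of \<open>gradient (\<psi> m)\<close> with the limit
    \<open>k\<close>, in polarised form, so that convergence of squared norms suffices. It vanishes
    as the limit of \<open>- 2\<close> times the pairings of the Laplacian \<open>w\<close> with
    \<open>\<psi> n\<close>.\<close>
  have orth: "?I (gradient (\<psi> m)) + ?I k - (LINT x|lebesgue. (norm (gradient (\<psi> m) x - k x))^2) = 0" for m
  proof -
    define w where "w x = (\<Sum>i\<in>UNIV. partial_deriv i (partial_deriv i (\<psi> m)) x)" for x
    obtain R where R: "\<And>x i. R < norm x \<Longrightarrow> partial_deriv i (\<psi> m) x = 0" using C1c_support[OF C\<psi>] by metis
    have w0: "w x = 0" if "R < norm x" for x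
    proof -
      have "open {x::real^'n. R < norm x}" by (intro open_Collect_less continuous_intros)
      then have "partial_deriv i (partial_deriv i (\<psi> m)) x = 0" for i
        by (rule partial_deriv_eq_0) (use that R in auto)
      then show ?thesis by (simp add: w_def)
    qed
    have cw: "continuous_on UNIV w" unfolding w_def by (intro continuous_on_sum C1_continuous_partial C2)
    have p0: "p > 0" using p by simp
    have wlim: "(\<lambda>n. LINT x|lborel. w x \<bullet> \<psi> n x) \<longlonglongrightarrow> 0"
      by (rule pairing_tendsto_0[OF cw w0 p C1_borel[OF C1c_C1[OF C\<psi>]] C1c_powr_integrable[OF C\<psi> p0] \<psi>lim])
    have eq2: "?I (gradient (\<psi> m)) + ?I (gradient (\<psi> n)) - (LINT x|lebesgue. (norm (gradient (\<psi> m) x - gradient (\<psi> n) x))^2)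
        = - 2 * (LINT x|lborel. w x \<bullet> \<psi> n x)" for n
    proof -
      have eq: "gradient (\<psi> m) x - gradient (\<psi> n) x = gradient (\<lambda>x. \<psi> m x - \<psi> n x) x" for x
        by (rule gradient_diff[symmetric]) (intro C1c_C1 C\<psi>)+
      have "(norm (gradient (\<psi> m) x - gradient (\<psi> n) x))^2 = (norm (gradient (\<psi> m) x))^2 + (norm (gradient (\<psi> n) x))^2 - 2 * (gradient (\<psi> m) x \<bullet> gradient (\<psi> n) x)" for x
        by (simp add: power2_norm_eq_inner inner_diff_left inner_diff_right inner_commute)
      then have i: "2 * (gradient (\<psi> m) x \<bullet> gradient (\<psi> n) x) = (norm (gradient (\<psi> m) x))^2 + (norm (gradient (\<psi> n) x))^2 - (norm (gradient (\<lambda>x. \<psi> m x - \<psi> n x) x))^2" for x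
        unfolding eq by simp
      have "2 * (LINT x|lborel. gradient (\<psi> m) x \<bullet> gradient (\<psi> n) x) = (LINT x|lborel. 2 * (gradient (\<psi> m) x \<bullet> gradient (\<psi> n) x))" by simp
      also have "\<dots> = dirichlet (\<psi> m) + dirichlet (\<psi> n) - dirichlet (\<lambda>x. \<psi> m x - \<psi> n x)"
        unfolding i dirichlet_def
        using dirichlet_integrable[OF C\<psi>] dirichlet_integrable[OF C1c_diff[OF C\<psi> C\<psi>]]
        by (simp add: Bochner_Integration.integral_diff Bochner_Integration.integral_add)
      finally show ?thesis
        unfolding eq green_first_identity[OF C\<psi> C2 C\<psi>] dirichlet_lebesgue[OF C\<psi>] dirichlet_lebesgue[OF C1c_diff[OF C\<psi> C\<psi>]] w_def by simp
    qed
    have l1: "(\<lambda>n. ?I (gradient (\<psi> m)) + ?I (gradient (\<psi> n)) - (LINT x|lebesgue. (norm (gradient (\<psi> m) x - gradient (\<psi> n) x))^2)) \<longlonglongrightarrow>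
       ?I (gradient (\<psi> m)) + ?I k - (LINT x|lebesgue. (norm (gradient (\<psi> m) x - k x))^2)"
      by (intro tendsto_add tendsto_diff tendsto_const n1 n2)
    have l2: "(\<lambda>n. - 2 * (LINT x|lborel. w x \<bullet> \<psi> n x)) \<longlonglongrightarrow> - 2 * 0" by (intro tendsto_mult tendsto_const wlim)
    from LIMSEQ_unique[OF l1[unfolded eq2] l2] show ?thesis by simp
  qed
  have "(\<lambda>m. ?I (gradient (\<psi> m)) + ?I k - (LINT x|lebesgue. (norm (gradient (\<psi> m) x - k x))^2)) \<longlonglongrightarrow> ?I k + ?I k - 0"
    by (intro tendsto_add tendsto_diff tendsto_const n1 err)
  then have k0: "?I k = 0" unfolding orth by (simp add: LIMSEQ_const_iff)
  have "\<bar>sqrt (?I g) - sqrt (?I (gradient u))\<bar> \<le> sqrt (?I k)"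
    unfolding k_def by (intro L2_triangle_abs gm approx_measurable(4)[OF d a] limit_gradient_integrable[OF d a] dirichlet_lebesgue_integrable Cu)
  then show ?thesis
    unfolding k0 by (simp add: dirichlet_energy_def g_def dirichlet_lebesgue[OF Cu])
qed

section \<open>Smooth test functions\<close>

text \<open>
  \<open>times_differentiable\<close> relative to a set, so that \<open>ln\<close> and \<open>powr\<close> of the norm can be used away from the origin.
\<close>

primrec td_on :: "nat \<Rightarrow> (real ^ 'n::finite) set \<Rightarrow> (real ^ 'n \<Rightarrow> 'k::real_normed_vector) \<Rightarrow> bool"
  where
    "td_on 0 S f \<longleftrightarrow> continuous_on S f"
  | "td_on (Suc m) S f \<longleftrightarrow> (\<forall>x\<in>S. f differentiable at x) \<and> (\<forall>i. td_on m S (partial_deriv i f))"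

lemma td_on_UNIV: "td_on m UNIV f \<longleftrightarrow> times_differentiable m f"
  by (induction m arbitrary: f) (auto simp: differentiable_on_def)

lemma td_on_cong:
  assumes S: "open S" and "\<And>x. x \<in> S \<Longrightarrow> f x = g x" "td_on m S f"
  shows "td_on m S g"
  using assms(2,3)
proof (induction m arbitrary: f g)
  case 0
  then show ?case using continuous_on_cong[of S S f g] by simp
next
  case (Suc m)
  have der: "(g has_derivative (\<lambda>h. \<Sum>i\<in>UNIV. (h $ i) *\<^sub>R partial_deriv i f x)) (at x)" if "x \<in> S" for x
    by (rule has_derivative_transform_within_open[OF has_derivative_partial S that]) (use Suc.prems that in auto)
  have p: "partial_deriv i f x = partial_deriv i g x" if "x \<in> S" for i x
  proof -
    have "partial_deriv i g x = (\<Sum>j\<in>UNIV. (axis i 1 $ j) *\<^sub>R partial_deriv j f x)" by (rule partial_deriv_eq[OF der[OF that]])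
    also have "\<dots> = partial_deriv i f x"
      by (subst sum.remove[of UNIV i]) (auto simp: axis_def intro!: sum.neutral)
    finally show ?thesis ..
  qed
  have "td_on m S (partial_deriv i g)" for i
    by (rule Suc.IH[of "partial_deriv i f"]) (use p Suc.prems in auto)
  moreover have "g differentiable at x" if "x \<in> S" for x using der[OF that] unfolding differentiable_def by blast
  ultimately show ?case by simp
qed

lemma td_on_Un: "open S \<Longrightarrow> open T \<Longrightarrow> td_on m S f \<Longrightarrow> td_on m T f \<Longrightarrow> td_on m (S \<union> T) f"
  by (induction m arbitrary: f) (auto intro: continuous_on_open_Un)

lemma td_on_continuous: "td_on m S f \<Longrightarrow> continuous_on S f"
  by (cases m) (auto intro!: continuous_at_imp_continuous_on differentiable_imp_continuous_within)

lemma td_on_Suc_D: "td_on (Suc m) S f \<Longrightarrow> td_on m S f"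
proof (induction m arbitrary: f)
  case 0
  then show ?case using td_on_continuous[of "Suc 0"] by simp
next
  case (Suc m)
  then show ?case by (simp del: td_on.simps(1)) 
qed

lemma td_on_add:
  assumes S: "open S" shows "td_on m S f \<Longrightarrow> td_on m S g \<Longrightarrow> td_on m S (\<lambda>x. f x + g x)"
proof (induction m arbitrary: f g)
  case 0
  then show ?case by (simp add: continuous_on_add)
next
  case (Suc m)
  have p: "partial_deriv i f x + partial_deriv i g x = partial_deriv i (\<lambda>x. f x + g x) x" if "x \<in> S" for i x
  proof -
    have "f differentiable at x" "g differentiable at x" using Suc.prems that by auto
    from partial_deriv_eq[OF has_derivative_add[OF this[unfolded frechet_derivative_works]], of i] show ?thesis
      by (simp add: partial_deriv_def)
  qed
  have "td_on m S (partial_deriv i (\<lambda>x. f x + g x))" for i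
    by (rule td_on_cong[OF S p Suc.IH]) (use Suc.prems in auto)
  with Suc.prems show ?case by (auto intro: differentiable_add)
qed

lemma td_on_scaleR:
  assumes S: "open S" shows "td_on m S a \<Longrightarrow> td_on m S f \<Longrightarrow> td_on m S (\<lambda>x. a x *\<^sub>R f x)"
proof (induction m arbitrary: a f)
  case 0
  then show ?case by (simp add: continuous_on_scaleR)
next
  case (Suc m)
  have p: "a x *\<^sub>R partial_deriv i f x + partial_deriv i a x *\<^sub>R f x = partial_deriv i (\<lambda>x. a x *\<^sub>R f x) x" if "x \<in> S" for i x
    using Suc.prems that by (intro partial_scaleR[symmetric]) auto
  note lower = td_on_Suc_D[OF Suc.prems(1)] td_on_Suc_D[OF Suc.prems(2)]
  have "td_on m S (partial_deriv i (\<lambda>x. a x *\<^sub>R f x))" for i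
    by (rule td_on_cong[OF S p td_on_add[OF S Suc.IH Suc.IH]]) (use Suc.prems lower in auto)
  with Suc.prems show ?case by (auto intro: differentiable_scaleR)
qed

lemma td_on_mult: "open S \<Longrightarrow> td_on m S a \<Longrightarrow> td_on m S f \<Longrightarrow> td_on m S (\<lambda>x. a x * f x :: real)"
  using td_on_scaleR[of S m a f] by simp

lemma td_on_const: "td_on m S (\<lambda>x::real^'n::finite. c)"
proof (induction m arbitrary: c)
  case (Suc m)
  have "partial_deriv i (\<lambda>x::real^'n. c) = (\<lambda>x. 0)" for i
    by (rule ext) (rule partial_deriv_eq[OF has_derivative_const])
  then show ?case using Suc by simp
qed simp

lemma td_on_coord: "td_on m S (\<lambda>x::real^'n::finite. (x - y) $ j)"
proof (cases m)
  case 0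
  then show ?thesis by (auto intro!: continuous_intros)
next
  case (Suc k)
  have "partial_deriv i (\<lambda>x. (x - y) $ j) = (\<lambda>x. if i = j then 1 else 0)" for i by (rule ext) (rule partial_coord)
  then show ?thesis unfolding Suc td_on.simps using differentiable_coord td_on_const by auto
qed

lemma td_on_dist_sq:
  assumes S: "open S" shows "td_on m S (\<lambda>x::real^'n::finite. (norm (x - y))^2)"
proof (cases m)
  case 0
  then show ?thesis by (auto intro!: continuous_intros)
next
  case (Suc k)
  have "partial_deriv i (\<lambda>x. (norm (x - y))^2) = (\<lambda>x. 2 * (x - y) $ i)" for i by (rule ext) (rule partial_dist_sq)
  then have "td_on k S (partial_deriv i (\<lambda>x. (norm (x - y))^2))" for i
    using td_on_mult[OF S td_on_const[of k S 2] td_on_coord[of k S y i]] by (simp only:)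
  then show ?thesis
    unfolding Suc td_on.simps using differentiable_dist_sq by blast
qed

text \<open>The chain rule replaces \<open>F\<close> by its derivative, so the induction on
  \<open>m\<close> must run over a family closed under differentiation. The families used below are
  the functions \<open>flat_exp p\<close>, the multiples of real powers, and the latter together
  with \<open>ln\<close>.\<close>

lemma td_on_compose:
  assumes S: "open S" and fam: "\<And>F. F \<in> \<F> \<Longrightarrow> \<exists>F'\<in>\<F>. \<forall>t\<in>U. (F has_real_derivative F' t) (at t)"
    and g: "\<And>x. x \<in> S \<Longrightarrow> g x \<in> U"
  shows "F \<in> \<F> \<Longrightarrow> td_on m S g \<Longrightarrow> td_on m S (\<lambda>x. F (g x))"
proof (induction m arbitrary: F)
  case 0
  then obtain F' where "\<forall>t\<in>U. (F has_real_derivative F' t) (at t)" using fam by blast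
  then have "continuous_on U F" by (intro DERIV_continuous_on) (auto intro: has_field_derivative_at_within)
  then show ?case using 0 g by (auto intro: continuous_on_compose2)
next
  case (Suc m)
  obtain F' where F': "F' \<in> \<F>" "\<And>t. t \<in> U \<Longrightarrow> (F has_real_derivative F' t) (at t)" using fam[OF Suc.prems(1)] by blast
  have gd: "g differentiable at x" if "x \<in> S" for x using Suc.prems that by auto
  have p: "F' (g x) * partial_deriv i g x = partial_deriv i (\<lambda>x. F (g x)) x" if "x \<in> S" for i x
    by (rule partial_compose[symmetric, OF F'(2)[OF g[OF that]] gd[OF that]])
  have "td_on m S (partial_deriv i (\<lambda>x. F (g x)))" for i
    by (rule td_on_cong[OF S p td_on_mult[OF S Suc.IH[OF F'(1) td_on_Suc_D[OF Suc.prems(2)]]]]) (use Suc.prems in auto)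
  moreover have "(\<lambda>x. F (g x)) differentiable at x" if "x \<in> S" for x
  proof (rule differentiable_compose[of F, OF _ gd[OF that]])
    show "F differentiable at (g x)" using F'(2)[OF g[OF that]] real_differentiable_def by blast
  qed
  ultimately show ?case by simp
qed

lemma smooth_compact_supportI:
  assumes "\<And>m. td_on m UNIV f" "\<And>x. R < norm x \<Longrightarrow> f x = 0"
  shows "f \<in> smooth_compact_support"
proof -
  have "{x. f x \<noteq> 0} \<subseteq> cball 0 R" using assms(2) by force
  then have "bounded {x. f x \<noteq> 0}" using bounded_cball bounded_subset by blast
  then show ?thesis using assms(1) by (simp add: smooth_compact_support_def td_on_UNIV)
qed

text \<open>All derivatives of \<open>exp (- 1 / t)\<close>, extended by 0, have this shape:
  differentiation turns \<open>p\<close> into \<open>X^2 * (p - p')\<close>. The polynomial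
  parameter makes the family closed under differentiation.\<close>

definition flat_exp :: "real poly \<Rightarrow> real \<Rightarrow> real"
  where "flat_exp p t = (if t > 0 then poly p (1 / t) * exp (- (1 / t)) else 0)"

lemma poly_exp_tendsto_0: "((\<lambda>s. poly p s * exp (- s)) \<longlongrightarrow> 0) (at_top :: real filter)"
proof -
  have "((\<lambda>s. \<Sum>i\<le>degree p. coeff p i * (s ^ i / exp s)) \<longlongrightarrow> (\<Sum>i\<le>degree p. coeff p i * 0)) at_top"
    by (intro tendsto_intros tendsto_power_div_exp_0)
  moreover have "(\<Sum>i\<le>degree p. coeff p i * (s ^ i / exp s)) = poly p s * exp (- s)" for s :: real
    by (simp add: poly_altdef sum_distrib_right exp_minus divide_inverse mult.assoc)
  ultimately show ?thesis by simp
qed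

lemma flat_exp_tendsto_0: "((\<lambda>t. flat_exp p t) \<longlongrightarrow> 0) (at 0)"
proof -
  have "((\<lambda>t. poly p (inverse t) * exp (- inverse t)) \<longlongrightarrow> 0) (at_right 0)"
    by (rule filterlim_compose[OF poly_exp_tendsto_0 filterlim_inverse_at_top_right])
  then have "(flat_exp p \<longlongrightarrow> 0) (at_right 0)"
    by (rule Lim_transform_eventually) (auto simp: eventually_at_filter flat_exp_def inverse_eq_divide)
  moreover have "(flat_exp p \<longlongrightarrow> 0) (at_left 0)"
    by (rule Lim_transform_eventually[OF tendsto_const]) (auto simp: eventually_at_filter flat_exp_def)
  ultimately show ?thesis by (simp add: filterlim_at_split)
qed

lemma flat_exp_has_derivative:
  "(flat_exp p has_real_derivative flat_exp ([:0, 0, 1:] * (p - pderiv p)) t) (at t)"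
proof -
  consider "t < 0" | "t = 0" | "t > 0" by linarith
  then show ?thesis
  proof cases
    case 1
    have "((\<lambda>s::real. 0) has_real_derivative 0) (at t)" by simp
    then show ?thesis
      by (rule has_field_derivative_transform_within_open[of _ _ _ "{..<0}", THEN DERIV_cong])
        (use 1 in \<open>auto simp: flat_exp_def\<close>)
  next
    case 3
    have "((\<lambda>s. 1 / s) has_real_derivative - (1 / t^2)) (at t)"
      using 3 by (auto intro!: derivative_eq_intros simp: power2_eq_square)
    then have "((\<lambda>s. poly p (1 / s) * exp (- (1 / s))) has_real_derivative
       poly (pderiv p) (1 / t) * (- (1 / t^2)) * exp (- (1 / t)) + exp (- (1 / t)) * (- (- (1 / t^2))) * poly p (1 / t)) (at t)"
      by (intro DERIV_mult DERIV_chain2[OF poly_DERIV] DERIV_fun_exp DERIV_minus)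
    then have "((\<lambda>s. poly p (1 / s) * exp (- (1 / s))) has_real_derivative flat_exp ([:0, 0, 1:] * (p - pderiv p)) t) (at t)"
      by (rule DERIV_cong) (use 3 in \<open>simp add: flat_exp_def algebra_simps power2_eq_square\<close>)
    then show ?thesis
      by (rule has_field_derivative_transform_within_open[of _ _ _ "{0<..}"]) (use 3 in \<open>auto simp: flat_exp_def\<close>)
  next
    case 2
    \<comment> \<open>The difference quotient at 0 is again a member of the family, since dividing
      by \<open>h\<close> multiplies the polynomial in \<open>1 / h\<close> by its variable.\<close>
    have "((\<lambda>h. flat_exp (pCons 0 p) h) \<longlongrightarrow> 0) (at 0)" by (rule flat_exp_tendsto_0)
    then have "((\<lambda>h. (flat_exp p (0 + h) - flat_exp p 0) / h) \<longlongrightarrow> 0) (at 0)"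
      by (rule Lim_transform_eventually) (auto simp: eventually_at_filter flat_exp_def)
    then show ?thesis using 2 by (simp add: DERIV_def flat_exp_def)
  qed
qed

definition bump :: "real \<Rightarrow> real"
  where "bump t = flat_exp 1 t"

lemma bump_nonpos: "t \<le> 0 \<Longrightarrow> bump t = 0" and bump_pos: "t > 0 \<Longrightarrow> bump t > 0"
  by (auto simp: bump_def flat_exp_def)

lemma td_on_bump:
  assumes S: "open S" and g: "td_on m S g" shows "td_on m S (\<lambda>x. bump (g x))"
  unfolding bump_def
proof (rule td_on_compose[OF S, of "range flat_exp" UNIV, OF _ _ _ g])
  fix F assume "F \<in> range flat_exp"
  then obtain p where "F = flat_exp p" by blast
  with flat_exp_has_derivative[of p] show "\<exists>F'\<in>range flat_exp. \<forall>t\<in>UNIV. (F has_real_derivative F' t) (at t)" by blast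
qed auto

lemma td_on_powr:
  fixes g :: "real ^ 'n::finite \<Rightarrow> real"
  assumes S: "open S" and g: "td_on m S g" "\<And>x. x \<in> S \<Longrightarrow> g x > 0" shows "td_on m S (\<lambda>x. g x powr a)"
proof (rule td_on_compose[OF S, of "{F. \<exists>b c. F = (\<lambda>t. c * t powr b)}" "{0<..}", OF _ _ _ g(1)])
  fix F :: "real \<Rightarrow> real" assume "F \<in> {F. \<exists>b c. F = (\<lambda>t. c * t powr b)}"
  then obtain b c where F: "F = (\<lambda>t. c * t powr b)" by blast
  have "(F has_real_derivative (c * b) * t powr (b - 1)) (at t)" if "t > 0" for t
    unfolding F using DERIV_cmult[OF has_real_derivative_powr[OF that, of b], of c] by (simp add: mult_ac)
  then show "\<exists>F'\<in>{F. \<exists>b c. F = (\<lambda>t. c * t powr b)}. \<forall>t\<in>{0<..}. (F has_real_derivative F' t) (at t)"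
    by (intro bexI[of _ "\<lambda>t. (c * b) * t powr (b - 1)"]) auto
next
  show "(\<lambda>t. t powr a) \<in> {F. \<exists>b c. F = (\<lambda>t. c * t powr b)}" by (rule CollectI, rule exI[of _ a], rule exI[of _ 1]) simp
qed (use g in auto)

lemma td_on_ln:
  fixes g :: "real ^ 'n::finite \<Rightarrow> real"
  assumes S: "open S" and g: "td_on m S g" "\<And>x. x \<in> S \<Longrightarrow> g x > 0" shows "td_on m S (\<lambda>x. ln (g x))"
proof (rule td_on_compose[OF S, of "insert ln {F. \<exists>b c. F = (\<lambda>t. c * t powr b)}" "{0<..}", OF _ _ _ g(1)])
  fix F :: "real \<Rightarrow> real" assume "F \<in> insert ln {F. \<exists>b c. F = (\<lambda>t. c * t powr b)}"
  then consider "F = ln" | b c where "F = (\<lambda>t. c * t powr b)" by blast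
  then show "\<exists>F'\<in>insert ln {F. \<exists>b c. F = (\<lambda>t. c * t powr b)}. \<forall>t\<in>{0<..}. (F has_real_derivative F' t) (at t)"
  proof cases
    case 1
    have "(ln has_real_derivative 1 * t powr (-1)) (at t)" if "t > 0" for t
      using DERIV_ln[OF that] that by (simp add: powr_minus_divide inverse_eq_divide)
    with 1 have "\<forall>t\<in>{0<..}. (F has_real_derivative (\<lambda>t. 1 * t powr (-1)) t) (at t)" by blast
    then show ?thesis 
      by (rule bexI[of "\<lambda>F'. \<forall>t\<in>{0<..}. (F has_real_derivative F' t) (at t)" "\<lambda>t. 1 * t powr (-1)"]) blast
  next
    case (2 b c)
    have "(F has_real_derivative (c * b) * t powr (b - 1)) (at t)" if "t > 0" for t
      unfolding 2 using DERIV_cmult[OF has_real_derivative_powr[OF that, of b], of c] by (simp add: mult_ac)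
    then show ?thesis by (intro bexI[of _ "\<lambda>t. (c * b) * t powr (b - 1)"]) auto
  qed
qed (use g in auto)

text \<open>In the variable \<open>t = ln |x|\<close>, after removal of the factor
  \<open>|x| powr (- (d - 2) / 2)\<close>, this is a bump in \<open>2 * k * t\<close>, whose width
  grows like \<open>1 / k\<close>. It is written through \<open>|x|^2\<close>, a polynomial in the
  coordinates.\<close>

definition spread_bump :: "real \<Rightarrow> real ^ 'n::finite \<Rightarrow> 'k::{real_normed_field,euclidean_space}"
  where "spread_bump k x = (((norm x)^2) powr (- (real CARD('n) - 2) / 4) * bump (1 - (k * ln ((norm x)^2))^2)) *\<^sub>R 1"

lemma spread_bump_eq_0:
  fixes x :: "real ^ 'n::finite"
  assumes "x = 0 \<or> 1 \<le> \<bar>k * ln ((norm x)^2)\<bar>" shows "spread_bump k x = (0 :: 'k::{real_normed_field,euclidean_space})"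
proof (cases "x = 0")
  case False
  with assms have "1 \<le> \<bar>k * ln ((norm x)^2)\<bar>^2" by (intro one_le_power) auto
  then show ?thesis unfolding spread_bump_def by (subst bump_nonpos) auto
qed (simp add: spread_bump_def)


lemma spread_bump_inside:
  fixes x :: "real ^ 'n::finite"
  assumes k: "k > 0" and x: "norm x < exp (- (1 / (2 * k)))"
  shows "spread_bump k x = (0 :: 'k::{real_normed_field,euclidean_space})"
proof (rule spread_bump_eq_0, cases "x = 0")
  case False
  then have "ln (norm x) < ln (exp (- (1 / (2 * k))))" using x by (subst ln_less_cancel_iff) auto
  then have "ln (norm x) * (2 * k) < - 1" using k by (simp add: field_simps)
  moreover have "ln ((norm x)^2) = 2 * ln (norm x)" using False by (simp add: ln_realpow)
  ultimately have "k * ln ((norm x)^2) < - 1" by (simp add: mult_ac)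
  then show "x = 0 \<or> 1 \<le> \<bar>k * ln ((norm x)^2)\<bar>" by simp
qed simp

lemma spread_bump_outside:
  fixes x :: "real ^ 'n::finite"
  assumes k: "k > 0" and x: "exp (1 / (2 * k)) < norm x"
  shows "spread_bump k x = (0 :: 'k::{real_normed_field,euclidean_space})"
proof (rule spread_bump_eq_0)
  have x0: "norm x > 0" using x exp_gt_zero less_trans by blast
  then have "ln (exp (1 / (2 * k))) < ln (norm x)" using x by (subst ln_less_cancel_iff) auto
  then have "1 < ln (norm x) * (2 * k)" using k by (simp add: field_simps)
  moreover have "ln ((norm x)^2) = 2 * ln (norm x)" using x0 by (simp add: ln_realpow)
  ultimately have "1 < k * ln ((norm x)^2)" by (simp add: mult_ac)
  then show "x = 0 \<or> 1 \<le> \<bar>k * ln ((norm x)^2)\<bar>" by simp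
qed

text \<open>Away from the origin \<open>ln\<close> and \<open>powr\<close> of \<open>|x|^2\<close>
  are smooth; on a ball around it the function vanishes. These two open sets cover the
  space.\<close>

lemma spread_bump_smooth:
  assumes k: "k > 0"
  shows "(spread_bump k :: real ^ 'n::finite \<Rightarrow> 'k::{real_normed_field,euclidean_space}) \<in> smooth_compact_support"
proof (rule smooth_compact_supportI)
  fix m
  define S where "S = - {0::real^'n}"
  have S: "open S" by (simp add: S_def open_Compl)
  have nsq: "td_on m S (\<lambda>x. (norm x)^2)" using td_on_dist_sq[OF S, of m 0] by simp
  have pos: "x \<in> S \<Longrightarrow> (norm x)^2 > 0" for x by (simp add: S_def)
  have "td_on m S (\<lambda>x. 1 + (- (k^2)) * (ln ((norm x)^2) * ln ((norm x)^2)))"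
    by (intro td_on_add td_on_mult S td_on_const td_on_ln nsq pos)
  then have "td_on m S (\<lambda>x. 1 - (k * ln ((norm x)^2))^2)"
    by (rule td_on_cong[OF S, rotated]) (simp add: power2_eq_square)
  then have "td_on m S (spread_bump k :: real^'n \<Rightarrow> 'k)"
    unfolding spread_bump_def by (intro td_on_scaleR td_on_mult S td_on_const td_on_powr td_on_bump nsq pos)
  moreover have "td_on m (ball 0 (exp (- (1 / (2 * k))))) (spread_bump k :: real^'n \<Rightarrow> 'k)"
    by (rule td_on_cong[OF open_ball _ td_on_const[of _ _ 0]]) (simp add: spread_bump_inside[OF k])
  ultimately have "td_on m (S \<union> ball 0 (exp (- (1 / (2 * k))))) (spread_bump k :: real^'n \<Rightarrow> 'k)"
    by (intro td_on_Un S open_ball)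
  moreover have "S \<union> ball 0 (exp (- (1 / (2 * k)))) = UNIV" by (auto simp: S_def)
  ultimately show "td_on m UNIV (spread_bump k :: real^'n \<Rightarrow> 'k)" by simp
qed (rule spread_bump_outside[OF k])

text \<open>The bump depends on \<open>x\<close> only through \<open>k * ln |x|\<close>, which is
  what \<open>stretch k\<close> makes of \<open>ln |x|\<close>; the powers of the norm match by the
  choice of exponent in \<open>twist\<close>. The energies of all spread bumps thereby reduce to
  \<open>k = 1\<close>.\<close>

lemma spread_bump_twist:
  assumes k: "k > 0"
  shows "(spread_bump k :: real ^ 'n::finite \<Rightarrow> 'k::{real_normed_field,euclidean_space}) = twist k (spread_bump 1)"
proof
  fix x :: "real^'n"
  show "spread_bump k x = (twist k (spread_bump 1) x :: 'k)"
  proof (cases "x = 0")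
    case False
    define P where "P = norm x"
    have P: "P > 0" using False by (simp add: P_def)
    let ?m = "real CARD('n) - 2"
    have 1: "(P^2) powr (- ?m / 4) = P powr (- ?m / 2)"
    proof -
      have "P^2 = P powr 2" using P by simp
      then show ?thesis
        by (simp only: powr_powr) (rule arg_cong[of _ _ "(powr) P"], simp add: field_simps)
    qed
    have 2: "((P powr k)^2) powr (- ?m / 4) = P powr (- (k * ?m / 2))"
    proof -
      have "(P powr k)^2 = P powr (2 * k)" using P by (simp add: powr_power mult.commute)
      then show ?thesis
        by (simp only: powr_powr) (rule arg_cong[of _ _ "(powr) P"], simp add: field_simps)
    qed
    have 3: "P powr (?m * (k - 1) / 2) * P powr (- (k * ?m / 2)) = P powr (- ?m / 2)"
      unfolding powr_add[symmetric] by (rule arg_cong[of _ _ "(powr) P"]) (simp add: field_simps)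
    have "ln ((P powr k)^2) = k * ln (P^2)" using P by (simp add: ln_realpow ln_powr)
    then show ?thesis
      unfolding twist_def spread_bump_def norm_stretch P_def[symmetric] scaleR_scaleR 1 2 mult.assoc[symmetric] 3 by simp
  qed (simp add: spread_bump_def twist_def)
qed

lemma partial_scaleR_1:
  fixes f :: "real ^ 'n::finite \<Rightarrow> real"
  assumes "f differentiable at x"
  shows "partial_deriv i (\<lambda>x. f x *\<^sub>R (1::'k::{real_normed_field,euclidean_space})) x = partial_deriv i f x *\<^sub>R 1"
proof -
  have "((\<lambda>x. f x *\<^sub>R (1::'k)) has_derivative (\<lambda>h. frechet_derivative f (at x) h *\<^sub>R 1)) (at x)"
    using assms by (intro has_derivative_scaleR_left) (simp add: frechet_derivative_works)
  from partial_deriv_eq[OF this] show ?thesis by (simp add: partial_deriv_def)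
qed

text \<open>A function of \<open>|x|\<close> has its gradient along \<open>x\<close>, so there is no
  angular energy. By \<open>dirichlet_twist\<close>, the deficit of \<open>spread_bump k\<close> at
  the origin is then exactly \<open>k\<close> times that of \<open>spread_bump 1\<close>.\<close>

lemma spread_bump_radial:
  "radial_energy (spread_bump 1 :: real ^ 'n::finite \<Rightarrow> 'k::{real_normed_field,euclidean_space}) = dirichlet (spread_bump 1 :: real ^ 'n \<Rightarrow> 'k)"
  unfolding radial_energy_def dirichlet_def
proof (rule integral_cong_AE)
  let ?u = "spread_bump 1 :: real ^ 'n \<Rightarrow> 'k"
  note C = C1c_C1[OF smooth_C1c[OF spread_bump_smooth[of 1, where 'n = 'n and 'k = 'k]]]
  note [measurable] = radial_part_measurable[OF C] C1_gradient_borel[OF C]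
  show "(\<lambda>x. (norm (radial_part ?u x))^2 / (norm x)^2) \<in> borel_measurable lborel"
    "(\<lambda>x. (norm (gradient ?u x))^2) \<in> borel_measurable lborel" by measurable
  show "AE x in lborel. (norm (radial_part ?u x))^2 / (norm x)^2 = (norm (gradient ?u x))^2"
    using AE_lborel_singleton[of 0]
  proof eventually_elim
    case (elim x)
    define F where "F s = s powr (- (real CARD('n) - 2) / 4) * bump (1 - (1 * ln s)^2)" for s
    define s where "s = (norm x)^2"
    have s: "s > 0" using elim by (simp add: s_def)
    have b: "\<exists>B. (bump has_real_derivative B) (at t)" for t
      unfolding bump_def using flat_exp_has_derivative by blast
    have "F differentiable at s"
      unfolding F_def
    proof (intro differentiable_mult)
      show "(\<lambda>s. s powr (- (real CARD('n) - 2) / 4)) differentiable at s"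
        using has_real_derivative_powr[OF s] real_differentiable_def by blast
      have "bump differentiable at (1 - (1 * ln s)^2)" using b real_differentiable_def by blast
      moreover have "(\<lambda>s. 1 - (1 * ln s)^2) differentiable at s"
        using DERIV_ln[OF s] by (intro differentiable_diff differentiable_power differentiable_mult differentiable_const)
          (auto simp: real_differentiable_def)
      ultimately show "(\<lambda>s. bump (1 - (1 * ln s)^2)) differentiable at s"
        by (rule differentiable_compose[of bump])
    qed
    then obtain F' where F': "(F has_real_derivative F') (at ((norm (x - 0))^2))"
      unfolding s_def using real_differentiable_def by auto
    have u: "?u = (\<lambda>x. F ((norm (x - 0))^2) *\<^sub>R 1)" by (rule ext) (simp add: spread_bump_def F_def)
    have d: "(\<lambda>x. F ((norm (x - 0))^2)) differentiable at x"
      by (rule differentiable_compose[of F, OF _ differentiable_dist_sq]) (use F' real_differentiable_def in blast)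
    have "partial_deriv i ?u x = (F' * (2 * (x - 0) $ i)) *\<^sub>R 1" for i
      unfolding u partial_scaleR_1[OF d] partial_compose[OF F' differentiable_dist_sq] partial_dist_sq ..
    then have p: "partial_deriv i ?u x = (2 * F' * x $ i) *\<^sub>R 1" for i by (simp add: mult_ac)
    have "radial_part ?u x = (2 * F' * (norm x)^2) *\<^sub>R 1"
      unfolding radial_part_def p sum_coord_sq[symmetric]
      by (simp add: sum_distrib_left scaleR_sum_left power2_eq_square mult_ac)
    then have 1: "(norm (radial_part ?u x))^2 = 4 * F'^2 * (norm x) ^ 4" by (simp add: power_mult_distrib)
    have "(norm (gradient ?u x))^2 = (\<Sum>i\<in>UNIV. 4 * F'^2 * (x $ i)^2)"
      unfolding gradient_norm_sq p by (simp add: power_mult_distrib)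
    also have "\<dots> = 4 * F'^2 * (norm x)^2" by (simp add: sum_distrib_left[symmetric] sum_coord_sq)
    finally show ?case using elim unfolding 1 by (simp add: eval_nat_numeral)
  qed
qed

definition unit_bump :: "real ^ 'n::finite \<Rightarrow> 'k::{real_normed_field,euclidean_space}"
  where "unit_bump x = bump (1 - (norm x)^2) *\<^sub>R 1"

lemma unit_bump_outside: "1 \<le> norm x \<Longrightarrow> unit_bump x = 0"
  unfolding unit_bump_def by (subst bump_nonpos) (auto simp: one_le_power)

lemma td_on_unit_bump: "td_on m UNIV (\<lambda>x. unit_bump (x - y) :: 'k::{real_normed_field,euclidean_space})"
proof -
  have "td_on m UNIV (\<lambda>x. 1 + (- 1) * (norm (x - y))^2)"
    by (intro td_on_add td_on_mult open_UNIV td_on_const td_on_dist_sq)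
  then have "td_on m UNIV (\<lambda>x. 1 - (norm (x - y))^2)" by simp
  then show ?thesis
    unfolding unit_bump_def by (intro td_on_scaleR open_UNIV td_on_const td_on_bump)
qed

section \<open>Failure of the inequality for other exponents\<close>

lemma C1c_not_AE_zero:
  fixes u :: "real ^ 'n::finite \<Rightarrow> 'v::euclidean_space"
  assumes u: "C1c u" and x0: "u x0 \<noteq> 0"
  shows "\<not> (AE x in lborel. u x = 0)"
proof
  assume ae: "AE x in lborel. u x = 0"
  have op: "open {x. u x \<noteq> 0}"
    by (intro open_Collect_neq continuous_on_const C1_continuous[OF C1c_C1[OF u]])
  then obtain r where r: "r > 0" "ball x0 r \<subseteq> {x. u x \<noteq> 0}" using x0 by (auto simp: open_contains_ball)
  have "emeasure lborel {x. u x \<noteq> 0} = 0"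
    using ae op by (subst (asm) AE_iff_measurable[of "{x. u x \<noteq> 0}"]) auto
  then have "emeasure lborel (ball x0 r) = 0" using emeasure_mono[OF r(2), of lborel] op by simp
  then have "unit_ball_vol (real CARD('n)) * r ^ CARD('n) \<le> 0"
    using r(1) by (simp add: emeasure_ball ennreal_eq_0_iff)
  moreover have "0 < unit_ball_vol (real CARD('n)) * r ^ CARD('n)"
    using r(1) by (intro mult_pos_pos unit_ball_vol_pos zero_less_power) auto
  ultimately show False by linarith
qed

lemma C1c_integral_pos:
  fixes u :: "real ^ 'n::finite \<Rightarrow> 'v::euclidean_space" and f :: "real ^ 'n \<Rightarrow> real"
  assumes u: "C1c u" "u x0 \<noteq> 0" and f: "integrable lborel f" "\<And>x. 0 \<le> f x" "AE x in lborel. f x = 0 \<longrightarrow> u x = 0"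
  shows "0 < (LINT x|lborel. f x)"
proof (rule ccontr)
  assume "\<not> 0 < (LINT x|lborel. f x)"
  then have "(LINT x|lborel. f x) = 0" using Bochner_Integration.integral_nonneg[of lborel f] f(2) by (simp add: antisym)
  then have "AE x in lborel. f x = 0" using integral_nonneg_eq_0_iff_AE[OF f(1)] f(2) by simp
  with f(3) have "AE x in lborel. u x = 0" by eventually_elim simp
  with C1c_not_AE_zero[OF u] show False by simp
qed

lemma hardy_int_pos:
  fixes u :: "real ^ 'n::finite \<Rightarrow> 'v::euclidean_space"
  assumes u: "C1c u" "u x0 \<noteq> 0" and d: "3 \<le> CARD('n)"
  shows "0 < hardy_int u y"
  unfolding hardy_int_def
proof (rule C1c_integral_pos[OF u])
  show "AE x in lborel. (norm (u x))^2 / (norm (x - y))^2 = 0 \<longrightarrow> u x = 0"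
    using AE_lborel_singleton[of y] by eventually_elim simp
qed (use hardy[OF u(1) d, of y] in auto)

lemma powr_int_pos:
  fixes u :: "real ^ 'n::finite \<Rightarrow> 'v::euclidean_space"
  assumes u: "C1c u" "u x0 \<noteq> 0" and p: "0 < p"
  shows "0 < (LINT x|lborel. norm (u x) powr p)"
  by (rule C1c_integral_pos[OF u C1c_powr_integrable[OF u(1) p]]) auto

lemma Lp_norm_smooth:
  fixes u :: "real ^ 'n::finite \<Rightarrow> 'v::euclidean_space"
  assumes u: "C1c u" and p: "0 < p"
  shows "(Lp_norm p u)^2 = (LINT x|lborel. norm (u x) powr p) powr (2 / p)"
proof -
  note [measurable] = C1_borel[OF C1c_C1[OF u]]
  have "(\<lambda>x. norm (u x) powr p) \<in> borel_measurable borel" by measurable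
  from lebesgue_integral[OF this] have "Lp_norm p u = (LINT x|lborel. norm (u x) powr p) powr (1 / p)"
    by (simp add: Lp_norm_def)
  then show ?thesis by (simp add: power2_eq_square flip: powr_add)
qed

lemma smooth_not_AE_zero:
  fixes u :: "real ^ 'n::finite \<Rightarrow> 'v::euclidean_space"
  assumes u: "C1c u" "u x0 \<noteq> 0"
  shows "\<not> (AE x in lebesgue. u x = 0)"
proof
  assume ae: "AE x in lebesgue. u x = 0"
  note [measurable] = C1_borel[OF C1c_C1[OF u(1)]]
  have "(\<lambda>x. norm (u x) powr 1) \<in> borel_measurable borel" by measurable
  from lebesgue_integral[OF this] have "(LINT x|lborel. norm (u x) powr 1) = (LINT x|lebesgue. norm (u x) powr 1)" ..
  also have "\<dots> = 0" by (rule integral_eq_zero_AE) (use ae in \<open>eventually_elim, simp\<close>)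
  finally show False using powr_int_pos[OF u, of 1] by simp
qed

lemma hardy_sobolev_inequality_smooth_iff:
  fixes u :: "real ^ 'n::finite \<Rightarrow> 'k::{real_normed_field,euclidean_space}"
  assumes u: "u \<in> smooth_compact_support" and d: "3 \<le> CARD('n)"
  shows "hardy_sobolev_inequality \<theta> C u \<longleftrightarrow>
    C * (LINT x|lborel. norm (u x) powr (2 * real CARD('n) / (real CARD('n) - 2))) powr ((real CARD('n) - 2) / real CARD('n))
    \<le> (dirichlet u - (real CARD('n) - 2)^2 / 4 * hardy_sup u) powr \<theta> * hardy_sup u powr (1 - \<theta>)"
proof -
  have "0 < 2 * real CARD('n) / (real CARD('n) - 2)" using d by simp
  moreover have "2 / (2 * real CARD('n) / (real CARD('n) - 2)) = (real CARD('n) - 2) / real CARD('n)"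
    by (simp add: field_simps)
  ultimately show ?thesis
    using Lp_norm_smooth[OF smooth_C1c[OF u]]
    unfolding hardy_sobolev_inequality_def dirichlet_energy_smooth[OF u d] sobolev_exponent_def by metis
qed

text \<open>Since \<open>\<theta>\<close> is an arbitrary real number, the powers in the inequality
  may increase or decrease with their base; the sum of the values at both ends covers either
  case.\<close>

lemma powr_between:
  assumes "0 < l" "l \<le> x" "x \<le> (r::real)"
  shows "x powr a \<le> l powr a + r powr a"
proof (cases "a \<ge> 0")
  case True
  then have "x powr a \<le> r powr a" using assms by (intro powr_mono2) auto
  then show ?thesis by (simp add: add_increasing)
next
  case False
  then have "x powr a \<le> l powr a" using assms by (intro powr_mono2') auto
  then show ?thesis by (simp add: add_increasing2)
qed

text \<open>Power counting for \<open>spread_bump k\<close> as \<open>k\<close> tends to 0: the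
  deficit is at most \<open>k * a\<close>, the supremum is of order \<open>1 / k\<close>, and the
  \<open>L^p\<close> integral is \<open>X / k\<close>. Collecting powers, the inequality bounds a
  positive constant by a multiple of \<open>k powr (2 * \<theta> - 2 / n)\<close>, which tends to
  0.\<close>

theorem no_constant_large_theta:
  assumes d: "3 \<le> CARD('n::finite)" and \<theta>: "1 / real CARD('n) < \<theta>" and C: "0 < C"
    and ineq: "\<forall>u \<in> (dot_H1 :: (real ^ 'n \<Rightarrow> 'k::{real_normed_field,euclidean_space}) set).
      \<not> (AE x in lebesgue. u x = 0) \<longrightarrow> hardy_sobolev_inequality \<theta> C u"
  shows False
proof -
  let ?u = "spread_bump 1 :: real ^ 'n \<Rightarrow> 'k"
  have S: "(spread_bump k :: real ^ 'n \<Rightarrow> 'k) \<in> smooth_compact_support" if "k > 0" for k by (rule spread_bump_smooth[OF that])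
  note C1 = smooth_C1c[OF S[OF zero_less_one]]
  define n where "n = real CARD('n)"
  have n: "n \<ge> 3" using d by (simp add: n_def)
  have \<theta>0: "\<theta> > 0" using \<theta> n by (simp add: n_def less_trans[OF _ \<theta>])
  define c where "c = (n - 2)^2 / 4"
  have c: "c > 0" using n by (simp add: c_def)
  define q where "q = (n - 2) / n"
  obtain x0 :: "real^'n" where x0: "norm x0 = 1" using vector_choose_size[of 1] by auto
  have nz: "(spread_bump k x0 :: 'k) \<noteq> 0" for k using bump_pos[of 1] by (simp add: spread_bump_def x0)
  have away: "norm x < exp (- (1 / 2)) \<Longrightarrow> ?u x = 0" for x by (rule spread_bump_inside) auto
  define D where "D = dirichlet ?u"
  define h where "h = hardy_int ?u 0"
  define X where "X = (LINT x|lborel. norm (?u x) powr (2 * real CARD('n) / (real CARD('n) - 2)))"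
  define a where "a = D - c * h"
  have a: "a \<ge> 0" using hardy[OF C1 d, of 0] by (simp add: a_def D_def h_def c_def n_def)
  have h: "h > 0" unfolding h_def by (rule hardy_int_pos[OF C1 nz d])
  have D: "D > 0" using a mult_pos_pos[OF c h] by (simp add: a_def)
  have X: "X > 0" unfolding X_def by (rule powr_int_pos[OF C1 nz]) (use n in \<open>simp add: n_def\<close>)
  \<comment> \<open>The supremum is only bracketed between \<open>h / k\<close> and
    \<open>(D / c) / k\<close>; as the sign of \<open>1 - \<theta>\<close> is open, both ends
    enter.\<close>
  define B where "B = h powr (1 - \<theta>) + (D / c) powr (1 - \<theta>)"
  have main: "C * X powr q \<le> a powr \<theta> * B * k powr (2 * \<theta> - 2 / n)" if k: "k > 0" "k \<le> 1" for k
  proof -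
    let ?v = "spread_bump k :: real ^ 'n \<Rightarrow> 'k"
    note Cv = smooth_C1c[OF S[OF k(1)]]
    have k2: "k^2 \<le> 1" using k by (intro power_le_one) auto
    have Dv: "dirichlet ?v = (D + (k^2 - 1) * a) / k"
      unfolding spread_bump_twist[OF k(1)] D_def a_def h_def c_def n_def
      by (subst dirichlet_twist[OF C1 d exp_gt_zero[of "- (1 / 2)"] _ k(1)]) (rule away, simp_all add: spread_bump_radial)
    have hv: "hardy_int ?v 0 = h / k"
      unfolding spread_bump_twist[OF k(1)] h_def
      by (rule hardy_int_twist[OF C1 d exp_gt_zero[of "- (1 / 2)"] _ k(1)]) (rule away)
    have Xv: "(LINT x|lborel. norm (?v x) powr (2 * real CARD('n) / (real CARD('n) - 2))) = X / k"
      unfolding spread_bump_twist[OF k(1)] X_def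
      by (rule powr_int_twist[OF C1 d exp_gt_zero[of "- (1 / 2)"] _ k(1)]) (rule away)
    define H where "H = hardy_sup ?v"
    have hle: "hardy_int ?v y \<le> dirichlet ?v / c" for y
      using hardy_int_le[OF Cv d, of y] by (simp add: c_def n_def)
    have H1: "h / k \<le> H" unfolding H_def hv[symmetric] by (rule hardy_int_le_sup[OF Cv d])
    have H2: "H \<le> dirichlet ?v / c" unfolding H_def by (rule hardy_sup_le[OF Cv d hle])
    have "(k^2 - 1) * a \<le> 0" using k2 a by (simp add: mult_nonpos_nonneg)
    then have "dirichlet ?v \<le> D / k" unfolding Dv using k by (intro divide_right_mono) auto
    then have H3: "H \<le> (D / c) / k" using H2 c divide_right_mono[of "dirichlet ?v" "D / k" c] by (simp add: mult.commute)
    define A where "A = dirichlet ?v - c * H"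
    have A0: "A \<ge> 0" using H2 c by (simp add: A_def pos_le_divide_eq mult.commute)
    \<comment> \<open>The supremum dominates the Hardy integral about the origin, so
      \<open>A\<close> is at most the deficit there, in which the terms of order
      \<open>1 / k\<close> cancel.\<close>
    have "c * (h / k) \<le> c * H" using H1 c by (intro mult_left_mono) auto
    then have "A \<le> dirichlet ?v - c * (h / k)" unfolding A_def by linarith
    also have "\<dots> = k * a" unfolding Dv a_def using k by (simp add: field_simps power2_eq_square)
    finally have A1: "A powr \<theta> \<le> (k * a) powr \<theta>" using A0 \<theta>0 by (intro powr_mono2) auto
    have H4: "H powr (1 - \<theta>) \<le> B / k powr (1 - \<theta>)"
      using powr_between[OF _ H1 H3, of "1 - \<theta>"] h k D c by (simp add: B_def powr_divide powr_mult add_divide_distrib)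
    have "hardy_sobolev_inequality \<theta> C ?v"
      using ineq smooth_in_dot_H1(2)[OF S[OF k(1)] d] smooth_not_AE_zero[OF Cv nz] by blast
    then have "C * (X / k) powr q \<le> A powr \<theta> * H powr (1 - \<theta>)"
      unfolding hardy_sobolev_inequality_smooth_iff[OF S[OF k(1)] d] Xv A_def H_def q_def n_def c_def .
    also have "\<dots> \<le> (k * a) powr \<theta> * (B / k powr (1 - \<theta>))"
      by (intro mult_mono A1 H4) auto
    finally have "C * (X / k) powr q * k powr q \<le> (k * a) powr \<theta> * (B / k powr (1 - \<theta>)) * k powr q"
      by (rule mult_right_mono) simp
    moreover have "C * (X / k) powr q * k powr q = C * X powr q" using X k by (simp add: powr_divide)
    moreover have "(k * a) powr \<theta> * (B / k powr (1 - \<theta>)) * k powr q = a powr \<theta> * B * k powr (\<theta> - (1 - \<theta>) + q)"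
      using a k by (simp only: powr_add powr_diff powr_mult) (simp add: field_simps)
    moreover have "\<theta> - (1 - \<theta>) + q = 2 * \<theta> - 2 / n" using n by (simp add: q_def field_simps)
    ultimately show ?thesis by (simp only:)
  qed
  have e: "2 * \<theta> - 2 / n > 0" using \<theta> by (simp add: n_def)
  have "(\<lambda>N. a powr \<theta> * B * inverse (real (Suc N)) powr (2 * \<theta> - 2 / n)) \<longlonglongrightarrow> a powr \<theta> * B * 0"
    by (intro tendsto_mult tendsto_const tendsto_zero_powrI[OF LIMSEQ_inverse_real_of_nat tendsto_const]) (use e in auto)
  then have "C * X powr q \<le> a powr \<theta> * B * 0"
    by (rule LIMSEQ_le_const) (auto intro!: main simp: inverse_le_1_iff)
  then show False using C X by (simp add: mult_le_0_iff)
qed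

section \<open>Chains of distant bumps\<close>

lemma sum_at_most_one:
  assumes "finite A" "\<And>j k. j \<in> A \<Longrightarrow> k \<in> A \<Longrightarrow> j \<noteq> k \<Longrightarrow> a j = 0 \<or> a k = 0" "F 0 = 0"
  shows "F (\<Sum>j\<in>A. a j) = (\<Sum>j\<in>A. F (a j))"
proof (cases "\<forall>j\<in>A. a j = 0")
  case True
  then show ?thesis using assms(3) by simp
next
  case False
  then obtain j where j: "j \<in> A" "a j \<noteq> 0" by blast
  then have "a k = 0" if "k \<in> A - {j}" for k using assms(2)[of j k] that by auto
  then have "(\<Sum>j\<in>A. a j) = a j" "(\<Sum>j\<in>A. F (a j)) = F (a j)"
    using assms(1,3) j(1) by (simp_all add: sum.remove[of A j])
  then show ?thesis by simp
qed

lemma td_on_sum: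
  assumes "open S" "finite A" "\<And>j. j \<in> A \<Longrightarrow> td_on m S (f j)"
  shows "td_on m S (\<lambda>x. \<Sum>j\<in>A. f j x)"
  using assms(2,3) by (induction A rule: finite_induct) (auto intro: td_on_const td_on_add assms(1))

lemma partial_sum:
  assumes "\<And>j. j \<in> A \<Longrightarrow> f j differentiable at x"
  shows "partial_deriv i (\<lambda>x. \<Sum>j\<in>A. f j x) x = (\<Sum>j\<in>A. partial_deriv i (f j) x)"
proof -
  have "((\<lambda>x. \<Sum>j\<in>A. f j x) has_derivative (\<lambda>h. \<Sum>j\<in>A. frechet_derivative (f j) (at x) h)) (at x)"
    by (intro has_derivative_sum) (use assms in \<open>auto simp: frechet_derivative_works\<close>)
  from partial_deriv_eq[OF this] show ?thesis by (simp add: partial_deriv_def)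
qed

lemma unit_bump_smooth:
  "(unit_bump :: real ^ 'n::finite \<Rightarrow> 'k::{real_normed_field,euclidean_space}) \<in> smooth_compact_support"
proof (rule smooth_compact_supportI)
  show "td_on m UNIV (unit_bump :: real ^ 'n \<Rightarrow> 'k)" for m by (rule td_on_unit_bump[of m 0, simplified])
  show "(unit_bump x :: 'k) = 0" if "1 < norm x" for x :: "real ^ 'n" by (rule unit_bump_outside) (use that in simp)
qed

lemma hardy_int_unit_bump_far:
  fixes z :: "real ^ 'n::finite"
  assumes d: "3 \<le> CARD('n)" and s: "0 < s" "s + 1 \<le> norm z"
  shows "hardy_int (unit_bump :: real ^ 'n \<Rightarrow> 'k::{real_normed_field,euclidean_space}) z \<le> (LINT x|lborel. (norm (unit_bump (x :: real ^ 'n) :: 'k))^2) / s^2"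
proof -
  let ?u = "unit_bump :: real ^ 'n \<Rightarrow> 'k"
  note C = smooth_C1c[OF unit_bump_smooth[where 'n = 'n and 'k = 'k]]
  have "hardy_int ?u z \<le> (LINT x|lborel. (norm (?u x))^2 / s^2)"
    unfolding hardy_int_def
  proof (rule integral_mono)
    show "integrable lborel (\<lambda>x. (norm (?u x))^2 / (norm (x - z))^2)" using hardy[OF C d, of z] by blast
    show "integrable lborel (\<lambda>x. (norm (?u x))^2 / s^2)" using C1c_power_integrable[OF C, of 2] by simp
    fix x
    show "(norm (?u x))^2 / (norm (x - z))^2 \<le> (norm (?u x))^2 / s^2"
    proof (cases "1 \<le> norm x")
      case False
      have "norm z \<le> norm x + norm (x - z)" using norm_triangle_ineq4[of x "x - z"] by simp
      then have "s \<le> norm (x - z)" using False s by linarith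
      then show ?thesis using s by (intro divide_left_mono power_mono mult_pos_pos zero_less_power) auto
    qed (simp add: unit_bump_outside)
  qed
  then show ?thesis by simp
qed

text \<open>The spacing \<open>2 * N + 4\<close> ensures that a point has at most one centre at
  distance less than \<open>N + 2\<close>; the other bumps, of radius 1, then stay at distance at
  least \<open>N + 1\<close>, and \<open>N\<close> contributions of order
  \<open>1 / (N + 1)^2\<close> remain bounded. The coordinate direction \<open>undefined\<close> is
  arbitrary.\<close>

definition bump_chain :: "nat \<Rightarrow> real ^ 'n::finite \<Rightarrow> 'k::{real_normed_field,euclidean_space}"
  where "bump_chain N x = (\<Sum>j<N. unit_bump (x - (real j * (2 * real N + 4)) *\<^sub>R axis undefined 1))"

context
  fixes N :: nat and c :: "nat \<Rightarrow> real ^ 'n::finite"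
  assumes d: "3 \<le> CARD('n)"
  defines "c \<equiv> \<lambda>j. (real j * (2 * real N + 4)) *\<^sub>R axis undefined 1"
begin

lemma centers_far: "j \<noteq> k \<Longrightarrow> 2 * real N + 4 \<le> dist (c j) (c k)"
proof -
  assume jk: "j \<noteq> k"
  have "1 \<le> \<bar>real j - real k\<bar>" using jk by linarith
  then have "2 * real N + 4 \<le> \<bar>real j - real k\<bar> * (2 * real N + 4)" by (simp add: mult_le_cancel_right1)
  also have "\<dots> = dist (c j) (c k)"
    unfolding c_def dist_norm scaleR_diff_left[symmetric] left_diff_distrib[symmetric] by (simp add: abs_mult)
  finally show ?thesis .
qed

lemma close_to_one_center: "norm (x - c j) < real N + 2 \<Longrightarrow> norm (x - c k) < real N + 2 \<Longrightarrow> j = k"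
proof (rule ccontr)
  assume a: "norm (x - c j) < real N + 2" "norm (x - c k) < real N + 2" "j \<noteq> k"
  have "dist (c j) (c k) \<le> dist (c j) x + dist x (c k)" by (rule dist_triangle)
  then show False using centers_far[OF a(3)] a(1,2) by (simp add: dist_norm norm_minus_commute)
qed

lemma chain_smooth: "(bump_chain N :: real ^ 'n \<Rightarrow> 'k::{real_normed_field,euclidean_space}) \<in> smooth_compact_support"
proof (rule smooth_compact_supportI)
  show "td_on m UNIV (bump_chain N :: real ^ 'n \<Rightarrow> 'k)" for m
    unfolding bump_chain_def by (intro td_on_sum open_UNIV finite_lessThan td_on_unit_bump)
  fix x :: "real ^ 'n" assume x: "1 + real N * (2 * real N + 4) < norm x"
  have "unit_bump (x - c j) = (0 :: 'k)" if "j < N" for j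
  proof (rule unit_bump_outside)
    have "norm (c j) = real j * (2 * real N + 4)" by (simp add: c_def)
    also have "\<dots> \<le> real N * (2 * real N + 4)" using that by (intro mult_right_mono) auto
    finally show "1 \<le> norm (x - c j)" using x norm_triangle_ineq2[of x "c j"] by linarith
  qed
  then show "bump_chain N x = (0 :: 'k)" by (simp add: bump_chain_def c_def)
qed

lemma at_most_one_bump_nonzero:
  assumes "j \<noteq> k"
  shows "unit_bump (x - c j) = (0 :: 'k::{real_normed_field,euclidean_space}) \<or> unit_bump (x - c k) = (0 :: 'k)"
    "partial_deriv i (\<lambda>x. unit_bump (x - c j) :: 'k) x = 0 \<or> partial_deriv i (\<lambda>x. unit_bump (x - c k) :: 'k) x = 0"
proof -
  have or: "1 < norm (x - c j) \<or> 1 < norm (x - c k)" using close_to_one_center[of x j k] assms by fastforce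
  then show "unit_bump (x - c j) = (0 :: 'k) \<or> unit_bump (x - c k) = (0 :: 'k)"
    using unit_bump_outside less_imp_le by blast
  have "partial_deriv i (\<lambda>x. unit_bump (x - c l) :: 'k) x = 0" if "1 < norm (x - c l)" for l
  proof (rule partial_deriv_eq_0[of "{x. 1 < norm (x - c l)}"])
    show "open {x. 1 < norm (x - c l)}" by (intro open_Collect_less continuous_intros)
  qed (use that unit_bump_outside less_imp_le in auto)
  with or show "partial_deriv i (\<lambda>x. unit_bump (x - c j) :: 'k) x = 0 \<or> partial_deriv i (\<lambda>x. unit_bump (x - c k) :: 'k) x = 0" by blast
qed

lemma chain_energies:
  shows "dirichlet (bump_chain N :: real ^ 'n \<Rightarrow> 'k::{real_normed_field,euclidean_space}) = real N * dirichlet (unit_bump :: real ^ 'n \<Rightarrow> 'k)"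
    and "hardy_int (bump_chain N :: real ^ 'n \<Rightarrow> 'k) y = (\<Sum>j<N. hardy_int (unit_bump :: real ^ 'n \<Rightarrow> 'k) (y - c j))"
    and "0 < p \<Longrightarrow> (LINT x|lborel. norm (bump_chain N (x :: real ^ 'n) :: 'k) powr p) = real N * (LINT x|lborel. norm (unit_bump (x :: real ^ 'n) :: 'k) powr p)"
proof -
  let ?u = "unit_bump :: real ^ 'n \<Rightarrow> 'k"
  note C = smooth_C1c[OF unit_bump_smooth[where 'n = 'n and 'k = 'k]]
  note [measurable] = C1_borel[OF C1c_C1[OF C]]
  have Ct: "C1c (\<lambda>x. ?u (x - c j))" for j using C1c_translate[OF C, of "- c j"] by simp
  have chain: "bump_chain N x = (\<Sum>j<N. ?u (x - c j))" for x by (simp add: bump_chain_def c_def)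
  have chain': "(bump_chain N :: real ^ 'n \<Rightarrow> 'k) = (\<lambda>x. \<Sum>j<N. ?u (x - c j))" by (rule ext) (rule chain)
  have "(norm (gradient (bump_chain N :: real ^ 'n \<Rightarrow> 'k) x))^2 = (\<Sum>j<N. (norm (gradient (\<lambda>x. ?u (x - c j)) x))^2)" for x
  proof -
    have "(norm (partial_deriv i (bump_chain N :: real ^ 'n \<Rightarrow> 'k) x))^2 = (\<Sum>j<N. (norm (partial_deriv i (\<lambda>x. ?u (x - c j)) x))^2)" for i
      unfolding chain' partial_sum[OF C1_differentiable[OF C1c_C1[OF Ct]]]
      by (rule sum_at_most_one[where F = "\<lambda>v. (norm v)^2"]) (use at_most_one_bump_nonzero(2) in auto)
    then show ?thesis unfolding gradient_norm_sq by (simp add: sum.swap[of _ UNIV])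
  qed
  then have "dirichlet (bump_chain N :: real ^ 'n \<Rightarrow> 'k) = (\<Sum>j<N. dirichlet (\<lambda>x. ?u (x - c j)))"
    unfolding dirichlet_def by (simp add: dirichlet_integrable[OF Ct])
  also have "\<dots> = real N * dirichlet ?u" using dirichlet_translate[OF C, of "- c _"] by simp
  finally show "dirichlet (bump_chain N :: real ^ 'n \<Rightarrow> 'k) = real N * dirichlet ?u" .
  have "(norm (bump_chain N x :: 'k))^2 / (norm (x - y))^2 = (\<Sum>j<N. (norm (?u (x - c j)))^2 / (norm (x - y))^2)" for x
    unfolding chain by (rule sum_at_most_one[where F = "\<lambda>v. (norm v)^2 / (norm (x - y))^2"]) (use at_most_one_bump_nonzero(1) in auto)
  then have "hardy_int (bump_chain N :: real ^ 'n \<Rightarrow> 'k) y = (\<Sum>j<N. hardy_int (\<lambda>x. ?u (x - c j)) y)"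
    unfolding hardy_int_def using hardy[OF Ct d] by simp
  also have "\<dots> = (\<Sum>j<N. hardy_int ?u (y - c j))" using hardy_int_translate[OF C, of "- c _"] by simp
  finally show "hardy_int (bump_chain N :: real ^ 'n \<Rightarrow> 'k) y = (\<Sum>j<N. hardy_int ?u (y - c j))" .
  show "(LINT x|lborel. norm (bump_chain N (x :: real ^ 'n) :: 'k) powr p) = real N * (LINT x|lborel. norm (?u x) powr p)" if p: "0 < p"
  proof -
    have "norm (bump_chain N x :: 'k) powr p = (\<Sum>j<N. norm (?u (x - c j)) powr p)" for x
      unfolding chain by (rule sum_at_most_one[where F = "\<lambda>v. norm v powr p"]) (use at_most_one_bump_nonzero(1) in auto)
    then have "(LINT x|lborel. norm (bump_chain N (x :: real ^ 'n) :: 'k) powr p) = (\<Sum>j<N. LINT x|lborel. norm (?u (x - c j)) powr p)"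
      by (simp add: C1c_powr_integrable[OF Ct p])
    also have "\<dots> = real N * (LINT x|lborel. norm (?u x) powr p)"
      using integral_translate[of "\<lambda>x. norm (?u x) powr p" "- c _"] by simp
    finally show ?thesis .
  qed
qed

text \<open>This separates the supremum from the other functionals: it stays bounded in
  \<open>N\<close>, while those grow linearly. A near bump costs at most \<open>b\<close>, the far
  ones together at most \<open>W\<close>.\<close>

lemma chain_hardy_le:
  assumes b: "\<And>z. hardy_int (unit_bump :: real ^ 'n \<Rightarrow> 'k::{real_normed_field,euclidean_space}) z \<le> b" "0 \<le> b"
  shows "hardy_int (bump_chain N :: real ^ 'n \<Rightarrow> 'k) y \<le> b + (LINT x|lborel. (norm (unit_bump (x :: real ^ 'n) :: 'k))^2)"
proof -
  define W where "W = (LINT x|lborel. (norm (unit_bump (x :: real ^ 'n) :: 'k))^2)"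
  have W: "0 \<le> W" by (simp add: W_def)
  let ?near = "\<lambda>j. norm (y - c j) < real N + 2"
  have "hardy_int (unit_bump :: real ^ 'n \<Rightarrow> 'k) (y - c j) \<le> W / (real N + 1)^2 + (if ?near j then b else 0)" for j
  proof (cases "?near j")
    case True
    then show ?thesis using b(1)[of "y - c j"] W by (simp add: add_increasing)
  next
    case False
    then show ?thesis using hardy_int_unit_bump_far[OF d, of "real N + 1" "y - c j", where 'k = 'k] by (simp add: W_def)
  qed
  then have "hardy_int (bump_chain N :: real ^ 'n \<Rightarrow> 'k) y \<le> (\<Sum>j<N. W / (real N + 1)^2 + (if ?near j then b else 0))"
    unfolding chain_energies(2) by (intro sum_mono)
  also have "\<dots> = real N * (W / (real N + 1)^2) + real (card {j \<in> {..<N}. ?near j}) * b"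
    by (simp add: sum.distrib sum.If_cases Int_def)
  also have "\<dots> \<le> 1 * W + 1 * b"
  proof (intro add_mono)
    have "real N \<le> (real N + 1)^2" by (simp add: power2_eq_square algebra_simps add_nonneg_nonneg)
    then have "real N / (real N + 1)^2 \<le> 1" by (simp add: divide_le_eq)
    from mult_right_mono[OF this W] show "real N * (W / (real N + 1)^2) \<le> 1 * W" by simp
    have "card {j \<in> {..<N}. ?near j} \<le> 1"
      by (rule card_le_Suc0_iff_eq[THEN iffD2, folded One_nat_def]) (use close_to_one_center in auto)
    then show "real (card {j \<in> {..<N}. ?near j}) * b \<le> 1 * b" using b(2) by (intro mult_right_mono) auto
  qed
  finally show ?thesis by (simp add: W_def)
qed

end

text \<open>Power counting for \<open>bump_chain N\<close> as \<open>N\<close> tends to infinity: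
  the deficit is of order \<open>N\<close>, the supremum bounded, the \<open>L^p\<close> integral
  equal to \<open>N * X\<close>. The inequality would bound \<open>N powr q\<close> by a constant
  times \<open>N powr \<theta>\<close>, with \<open>\<theta> < q\<close>.\<close>

theorem no_constant_small_theta:
  assumes d: "3 \<le> CARD('n::finite)" and \<theta>: "\<theta> < (real CARD('n) - 2) / real CARD('n)" and C: "0 < C"
    and ineq: "\<forall>u \<in> (dot_H1 :: (real ^ 'n \<Rightarrow> 'k::{real_normed_field,euclidean_space}) set).
      \<not> (AE x in lebesgue. u x = 0) \<longrightarrow> hardy_sobolev_inequality \<theta> C u"
  shows False
proof -
  let ?u = "unit_bump :: real ^ 'n \<Rightarrow> 'k"
  note Cu = smooth_C1c[OF unit_bump_smooth[where 'n = 'n and 'k = 'k]]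
  have nz: "?u 0 \<noteq> 0" using bump_pos[of 1] by (simp add: unit_bump_def)
  define n where "n = real CARD('n)"
  have n: "n \<ge> 3" using d by (simp add: n_def)
  define q where "q = (n - 2) / n"
  define p where "p = 2 * real CARD('n) / (real CARD('n) - 2)"
  have p: "p > 0" using n by (simp add: p_def n_def)
  have \<theta>q: "\<theta> < q" and q1: "q < 1" using \<theta> n by (auto simp: q_def n_def)
  define c where "c = (n - 2)^2 / 4"
  have c: "c > 0" using n by (simp add: c_def)
  define D where "D = dirichlet ?u"
  have hle: "hardy_int ?u z \<le> D / c" for z using hardy_int_le[OF Cu d, of z] by (simp add: D_def c_def n_def)
  have D: "D > 0"
    using less_le_trans[OF hardy_int_pos[OF Cu nz d] hle[of 0]] c by (simp add: zero_less_divide_iff)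
  define X where "X = (LINT x|lborel. norm (?u x) powr p)"
  have X: "X > 0" unfolding X_def by (rule powr_int_pos[OF Cu nz p])
  define B where "B = D / c + (LINT x|lborel. (norm (?u x))^2)"
  have B: "B > 0" unfolding B_def using D c by (intro add_pos_nonneg) auto
  define K where "K = (D / 2) powr \<theta> + D powr \<theta>"
  \<comment> \<open>Beyond this threshold \<open>c * H\<close> is at most half of the energy
    \<open>N * D\<close>, so the deficit lies between \<open>N * D / 2\<close> and
    \<open>N * D\<close>; \<open>K\<close> takes care of either sign of
    \<open>\<theta>\<close>.\<close>
  have main: "C * X powr q \<le> K * B powr (1 - \<theta>) * real N powr (\<theta> - q)" if N: "real N > 2 * c * B / D" for N
  proof -
    let ?v = "bump_chain N :: real ^ 'n \<Rightarrow> 'k"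
    have "0 < 2 * c * B / D" using B c D by simp
    then have N0: "real N > 0" using N by linarith
    note S = chain_smooth[OF d, of N, where 'k = 'k]
    note Cv = smooth_C1c[OF S]
    have Dv: "dirichlet ?v = real N * D" by (simp add: D_def chain_energies(1)[OF d])
    have Xv: "(LINT x|lborel. norm (?v x) powr p) = real N * X" by (simp add: X_def chain_energies(3)[OF d p])
    have "\<exists>x. ?v x \<noteq> 0"
    proof (rule ccontr)
      assume "\<not> (\<exists>x. ?v x \<noteq> 0)"
      then have "(LINT x|lborel. norm (?v x) powr p) = 0" by simp
      then show False using Xv N0 X by simp
    qed
    then obtain x1 where x1: "?v x1 \<noteq> 0" by blast
    define H where "H = hardy_sup ?v"
    have HB: "H \<le> B" unfolding H_def B_def
      by (intro hardy_sup_le[OF Cv d] chain_hardy_le[OF d hle]) (use D c in simp)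
    have H0: "H \<ge> 0" using hardy_int_le_sup[OF Cv d, of 0] hardy_int_nonneg[of ?v 0] by (simp add: H_def)
    define A where "A = dirichlet ?v - c * H"
    have A1: "A \<le> real N * D" using H0 c by (simp add: A_def Dv)
    have "c * H \<le> c * B" using HB c by simp
    moreover have "2 * (c * B) < real N * D" using N D by (simp add: divide_less_eq mult.assoc)
    ultimately have "c * H \<le> (real N * D) / 2" by linarith
    then have A2: "real N * (D / 2) \<le> A" unfolding A_def Dv times_divide_eq_right by linarith
    have A3: "A powr \<theta> \<le> real N powr \<theta> * K"
      using powr_between[OF mult_pos_pos[OF N0] A2 A1, of \<theta>] D unfolding powr_mult K_def distrib_left by simp
    \<comment> \<open>Here \<open>1 - \<theta> > 0\<close> because \<open>\<theta> < q < 1\<close>,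
      so an upper bound for \<open>H\<close> suffices.\<close>
    have H1: "H powr (1 - \<theta>) \<le> B powr (1 - \<theta>)" using H0 HB \<theta>q q1 by (intro powr_mono2) auto
    have "hardy_sobolev_inequality \<theta> C ?v"
      using ineq smooth_in_dot_H1(2)[OF S d] smooth_not_AE_zero[OF Cv x1] by blast
    then have "C * (real N * X) powr q \<le> A powr \<theta> * H powr (1 - \<theta>)"
      unfolding hardy_sobolev_inequality_smooth_iff[OF S d] p_def[symmetric] Xv A_def H_def q_def n_def c_def .
    also have "\<dots> \<le> (real N powr \<theta> * K) * B powr (1 - \<theta>)"
      using A3 H1 by (intro mult_mono) (auto simp: K_def)
    finally have "C * X powr q * real N powr q \<le> K * B powr (1 - \<theta>) * real N powr \<theta>"
      using N0 X by (simp add: powr_mult mult_ac)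
    then have "C * X powr q \<le> K * B powr (1 - \<theta>) * real N powr \<theta> / real N powr q"
      using N0 by (subst pos_le_divide_eq) auto
    then show ?thesis by (simp add: powr_diff)
  qed
  have "(\<lambda>N. K * B powr (1 - \<theta>) * real N powr (\<theta> - q)) \<longlonglongrightarrow> K * B powr (1 - \<theta>) * 0"
    by (intro tendsto_mult tendsto_const tendsto_neg_powr filterlim_real_sequentially) (use \<theta>q in simp)
  moreover have "\<exists>N0. \<forall>N\<ge>N0. C * X powr q \<le> K * B powr (1 - \<theta>) * real N powr (\<theta> - q)"
  proof -
    obtain N0 where "2 * c * B / D < real N0" using reals_Archimedean2 by blast
    then have "C * X powr q \<le> K * B powr (1 - \<theta>) * real N powr (\<theta> - q)" if "N \<ge> N0" for N
      using that by (intro main) (meson less_le_trans of_nat_le_iff)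
    then show ?thesis by blast
  qed
  ultimately have "C * X powr q \<le> K * B powr (1 - \<theta>) * 0" by (rule LIMSEQ_le_const)
  then show False using C X by (simp add: mult_le_0_iff)
qed

theorem theorem1:
  fixes \<theta> :: real
  assumes "CARD('n::finite) \<ge> 3"
  shows
    "(CARD('n) = 3 \<and> \<theta> = 1 / 3 \<longrightarrow>
       (\<exists>C>0. \<forall>u \<in> (dot_H1 :: (real ^ 'n \<Rightarrow> 'k::{real_normed_field,euclidean_space}) set).
          hardy_sobolev_inequality \<theta> C u)) \<and>
     (CARD('n) \<ge> 4 \<or> \<theta> \<noteq> 1 / 3 \<longrightarrow>
       \<not> (\<exists>C>0. \<forall>u \<in> (dot_H1 :: (real ^ 'n \<Rightarrow> 'k) set).
          \<not> (AE x in lebesgue. u x = 0) \<longrightarrow> hardy_sobolev_inequality \<theta> C u))"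
proof (intro conjI impI notI)
  assume "CARD('n) = 3 \<and> \<theta> = 1 / 3"
  then have d: "CARD('n) = 3" and \<theta>: "\<theta> = 1 / 3" by auto
  show "\<exists>C>0. \<forall>u \<in> (dot_H1 :: (real ^ 'n \<Rightarrow> 'k) set). hardy_sobolev_inequality \<theta> C u"
    unfolding \<theta> by (rule hardy_sobolev_inequality_dim_3[OF d])
next
  assume "CARD('n) \<ge> 4 \<or> \<theta> \<noteq> 1 / 3"
    and "\<exists>C>0. \<forall>u \<in> (dot_H1 :: (real ^ 'n \<Rightarrow> 'k) set).
          \<not> (AE x in lebesgue. u x = 0) \<longrightarrow> hardy_sobolev_inequality \<theta> C u"
  then obtain C where C: "0 < C" "\<forall>u \<in> (dot_H1 :: (real ^ 'n \<Rightarrow> 'k) set).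
          \<not> (AE x in lebesgue. u x = 0) \<longrightarrow> hardy_sobolev_inequality \<theta> C u" by blast
  have "\<not> 1 / real CARD('n) < \<theta>" using no_constant_large_theta[OF assms _ C] by blast
  moreover have "\<not> \<theta> < (real CARD('n) - 2) / real CARD('n)" using no_constant_small_theta[OF assms _ C] by blast
  \<comment> \<open>Both follow from \<open>(d - 2) / d \<le> \<theta> \<le> 1 / d\<close>.\<close>
  ultimately have "real CARD('n) - 2 \<le> 1" and "CARD('n) = 3 \<Longrightarrow> \<theta> = 1 / 3"
    using assms divide_le_cancel[of "real CARD('n) - 2" "real CARD('n)" 1] by auto
  with \<open>CARD('n) \<ge> 4 \<or> \<theta> \<noteq> 1 / 3\<close> assms show False by auto
qed

end
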